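(* Let $(n_j)_{j\ge 1}$ be a sequence of integers $n_j\geq 2$ with $n_j\to\infty$ such that each $n_j$ has the form $n_j=\prod_{k=1}^{m_j}p_k^{\beta_{k}^{(j)}}$, where $m_j\ge 1$ is an integer and $\beta_1^{(j)}\ge\beta_2^{(j)}\ge\cdots\ge\beta_{m_j}^{(j)}\ge 1$ are integers. Define $\varepsilon_{m_j}(n_j)$ by $n_j=\left(\prod_{k=1}^{m_j}p_k\right)^{1+\varepsilon_{m_j}(n_j)}$. If $\lim_{j\to\infty}\varepsilon_{m_j}(n_j)$ exists and is $>0$, or $\lim_{j\to\infty}\varepsilon_{m_j}(n_j)=+\infty$, then $$\lim_{j\to\infty}\left(e^{\gamma}n_j\log\log n_j-\sigma(n_j)\right)=+\infty.$$
   Context: $p_k$ denotes the $k$-th prime number in ascending order, $\sigma(n)=\sum_{d\mid n}d$ is the sum-of-divisors function, $\gamma$ is Euler's constant, and $\log$ is the natural logarithm. Equivalently, $\varepsilon_{m}(n)=\left(\log\prod_{k=1}^{m}p_k^{\beta_k}\right)\left(\log\prod_{k=1}^{m}p_k\right)^{-1}-1\ge 0$ for $n=\prod_{k=1}^m p_k^{\beta_k}$. *)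

theory Defs
  imports "HOL-Analysis.Analysis" "HOL-Computational_Algebra.Primes"
begin

(* Infinite_Set.enumerate counts from 0; the shift gives nth_prime 1 = 2, nth_prime 2 = 3, etc.
   The value at 0 is meaningless. *)
definition nth_prime :: "nat \<Rightarrow> nat" where
  "nth_prime k = enumerate {p. prime p} (k - 1)"

(* Only meaningful for n > 0: every number divides 0, and the sum over an infinite set is 0. *)
definition divisor_sum :: "nat \<Rightarrow> nat" where
  "divisor_sum n = (\<Sum>d | d dvd n. d)"

end

theory Submission
  imports Defs "HOL-Complex_Analysis.Complex_Analysis" "HOL-Number_Theory.Prime_Powers"
begin

text \<open>
  For $n = \prod_{k \le m} p_k^{\beta_k}$ the quotient $\sigma(n)/n$ is at most
  $Q(y) = \prod_{p \le y} (1 - 1/p)^{-1}$ with $y = p_m$. On the other side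
  the definition of $\varepsilon$ says $\log n = (1 + \varepsilon)\,\theta(y)$, hence
  $\log\log n = \log\theta(y) + \log(1 + \varepsilon)$, and by assumption $\log(1 + \varepsilon)$
  eventually stays above a positive constant. The theorem therefore rests on
  $$Q(y) \le e^\gamma\,(\log\theta(y) + o(1)),$$
  which is \<open>mertens_product_le_ln_theta\<close>: it gives a difference of at least a constant times $n$ when $y$
  is large, and when $y$ stays bounded so does $Q(y)$, while $\log\log n$ tends to infinity.

  With $O(1)$ in place of $o(1)$ this inequality would be elementary; the form needed here has the
  strength of the prime number theorem. It combines $\theta(y) \sim y$ (\<open>prime_number_theorem_theta\<close>)
  with $\sum_{p \le y} 1/p = \log\log y + M + o(1/\log y)$ (\<open>mertens_second_theorem\<close>). Both are
  consequences, by partial summation, of the convergence of $\sum_k (\Lambda(k) - 1)/k$.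

  That convergence comes from complex analysis. Newman's theorem (\<open>newman_tauberian\<close>) says that a
  Dirichlet series with bounded coefficients converges at a boundary point of its half-plane if its sum
  extends holomorphically across the boundary line. It is applied to the bounded coefficients
  $\psi(k)/k - 1$, where $\psi(x) = \sum_{k \le x} \Lambda(k)$; boundedness is Chebyshev's estimate, and the
  continuation comes from that of $\zeta$ together with $\zeta \ne 0$ on $\mathrm{Re}\, s = 1$
  (\<open>zeta_reg_nonzero\<close>). The monotonicity of $\psi$ then yields $\psi(x) \sim x$.

  Finally $M$ has to be compared with $\gamma$. As $\delta \to 0$, the Euler product bounds
  $\sum_p p^{-1-\delta}$ by $\log(1/\delta)$ minus the contribution of the higher prime powers; on the other
  hand, with $x = e^{-\delta}$, Abel's limit theorem compares $\sum_p p^{-1-\delta}$ with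
  $\sum_k x^k/k = -\log(1 - x)$. The partial sums at $p \le e^k$ and at $k$ differ by $M - \gamma + o(1)$,
  and the upper bound for $M$ in \<open>mertens_constant_le\<close> results.
\<close>

section \<open>Newman's Tauberian theorem for Dirichlet series\<close>

text \<open>
  The mean value theorem for $t^{-x}/x$; summed over integers it replaces comparison with an integral.
\<close>

lemma powr_le_telescoping:
  fixes x t :: real
  assumes "x > 0" "t > 0"
  shows "(t + 1) powr (-1 - x) \<le> (t powr (-x) - (t + 1) powr (-x)) / x"
proof -
  have "((\<lambda>t. - (t powr (-x)) / x) has_real_derivative s powr (-1 - x)) (at s)" if "t \<le> s" "s \<le> t + 1" for s
    using that assms by (auto intro!: derivative_eq_intros simp: algebra_simps minus_diff_commute)
  from MVT2[of t "t + 1", OF _ this] obtain s where s: "t < s" "s < t + 1"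
    "- ((t+1) powr (-x)) / x - - (t powr (-x)) / x = (t + 1 - t) * s powr (-1 - x)" by auto
  moreover have "s powr (-1 - x) \<ge> (t + 1) powr (-1 - x)"
    using s assms by (intro powr_mono2') auto
  ultimately show ?thesis by (simp add: diff_divide_distrib)
qed

lemma sum_powr_tail_le:
  fixes x :: real
  assumes "x > 0" "N \<ge> 1"
  shows "(\<Sum>k=Suc N..M. real k powr (-1 - x)) \<le> real N powr (-x) / x"
proof -
  have *: "(\<Sum>k=Suc N..M. real k powr (-1 - x)) \<le> (real N powr (-x) - real M powr (-x)) / x" if "N \<le> M"
    using that
  proof (induction M rule: dec_induct)
    case (step n)
    have "(\<Sum>k=Suc N..Suc n. real k powr (-1 - x)) 
        = (\<Sum>k=Suc N..n. real k powr (-1 - x)) + (real n + 1) powr (-1 - x)"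
      using step by (simp add: add.commute)
    also have "\<dots> \<le> (real N powr (-x) - real n powr (-x)) / x
        + (real n powr (-x) - (real n + 1) powr (-x)) / x"
      using powr_le_telescoping[of x "real n"] assms step by (intro add_mono) auto
    also have "\<dots> = (real N powr (-x) - real (Suc n) powr (-x)) / x"
      by (simp add: diff_divide_distrib add.commute)
    finally show ?case .
  qed auto
  show ?thesis
  proof (cases "N \<le> M")
    case True
    have "(real N powr (-x) - real M powr (-x)) / x \<le> real N powr (-x) / x"
      using assms by (intro divide_right_mono) auto
    with *[OF True] show ?thesis by linarith
  next
    case False
    then show ?thesis using assms by simp
  qed
qed

text \<open>
  The extra term is needed only for $y > 1$, where $k^{y-1}$ increases and the comparison with the
  integral is off by the last summand.
\<close>

lemma sum_powr_head_le:
  fixes y :: real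
  assumes "y > 0"
  shows "(\<Sum>k=1..N. real k powr (y - 1)) \<le> real N powr y / y + real N powr (y - 1)"
proof -
  have der: "\<exists>s. t < s \<and> s < t + 1 \<and> ((t+1) powr y - t powr y) / y = s powr (y - 1)" if "t > 0" for t :: real
  proof -
    have "((\<lambda>t. (t powr y) / y) has_real_derivative s powr (y - 1)) (at s)" if "t \<le> s" "s \<le> t + 1" for s
      using that assms \<open>t > 0\<close> by (auto intro!: derivative_eq_intros simp: algebra_simps minus_diff_commute)
    from MVT2[of t "t + 1", OF _ this] show ?thesis by (auto simp: diff_divide_distrib)
  qed
  show ?thesis
  proof (cases "y \<le> 1")
    case True
    have "(\<Sum>k=1..N. real k powr (y - 1)) \<le> real N powr y / y"
    proof (induction N)
      case (Suc n)
      have "(real n + 1) powr (y - 1) \<le> ((real n+1) powr y - real n powr y) / y"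
      proof (cases "n = 0")
        case False
        hence "real n > 0" by simp
        from der[OF this] obtain s where s: "real n < s" "s < real n + 1"
          "((real n+1) powr y - real n powr y) / y = s powr (y - 1)" by blast
        have "s powr (y - 1) \<ge> (real n + 1) powr (y - 1)" using s True by (intro powr_mono2') auto
        then show ?thesis using s by simp
      qed (use assms True in \<open>auto simp: field_simps\<close>)
      with Suc show ?case by (simp add: diff_divide_distrib add.commute)
    qed (use assms in auto)
    then show ?thesis by (smt (verit) powr_ge_zero)
  next
    case False
    have "(\<Sum>k=1..N. real k powr (y - 1)) \<le> real (Suc N) powr y / y" for N
    proof (induction N)
      case (Suc n)
      have "real n + 1 > 0" by simp
      from der[OF this] obtain s where s: "real n + 1 < s" "s < real n + 1 + 1"
        "((real n+1+1) powr y - (real n + 1) powr y) / y = s powr (y - 1)" by blast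
      have "s powr (y - 1) \<ge> (real n + 1) powr (y - 1)" using s False by (intro powr_mono2) auto
      with Suc s show ?case by (simp add: diff_divide_distrib add.commute)
    qed (use assms in auto)
    from this[of "N - 1"] show ?thesis by (cases N) auto
  qed
qed

text \<open>
  The right half of the circle is closed up by an arbitrary path $q$ in the plane slit along the nonnegative
  real axis. The winding number around $0$ is $1$ because $\mathrm{Ln}(z)$ on the half circle and
  $\mathrm{Ln}(-z)$ on $q$ are primitives of $1/z$, and each contributes $i\pi$. Newman's argument uses this twice,
  with the left half circle and with a path that stays close to the imaginary axis.
\<close>

lemma Cauchy_formula_half_circle_join:
  assumes "R > 0" and V: "convex V" "open V" and H: "H holomorphic_on V" 
    and cp: "path_image (part_circlepath 0 R (-(pi/2)) (pi/2)) \<subseteq> V" and "0 \<in> V"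
    and q: "valid_path q" "pathstart q = \<i> * R" "pathfinish q = - \<i> * R" "path_image q \<subseteq> V"
    and slit: "\<And>z. z \<in> path_image q \<Longrightarrow> -z \<notin> \<real>\<^sub>\<le>\<^sub>0"
  shows "contour_integral (part_circlepath 0 R (-(pi/2)) (pi/2)) (\<lambda>z. H z / z)
       + contour_integral q (\<lambda>z. H z / z) = 2 * pi * \<i> * H 0"
proof -
  let ?c = "part_circlepath 0 R (-(pi/2)) (pi/2)"
  have ends: "pathstart ?c = -\<i> * R" "pathfinish ?c = \<i> * R"
    using exp_Euler[of "-(pi/2)"] exp_Euler[of "pi/2"]
    by (auto simp: pathstart_part_circlepath pathfinish_part_circlepath complex_eq_iff Re_exp Im_exp)
  have c_slit: "z \<notin> \<real>\<^sub>\<le>\<^sub>0" if z: "z \<in> path_image ?c" for z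
  proof -
    obtain t where t: "-(pi/2) \<le> t" "t \<le> pi/2" "z = R * exp (\<i> * t)"
      using z by (auto simp: path_image_part_circlepath' closed_segment_eq_real_ivl cis_conv_exp)
    show ?thesis
    proof
      assume "z \<in> \<real>\<^sub>\<le>\<^sub>0"
      hence "Im z = 0" "Re z \<le> 0" by (auto simp: complex_nonpos_Reals_iff)
      hence "R * cos t \<le> 0" "R * sin t = 0" using t by (auto simp: Re_exp Im_exp)
      hence "cos t \<le> 0" "sin t = 0" using \<open>R > 0\<close> by (auto simp: mult_le_0_iff)
      moreover have "cos t \<ge> 0" using t by (intro cos_ge_zero) auto
      ultimately show False using sin_cos_squared_add[of t] by auto
    qed
  qed
  have nz: "0 \<notin> path_image ?c" "0 \<notin> path_image q" using c_slit slit by force+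
  have val: "valid_path (?c +++ q)" using q ends by (intro valid_path_join) auto
  have img: "path_image (?c +++ q) = path_image ?c \<union> path_image q"
    using q ends by (intro path_image_join) auto
  have ci_c: "(\<lambda>z. f z / z) contour_integrable_on ?c" if "f holomorphic_on V" for f
    using cp nz that \<open>open V\<close> by (intro contour_integrable_holomorphic_simple[of _ "V - {0}"]) 
      (auto intro!: holomorphic_intros elim: holomorphic_on_subset)
  have ci_q: "(\<lambda>z. f z / z) contour_integrable_on q" if "f holomorphic_on V" for f
    using q nz that \<open>open V\<close> by (intro contour_integrable_holomorphic_simple[of _ "V - {0}"]) 
      (auto intro!: holomorphic_intros elim: holomorphic_on_subset)
  have "(Ln has_field_derivative 1 / z) (at z within path_image ?c)" if "z \<in> path_image ?c" for z
    using c_slit[OF that] by (auto intro!: derivative_eq_intros simp: field_simps)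
  from contour_integral_primitive[OF this, of ?c]
  have "((\<lambda>z. 1 / z) has_contour_integral (Ln (\<i> * R) - Ln (-\<i> * R))) ?c" unfolding ends by simp
  hence "contour_integral ?c (\<lambda>z. 1 / z) = Ln (\<i> * R) - Ln (-\<i> * R)" by (rule contour_integral_unique)
  moreover
  have "((\<lambda>z. Ln (-z)) has_field_derivative 1 / z) (at z within path_image q)" if "z \<in> path_image q" for z
    using slit[OF that] by (auto intro!: derivative_eq_intros simp: field_simps)
  from contour_integral_primitive[OF this, of q]
  have "((\<lambda>z. 1 / z) has_contour_integral (Ln (\<i> * R) - Ln (-\<i> * R))) q" unfolding q using q(1) by simp
  hence "contour_integral q (\<lambda>z. 1 / z) = Ln (\<i> * R) - Ln (-\<i> * R)" by (rule contour_integral_unique)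
  moreover have "Ln (\<i> * R) - Ln (-\<i> * R) = pi * \<i>"
    using \<open>R > 0\<close> Ln_times_of_real[of R \<i>] Ln_times_of_real[of R "-\<i>"] by (simp add: mult.commute)
  ultimately have "contour_integral (?c +++ q) (\<lambda>z. 1 / z) = 2 * pi * \<i>"
    using ci_c[of "\<lambda>_. 1"] ci_q[of "\<lambda>_. 1"] ends q by (subst contour_integral_join) auto
  hence "winding_number (?c +++ q) 0 = 1"
    using nz val img by (subst winding_number_valid_path) auto
  moreover have "((\<lambda>z. H z / (z - 0)) has_contour_integral (2 * pi * \<i> * winding_number (?c +++ q) 0 * H 0)) (?c +++ q)"
    using assms val img nz q ends by (intro Cauchy_integral_formula_convex_simple[of V]) (auto simp: interior_open)
  ultimately have "contour_integral (?c +++ q) (\<lambda>z. H z / z) = 2 * pi * \<i> * H 0"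
    by (simp add: contour_integral_unique)
  thus ?thesis using ci_c[OF H] ci_q[OF H] ends q by (subst (asm) contour_integral_join) auto
qed

text \<open>
  On the segment $|N^z| = N^{\mathrm{Re}\, z}$ decays exponentially in $\log N$ away from the end point $a$ on the
  imaginary axis, so that the integral is $O(1/\log N)$.
\<close>

lemma contour_integral_left_segment_tendsto_0:
  assumes f: "continuous_on (closed_segment a b) f" and ab: "Re a = 0" "Re b < 0"
  shows "(\<lambda>N. contour_integral (linepath a b) (\<lambda>z. f z * of_nat N powr z)) \<longlonglongrightarrow> 0"
proof -
  define d where "d = - Re b"
  have d: "d > 0" using ab by (simp add: d_def)
  have "compact (f ` closed_segment a b)" using f by (intro compact_continuous_image) auto
  then obtain M where M: "\<And>z. z \<in> closed_segment a b \<Longrightarrow> norm (f z) \<le> M"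
    by (meson compact_imp_bounded bounded_iff imageI)
  define B where "B = M * norm (b - a)"
  have "M \<ge> 0" using order_trans[OF norm_ge_zero M[of a]] by simp
  hence B: "B \<ge> 0" by (simp add: B_def)
  have bound: "norm (contour_integral (linepath a b) (\<lambda>z. f z * of_nat N powr z)) \<le> B / (d * ln N)" if N: "N \<ge> 2" for N
  proof -
    define c where "c = d * ln N"
    have c: "c > 0" using d N by (simp add: c_def)
    have int: "((\<lambda>t. B * exp (- c * t)) has_integral (- (B / c) * exp (-c * 1) - - (B / c) * exp (- c * 0))) {0..1}"
      using c by (intro fundamental_theorem_of_calculus) (auto intro!: derivative_eq_intros simp: has_real_derivative_iff_has_vector_derivative [symmetric])
    have "norm (integral {0..1} (\<lambda>t. (f (linepath a b t) * of_nat N powr (linepath a b t)) * (b - a)))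
        \<le> integral {0..1} (\<lambda>t. B * exp (- c * t))"
    proof (intro integral_norm_bound_integral)
      show "(\<lambda>t. f (linepath a b t) * of_nat N powr linepath a b t * (b - a)) integrable_on {0..1}"
      proof (intro integrable_continuous_real)
        have "continuous_on {0..1} (\<lambda>t. f (linepath a b t))"
          by (intro continuous_on_compose2[OF f] continuous_on_linepath) (auto simp: linepath_in_path)
        moreover have "continuous_on {0..1} (\<lambda>t. of_nat N powr linepath a b t)"
          using N by (intro continuous_on_powr_complex continuous_on_linepath continuous_on_const) auto
        ultimately show "continuous_on {0..1} (\<lambda>t. f (linepath a b t) * of_nat N powr linepath a b t * (b - a))"
          by (intro continuous_on_mult continuous_on_const)
      qed
      show "(\<lambda>t. B * exp (- c * t)) integrable_on {0..1}" using int by blast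
      fix t :: real assume t: "t \<in> {0..1}"
      have "norm (f (linepath a b t)) \<le> M" using t by (intro M linepath_in_path)
      moreover have "norm (of_nat N powr (linepath a b t)) = exp (- c * t)"
        using N ab by (simp add: norm_powr_real_powr powr_def c_def linepath_def d_def)
      moreover have "norm (f (linepath a b t)) * (exp (- c * t) * norm (b - a)) \<le> M * (exp (- c * t) * norm (b - a))"
        using calculation by (intro mult_right_mono) auto
      ultimately show "norm (f (linepath a b t) * of_nat N powr linepath a b t * (b - a)) \<le> B * exp (- c * t)"
        by (simp add: norm_mult B_def mult_ac)
    qed
    also have "\<dots> = B / c * (1 - exp (-c))" using int by (subst integral_unique[OF int]) (simp add: algebra_simps)
    also have "\<dots> \<le> B / c * 1" using B c by (intro mult_left_mono) auto
    finally show ?thesis by (simp add: contour_integral_integral c_def)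
  qed
  have "(\<lambda>N. B / (d * ln (real N))) \<longlonglongrightarrow> 0" using d by real_asymp
  moreover have "eventually (\<lambda>N. norm (contour_integral (linepath a b) (\<lambda>z. f z * of_nat N powr z)) \<le> B / (d * ln N)) sequentially"
    using bound by (intro eventually_sequentiallyI[of 2]) auto
  ultimately show ?thesis by (rule Lim_null_comparison[rotated])
qed

text \<open>
  Write $R^2 = z \bar z$. The factor $\mathrm{Re}\, z$ makes up for the pole of the estimates of the remainder and
  of the partial sums on the imaginary axis.
\<close>

lemma newman_kernel_on_circle:
  fixes z :: complex
  assumes "norm z = R" "R > 0"
  shows "(1 + z\<^sup>2 / R\<^sup>2) / z = of_real (2 * Re z / R\<^sup>2)"
proof -
  have nz: "z \<noteq> 0" using assms by auto
  have "of_real (R\<^sup>2) = z * cnj z" using assms complex_norm_square[of z] by simp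
  moreover have "z + cnj z = of_real (2 * Re z)" by (simp add: complex_add_cnj)
  ultimately show ?thesis using nz assms
    by (simp add: field_simps power2_eq_square) 
qed


text \<open>
  Let $g_N$ be the partial sums. The Cauchy formula expresses $G(0)$ and $g_N(0)$ as integrals against the
  kernel $N^z (1 + z^2/R^2)/z$. On the right half of the circle of radius $R$ the two integrals are compared
  through the remainder $G - g_N$; on the left, $g_N$, which is entire, is estimated on the other half of the circle,
  and $G$ on a path inside its domain, where the factor $N^z$ makes the integral vanish in the limit. Everything
  but this last contribution is $O(1/R)$, uniformly in large $N$, and $R$ is arbitrary.
\<close>

theorem newman_tauberian:
  fixes a :: "nat \<Rightarrow> complex"
  assumes C: "\<And>n. norm (a n) \<le> C"
    and U: "open U" "{z. Re z \<ge> 0} \<subseteq> U" and G: "G holomorphic_on U"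
    and sums: "\<And>z. Re z > 0 \<Longrightarrow> (\<lambda>n. a (Suc n) * of_nat (Suc n) powr (-1 - z)) sums G z"
  shows "(\<lambda>N. \<Sum>k=1..N. a k / of_nat k) \<longlonglongrightarrow> G 0"
proof -
  define g where "g = (\<lambda>N z. \<Sum>k=1..N. a k * of_nat k powr (-1 - z))"
  have "C \<ge> 0" using order_trans[OF norm_ge_zero C[of 0]] .
  have norm_term: "norm (a k * of_nat k powr (-1 - z)) \<le> C * real k powr (-1 - Re z)" for k z
    using C[of k] by (auto simp: norm_mult norm_powr_real_powr intro!: mult_right_mono)
  have g_hol: "g N holomorphic_on A" for N A
    unfolding g_def by (intro holomorphic_intros) auto
  have g_0: "g N 0 = (\<Sum>k=1..N. a k / of_nat k)" for N
    unfolding g_def by (intro sum.cong) (auto simp: powr_minus_divide)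

  \<comment> \<open>To the right of the imaginary axis the remainder, to the left the partial sum itself, has the size
      \<open>N powr - Re z / \<bar>Re z\<bar>\<close>, which the kernel will cancel.\<close>
  have right: "norm (G z - g N z) \<le> C * (real N powr (- Re z) / Re z)" if "Re z > 0" "N \<ge> 1" for z N
  proof (rule Lim_norm_ubound)
    have "(\<lambda>M. g M z) \<longlonglongrightarrow> G z"
      using sums[OF that(1)] unfolding sums_def g_def 
      by (simp only: One_nat_def sum.atLeast1_atMost_eq)
    then show "(\<lambda>M. g M z - g N z) \<longlonglongrightarrow> G z - g N z" by (intro tendsto_intros)
    show "eventually (\<lambda>M. norm (g M z - g N z) \<le> C * (real N powr (- Re z) / Re z)) sequentially"
      using eventually_ge_at_top[of N]
    proof eventually_elim
      case (elim M)
      have "{1..M} = {1..N} \<union> {Suc N..M}" using elim that by auto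
      hence "g M z = g N z + (\<Sum>k=Suc N..M. a k * of_nat k powr (-1 - z))"
        unfolding g_def by (simp add: sum.union_disjoint)
      hence "norm (g M z - g N z) = norm (\<Sum>k=Suc N..M. a k * of_nat k powr (-1 - z))" by simp
      also have "\<dots> \<le> (\<Sum>k=Suc N..M. C * real k powr (-1 - Re z))" 
        by (intro sum_norm_le norm_term)
      also have "\<dots> = C * (\<Sum>k=Suc N..M. real k powr (-1 - Re z))" by (simp add: sum_distrib_left)
      also have "\<dots> \<le> C * (real N powr (- Re z) / Re z)"
        using that \<open>C \<ge> 0\<close> by (intro mult_left_mono sum_powr_tail_le)
      finally show ?case .
    qed
  qed auto
  have left: "norm (g N z) \<le> C * (real N powr (- Re z) / (- Re z) + real N powr (- Re z - 1))" if "Re z < 0" for z N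
  proof -
    have "norm (g N z) \<le> (\<Sum>k=1..N. C * real k powr (- Re z - 1))"
      unfolding g_def using norm_term[of _ z] by (intro sum_norm_le) (simp add: minus_diff_commute)
    also have "\<dots> = C * (\<Sum>k=1..N. real k powr (- Re z - 1))" by (simp add: sum_distrib_left)
    also have "\<dots> \<le> C * (real N powr (- Re z) / (- Re z) + real N powr (- Re z - 1))"
      using that \<open>C \<ge> 0\<close> by (intro mult_left_mono sum_powr_head_le) auto
    finally show ?thesis .
  qed

  have limsup: "eventually (\<lambda>N. norm (G 0 - g N 0) \<le> 4 * (C + 1) / R) sequentially" if R: "R > 0" for R :: real
  proof -
    define c where "c = part_circlepath 0 R (-(pi/2)) (pi/2)"
    define l where "l = part_circlepath 0 R (pi/2) (3 * pi/2)"
    define E where "E = (\<lambda>N z. of_nat N powr z * (1 + z\<^sup>2 / complex_of_real (R\<^sup>2)))"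
    \<comment> \<open>A compactness argument gives a strip of width \<open>e\<close> to the left of the imaginary axis on which \<open>G\<close> is still defined.\<close>
    define K where "K = {z. norm z \<le> R + 1 \<and> Re z \<ge> 0}"
    have "K = cball 0 (R + 1) \<inter> {z. Re z \<ge> 0}" by (auto simp: K_def)
    hence "compact K" by (auto intro!: compact_Int_closed closed_halfspace_Re_ge)
    moreover have "K \<subseteq> U" using U by (auto simp: K_def)
    ultimately obtain e where e: "e > 0" "(\<Union>x\<in>K. ball x e) \<subseteq> U"
      using U compact_subset_open_imp_ball_epsilon_subset by metis
    define V where "V = ball 0 (R + 1) \<inter> {z. Re z > - e}"
    have V: "convex V" "open V" "0 \<in> V"
      using R e by (auto simp: V_def intro!: convex_Int convex_halfspace_Re_gt open_halfspace_Re_gt)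
    have "V \<subseteq> U"
    proof
      fix z assume z: "z \<in> V"
      show "z \<in> U"
      proof (cases "Re z \<ge> 0")
        case False
        define w where "w = Complex 0 (Im z)"
        have "norm w \<le> norm z" by (simp add: w_def cmod_def)
        hence "w \<in> K" using z by (auto simp: K_def V_def w_def)
        moreover have "dist w z < e" using z False by (auto simp: w_def V_def dist_complex_def cmod_def)
        ultimately show ?thesis using e by (auto simp: ball_def)
      qed (use U in auto)
    qed
    define d where "d = min e 1 / 2"
    have d: "d > 0" "d < e" "d < 1" using e by (auto simp: d_def)
    \<comment> \<open>Two sides of a triangle with vertex \<open>- d\<close> lead from \<open>\<i> R\<close> to \<open>- \<i> R\<close> through the left half-plane.\<close>
    define q where "q = linepath (\<i> * R) (- of_real d) +++ linepath (- of_real d) (- \<i> * R)"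

    have on_c: "norm z = R" "Re z \<ge> 0" if "z \<in> path_image c" for z
      using that R unfolding c_def
      by (auto simp: path_image_part_circlepath' closed_segment_eq_real_ivl norm_mult intro!: mult_nonneg_nonneg cos_ge_zero)
    have on_l: "norm z = R" "Re z \<le> 0" "z \<noteq> of_real R" if z: "z \<in> path_image l" for z
    proof -
      obtain t where t: "pi/2 \<le> t" "t \<le> 3 * pi/2" "z = R * cis t"
        using z R unfolding l_def by (auto simp: path_image_part_circlepath' closed_segment_eq_real_ivl)
      have "cos (t - pi) \<ge> 0" using t by (intro cos_ge_zero) auto
      hence "cos t \<le> 0" by simp
      thus "norm z = R" "Re z \<le> 0" using t R by (auto simp: norm_mult mult_le_0_iff)
      thus "z \<noteq> of_real R" using R by (metis Re_complex_of_real not_le)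
    qed
    have "3 * pi / 2 = (3 / 2) * pi" by simp
    hence "cos (3 * pi / 2) = 0" "sin (3 * pi / 2) = -1"
      using cos_3over2_pi sin_3over2_pi by presburger+
    hence "cis (pi / 2) = \<i>" "cis (3 * pi / 2) = - \<i>" by (auto simp: complex_eq_iff)
    hence l_ends: "pathstart l = \<i> * R" "pathfinish l = - \<i> * R"
      unfolding l_def pathstart_part_circlepath pathfinish_part_circlepath cis_conv_exp [symmetric] by simp_all
    have q_img: "path_image q = closed_segment (\<i> * R) (- of_real d) \<union> closed_segment (- of_real d) (- \<i> * R)"
      unfolding q_def by (subst path_image_join) auto
    have "\<i> * of_real R \<in> V" "- of_real d \<in> V" "- \<i> * of_real R \<in> V"
      using R d e by (auto simp: V_def norm_mult)
    hence q_V: "closed_segment (\<i> * R) (- of_real d) \<subseteq> V" "closed_segment (- of_real d) (- \<i> * R) \<subseteq> V"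
      using V(1) by (meson closed_segment_subset)+
    have q_slit: "- z \<notin> \<real>\<^sub>\<le>\<^sub>0" if z: "z \<in> path_image q" for z
    proof
      assume "- z \<in> \<real>\<^sub>\<le>\<^sub>0"
      hence *: "Im z = 0" "Re z \<ge> 0" by (auto simp: complex_nonpos_Reals_iff)
      from z consider t where "z = (1 - t) *\<^sub>R (\<i> * R) + t *\<^sub>R (- of_real d)"
        | t where "z = (1 - t) *\<^sub>R (- of_real d) + t *\<^sub>R (- \<i> * R)"
        unfolding q_img closed_segment_def by blast
      then show False using * R d by cases auto
    qed
    have l_slit: "- z \<notin> \<real>\<^sub>\<le>\<^sub>0" if z: "z \<in> path_image l" for z
      using on_l[OF z] R by (auto simp: complex_nonpos_Reals_iff complex_eq_iff cmod_def)
    have nz: "z \<noteq> 0" if "z \<in> path_image c \<or> z \<in> path_image l \<or> z \<in> path_image q" for z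
      using that on_c on_l q_slit R by force

    have E_hol: "E N holomorphic_on A" for N A
    proof (cases "N = 0")
      case False
      then show ?thesis unfolding E_def using R by (intro holomorphic_intros) auto
    qed (simp add: E_def)
    have E_0: "E N 0 = 1" if "N \<ge> 1" for N using that by (simp add: E_def)
    have E_circle: "norm (E N z / z) = real N powr Re z * (2 * \<bar>Re z\<bar> / R\<^sup>2)" if "norm z = R" for N z
    proof -
      have "E N z / z = of_nat N powr z * of_real (2 * Re z / R\<^sup>2)"
        using newman_kernel_on_circle[OF that R] unfolding E_def by (metis times_divide_eq_right)
      thus ?thesis by (simp add: norm_mult norm_divide norm_powr_real_powr norm_power abs_mult)
    qed

    have G_V: "G holomorphic_on V" using G \<open>V \<subseteq> U\<close> holomorphic_on_subset by blast
    have c_V: "path_image c \<subseteq> V" using on_c e R by (force simp: V_def)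
    have cauchy_G: "contour_integral c (\<lambda>z. G z * E N z / z) + contour_integral q (\<lambda>z. G z * E N z / z)
        = 2 * pi * \<i> * G 0" if "N \<ge> 1" for N
    proof -
      have "contour_integral c (\<lambda>z. G z * E N z / z) + contour_integral q (\<lambda>z. G z * E N z / z)
          = 2 * pi * \<i> * (G 0 * E N 0)"
        unfolding c_def
      proof (rule Cauchy_formula_half_circle_join[OF R V(1,2)])
        show "(\<lambda>z. G z * E N z) holomorphic_on V" by (intro holomorphic_intros G_V E_hol)
        show "valid_path q" "pathstart q = \<i> * R" "pathfinish q = - \<i> * R" "path_image q \<subseteq> V"
          using q_V unfolding q_img by (auto simp: q_def)
      qed (use c_V V q_slit in \<open>auto simp: c_def\<close>)
      thus ?thesis by (simp only: E_0[OF that] mult_1_right)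
    qed
    have cauchy_g: "contour_integral c (\<lambda>z. g N z * E N z / z) + contour_integral l (\<lambda>z. g N z * E N z / z)
        = 2 * pi * \<i> * g N 0" if "N \<ge> 1" for N
    proof -
      have "contour_integral c (\<lambda>z. g N z * E N z / z) + contour_integral l (\<lambda>z. g N z * E N z / z)
          = 2 * pi * \<i> * (g N 0 * E N 0)"
        unfolding c_def
      proof (rule Cauchy_formula_half_circle_join[OF R convex_UNIV open_UNIV])
        show "(\<lambda>z. g N z * E N z) holomorphic_on UNIV" by (intro holomorphic_intros g_hol E_hol)
        show "valid_path l" by (simp add: l_def)
      qed (use l_ends l_slit in auto)
      thus ?thesis by (simp only: E_0[OF that] mult_1_right)
    qed
    have G_circle: "continuous_on (path_image c) (\<lambda>z. G z * E N z / z)" for N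
      using c_V nz by (intro continuous_intros holomorphic_on_imp_continuous_on E_hol 
        holomorphic_on_subset[OF G_V]) auto
    have g_circle: "continuous_on A (\<lambda>z. g N z * E N z / z)" if "A \<subseteq> path_image c \<union> path_image l" for N A
      using that nz by (intro continuous_intros holomorphic_on_imp_continuous_on E_hol g_hol) auto
    have int_c: "(\<lambda>z. G z * E N z / z) contour_integrable_on c" "(\<lambda>z. g N z * E N z / z) contour_integrable_on c" for N
      using G_circle[of N] g_circle[of "path_image c" N] unfolding c_def
      by (auto intro: contour_integrable_continuous_part_circlepath)
    have int_l: "(\<lambda>z. g N z * E N z / z) contour_integrable_on l" for N
      using g_circle[of "path_image l" N] unfolding l_def
      by (auto intro: contour_integrable_continuous_part_circlepath)
    have bound_c: "norm (contour_integral c (\<lambda>z. G z * E N z / z) - contour_integral c (\<lambda>z. g N z * E N z / z))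
        \<le> 2 * C / R\<^sup>2 * R * pi" if N: "N \<ge> 1" for N
    proof -
      have "norm (contour_integral c (\<lambda>z. G z * E N z / z - g N z * E N z / z)) \<le> 2 * C / R\<^sup>2 * R * \<bar>pi/2 - -(pi/2)\<bar>"
        unfolding c_def
      proof (rule contour_integral_bound_part_circlepath)
        fix z assume "z \<in> path_image (part_circlepath 0 R (- (pi / 2)) (pi / 2))"
        hence z: "norm z = R" "Re z \<ge> 0" using on_c[of z] by (auto simp: c_def)
        have "norm (G z * E N z / z - g N z * E N z / z) = norm (G z - g N z) * norm (E N z / z)"
          by (simp add: algebra_simps diff_divide_distrib flip: norm_mult)
        also have "\<dots> \<le> 2 * C / R\<^sup>2"
        proof (cases "Re z = 0")
          case False
          hence "norm (G z - g N z) * norm (E N z / z) 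
              \<le> C * (real N powr (- Re z) / Re z) * (real N powr Re z * (2 * \<bar>Re z\<bar> / R\<^sup>2))"
            using z right[of z N] N False \<open>C \<ge> 0\<close>
            by (intro mult_mono) (auto simp: E_circle simp del: norm_divide intro!: divide_nonneg_nonneg)
          also have "\<dots> = 2 * C / R\<^sup>2" using False z N by (simp add: powr_minus field_simps)
          finally show ?thesis .
        qed (use z \<open>C \<ge> 0\<close> in \<open>simp add: E_circle del: norm_divide\<close>)
        finally show "norm (G z * E N z / z - g N z * E N z / z) \<le> 2 * C / R\<^sup>2" .
      qed (use int_c[of N] R \<open>C \<ge> 0\<close> in \<open>auto simp: c_def intro!: contour_integrable_diff\<close>)
      thus ?thesis using int_c[of N] by (subst (asm) contour_integral_diff) auto
    qed
    have bound_l: "norm (contour_integral l (\<lambda>z. g N z * E N z / z)) \<le> 2 * C / R\<^sup>2 * (1 + R / N) * R * pi" if N: "N \<ge> 1" for N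
    proof -
      have "norm (contour_integral l (\<lambda>z. g N z * E N z / z)) \<le> 2 * C / R\<^sup>2 * (1 + R / N) * R * \<bar>3*pi/2 - pi/2\<bar>"
        unfolding l_def
      proof (rule contour_integral_bound_part_circlepath)
        fix z assume "z \<in> path_image (part_circlepath 0 R (pi / 2) (3 * pi / 2))"
        hence z: "norm z = R" "Re z \<le> 0" using on_l[of z] by (auto simp: l_def)
        have "norm (g N z * E N z / z) = norm (g N z) * norm (E N z / z)"
          by (simp add: norm_mult norm_divide)
        also have "\<dots> \<le> 2 * C / R\<^sup>2 * (1 + R / N)"
        proof (cases "Re z = 0")
          case False
          have "norm (g N z) * norm (E N z / z) 
              \<le> C * (real N powr (- Re z) / (- Re z) + real N powr (- Re z - 1)) * (real N powr Re z * (2 * \<bar>Re z\<bar> / R\<^sup>2))"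
            using z left[of z N] False N \<open>C \<ge> 0\<close> order_trans[OF norm_ge_zero left[of z N]]
            by (intro mult_mono) (auto simp: E_circle mult_nonneg_nonpos divide_nonpos_nonneg simp del: norm_divide)
          also have "\<dots> = 2 * C / R\<^sup>2 * (1 + (- Re z) / N)" 
            using False z N R by (simp add: powr_minus powr_diff field_simps)
          also have "\<dots> \<le> 2 * C / R\<^sup>2 * (1 + R / N)" using z \<open>C \<ge> 0\<close> abs_Re_le_cmod[of z] N
            by (intro mult_left_mono add_left_mono divide_right_mono) auto
          finally show ?thesis .
        qed (use z \<open>C \<ge> 0\<close> R in \<open>simp add: E_circle del: norm_divide\<close>)
        finally show "norm (g N z * E N z / z) \<le> 2 * C / R\<^sup>2 * (1 + R / N)" .
      qed (use int_l[of N] R \<open>C \<ge> 0\<close> in \<open>auto simp: l_def\<close>)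
      thus ?thesis by simp
    qed

    have q_lim: "(\<lambda>N. contour_integral q (\<lambda>z. G z * E N z / z)) \<longlonglongrightarrow> 0"
    proof -
      define f where "f = (\<lambda>z. G z * (1 + z\<^sup>2 / complex_of_real (R\<^sup>2)) / z)"
      have f: "continuous_on (closed_segment (\<i> * R) (- of_real d)) f" "continuous_on (closed_segment (- of_real d) (- \<i> * R)) f"
        unfolding f_def using nz R q_V unfolding q_img
        by (auto intro!: continuous_intros holomorphic_on_imp_continuous_on[OF holomorphic_on_subset[OF G_V]])
      have cont_powr: "continuous_on A (\<lambda>z :: complex. of_nat N powr z)" if "N \<ge> 1" for N A
        using that continuous_on_powr_complex[of A "\<lambda>_. of_nat N" "\<lambda>z :: complex. z"] by (auto simp: continuous_on_id)
      have eq: "contour_integral q (\<lambda>z. G z * E N z / z) = 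
          contour_integral (linepath (\<i> * R) (- of_real d)) (\<lambda>z. f z * of_nat N powr z)
          - contour_integral (linepath (- \<i> * R) (- of_real d)) (\<lambda>z. f z * of_nat N powr z)" if "N \<ge> 1" for N
      proof -
        have "(\<lambda>z. G z * E N z / z) = (\<lambda>z. f z * of_nat N powr z)" by (auto simp: E_def f_def)
        moreover have "contour_integral q (\<lambda>z. f z * of_nat N powr z) = 
            contour_integral (linepath (\<i> * R) (- of_real d)) (\<lambda>z. f z * of_nat N powr z)
            + contour_integral (linepath (- of_real d) (- \<i> * R)) (\<lambda>z. f z * of_nat N powr z)"
          unfolding q_def using f cont_powr[OF that]
          by (intro contour_integral_join contour_integrable_continuous_linepath continuous_on_mult) auto
        moreover have "contour_integral (linepath (- of_real d) (- \<i> * R)) (\<lambda>z. f z * of_nat N powr z)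
            = - contour_integral (linepath (- \<i> * R) (- of_real d)) (\<lambda>z. f z * of_nat N powr z)"
          using f(2) cont_powr[OF that] by (intro contour_integral_reverse_linepath continuous_on_mult) auto
        ultimately show ?thesis by simp
      qed
      have "(\<lambda>N. contour_integral (linepath (\<i> * R) (- of_real d)) (\<lambda>z. f z * of_nat N powr z)
          - contour_integral (linepath (- \<i> * R) (- of_real d)) (\<lambda>z. f z * of_nat N powr z)) \<longlonglongrightarrow> 0 - 0"
        using f d by (intro tendsto_diff contour_integral_left_segment_tendsto_0) (auto simp: closed_segment_commute)
      moreover have "eventually (\<lambda>N. contour_integral (linepath (\<i> * R) (- of_real d)) (\<lambda>z. f z * of_nat N powr z)
          - contour_integral (linepath (- \<i> * R) (- of_real d)) (\<lambda>z. f z * of_nat N powr z)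
          = contour_integral q (\<lambda>z. G z * E N z / z)) sequentially"
        using eq by (intro eventually_sequentiallyI[of 1]) simp
      ultimately have "(\<lambda>N. contour_integral q (\<lambda>z. G z * E N z / z)) \<longlonglongrightarrow> 0 - 0" 
        by (rule Lim_transform_eventually)
      then show ?thesis by simp
    qed

    have "eventually (\<lambda>N. norm (contour_integral q (\<lambda>z. G z * E N z / z)) \<le> 2 * pi / R) sequentially"
      using q_lim R by (intro eventually_mono[OF order_tendstoD(2)[OF tendsto_norm[OF q_lim], of "2 * pi / R"]]) auto
    moreover have "eventually (\<lambda>N. real N \<ge> R) sequentially"
      using filterlim_real_sequentially by (auto simp: filterlim_at_top)
    ultimately show ?thesis using eventually_ge_at_top[of 1]
    proof eventually_elim
      case (elim N)
      have "2 * pi * \<i> * (G 0 - g N 0) = 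
          (contour_integral c (\<lambda>z. G z * E N z / z) - contour_integral c (\<lambda>z. g N z * E N z / z))
          + contour_integral q (\<lambda>z. G z * E N z / z) - contour_integral l (\<lambda>z. g N z * E N z / z)"
        using cauchy_G[of N] cauchy_g[of N] elim by (simp add: algebra_simps)
      hence "2 * pi * norm (G 0 - g N 0) = norm ((contour_integral c (\<lambda>z. G z * E N z / z) - contour_integral c (\<lambda>z. g N z * E N z / z))
          + contour_integral q (\<lambda>z. G z * E N z / z) - contour_integral l (\<lambda>z. g N z * E N z / z))"
        by (metis (no_types, lifting) norm_mult norm_ii norm_of_real abs_of_nonneg pi_ge_zero mult_nonneg_nonneg zero_le_numeral mult.right_neutral)
      also have "\<dots> \<le> norm (contour_integral c (\<lambda>z. G z * E N z / z) - contour_integral c (\<lambda>z. g N z * E N z / z))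
          + norm (contour_integral q (\<lambda>z. G z * E N z / z)) + norm (contour_integral l (\<lambda>z. g N z * E N z / z))"
        by norm
      also have "\<dots> \<le> 2 * C / R\<^sup>2 * R * pi + 2 * pi / R + 2 * C / R\<^sup>2 * (1 + R / N) * R * pi"
        using bound_c[of N] bound_l[of N] elim by (intro add_mono) auto
      also have "\<dots> \<le> 2 * C / R\<^sup>2 * R * pi + 2 * pi / R + 2 * C / R\<^sup>2 * (1 + 1) * R * pi"
        using elim R \<open>C \<ge> 0\<close> by (intro add_left_mono mult_right_mono mult_left_mono) (auto simp: field_simps)
      also have "\<dots> = 2 * pi * ((3 * C + 1) / R)" using R by (simp add: field_simps power2_eq_square)
      finally have "norm (G 0 - g N 0) \<le> (3 * C + 1) / R" by (rule mult_left_le_imp_le) simp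
      also have "\<dots> \<le> 4 * (C + 1) / R" using R \<open>C \<ge> 0\<close> by (intro divide_right_mono) auto
      finally show ?case .
    qed
  qed
  have "(\<lambda>N. g N 0) \<longlonglongrightarrow> G 0"
  proof (rule tendstoI)
    fix e :: real assume e: "e > 0"
    \<comment> \<open>The bound \<open>4 * (C + 1) / R\<close> becomes \<open>e / 2\<close>.\<close>
    define R where "R = 8 * (C + 1) / e"
    have "R > 0" using e \<open>C \<ge> 0\<close> by (simp add: R_def)
    moreover have "4 * (C + 1) / R = e / 2" using e \<open>C \<ge> 0\<close> by (simp add: R_def field_simps)
    ultimately have "eventually (\<lambda>N. norm (G 0 - g N 0) \<le> e / 2) sequentially" using limsup[of R] by metis
    then show "eventually (\<lambda>N. dist (g N 0) (G 0) < e) sequentially"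
      by eventually_elim (use e in \<open>simp add: dist_norm norm_minus_commute\<close>)
  qed
  then show ?thesis by (simp add: g_0)
qed

section \<open>Chebyshev's upper bound\<close>

definition chebyshev_psi :: "nat \<Rightarrow> real" where
  "chebyshev_psi n = (\<Sum>k=1..n. mangoldt k)"

text \<open>
  Expand every $\log k$ as $\sum_{d \mid k} \Lambda(d)$ and count the multiples of $d$ up to $n$. The upper limit $N$
  is kept free so that the identities for $n$ and $2n$ can be subtracted.
\<close>

lemma ln_fact_eq_sum_mangoldt:
  assumes "n \<le> N"
  shows "ln (fact n) = (\<Sum>d=1..N. mangoldt d * real (n div d))"
proof -
  have "ln (fact n) = (\<Sum>k=1..n. ln (real k))"
    unfolding fact_prod of_nat_prod by (subst ln_prod) auto
  also have "\<dots> = (\<Sum>k=1..n. \<Sum>d | d dvd k. mangoldt d)"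
    by (intro sum.cong) (auto simp: mangoldt_sum)
  also have "\<dots> = (\<Sum>k=1..n. \<Sum>d=1..N. if d dvd k then mangoldt d else 0)"
  proof (rule sum.cong[OF refl])
    fix k assume k: "k \<in> {1..n}"
    have "{d. d dvd k} \<subseteq> {1..N}"
    proof
      fix d assume d: "d \<in> {d. d dvd k}"
      with k have "d \<noteq> 0" by (intro notI) auto
      moreover have "d \<le> k" using d k by (auto intro: dvd_imp_le)
      ultimately show "d \<in> {1..N}" using k assms by simp
    qed
    thus "(\<Sum>d | d dvd k. mangoldt d) = (\<Sum>d=1..N. if d dvd k then mangoldt d else 0)"
      by (intro sum.mono_neutral_cong_left) auto
  qed
  also have "\<dots> = (\<Sum>d=1..N. \<Sum>k=1..n. if d dvd k then mangoldt d else 0)"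
    by (rule sum.swap)
  also have "\<dots> = (\<Sum>d=1..N. mangoldt d * real (n div d))"
  proof (intro sum.cong refl)
    fix d assume d: "d \<in> {1..N}"
    have "{k \<in> {1..n}. d dvd k} = (\<lambda>j. d * j) ` {1..n div d}"
    proof (intro equalityI subsetI)
      fix k assume k: "k \<in> {k \<in> {1..n}. d dvd k}"
      then obtain j where j: "k = d * j" by auto
      moreover have "j \<ge> 1" using j k by (cases j) auto
      moreover have "j \<le> n div d" using j k d by (simp add: less_eq_div_iff_mult_less_eq mult.commute)
      ultimately show "k \<in> (\<lambda>j. d * j) ` {1..n div d}" by auto
    next
      fix k assume "k \<in> (\<lambda>j. d * j) ` {1..n div d}"
      then obtain j where "j \<in> {1..n div d}" and j: "k = d * j" by blast
      hence "1 \<le> j" "j \<le> n div d" by auto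
      hence "j * d \<le> n" using d by (simp add: less_eq_div_iff_mult_less_eq Suc_le_eq)
      thus "k \<in> {k \<in> {1..n}. d dvd k}" using j d \<open>1 \<le> j\<close> by (auto simp: mult.commute Suc_le_eq)
    qed
    moreover have "card ((\<lambda>j. d * j) ` {1..n div d}) = n div d"
      using d by (subst card_image) (auto simp: inj_on_def)
    ultimately show "(\<Sum>k=1..n. if d dvd k then mangoldt d else 0) = mangoldt d * real (n div d)"
      by (simp add: sum.If_cases Int_def)
  qed
  finally show ?thesis .
qed

text \<open>
  In $\log\binom{2n}{n} = \sum_d \Lambda(d)\,(\lfloor 2n/d \rfloor - 2 \lfloor n/d \rfloor)$ no term is negative, and
  the coefficient is $1$ for $n < d \le 2n$.
\<close>

lemma chebyshev_psi_double_le: "chebyshev_psi (2 * n) - chebyshev_psi n \<le> 2 * real n * ln 2"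
proof -
  have "chebyshev_psi (2 * n) - chebyshev_psi n = (\<Sum>d=Suc n..2*n. mangoldt d)"
  proof -
    have "{1..2*n} = {1..n} \<union> {Suc n..2*n}" by auto
    thus ?thesis unfolding chebyshev_psi_def by (simp add: sum.union_disjoint)
  qed
  also have "\<dots> \<le> (\<Sum>d=Suc n..2*n. mangoldt d * (real (2 * n div d) - 2 * real (n div d)))"
  proof (intro sum_mono)
    fix d assume d: "d \<in> {Suc n..2*n}"
    hence "2 * n div d \<ge> 1" "n div d = 0" by (auto simp: Suc_le_eq div_greater_zero_iff)
    thus "mangoldt d \<le> mangoldt d * (real (2 * n div d) - 2 * real (n div d))"
      using mult_left_mono[of 1 "real (2 * n div d)" "mangoldt d"] mangoldt_nonneg[of d] by simp
  qed
  also have "\<dots> \<le> (\<Sum>d=1..2*n. mangoldt d * (real (2 * n div d) - 2 * real (n div d)))"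
  proof (intro sum_mono2)
    fix d
    have "2 * (n div d) \<le> 2 * n div d"
      using times_div_less_eq_dividend[of d n] by (cases "d = 0") (auto simp: less_eq_div_iff_mult_less_eq mult_ac)
    thus "0 \<le> mangoldt d * (real (2 * n div d) - 2 * real (n div d))"
      by (intro mult_nonneg_nonneg mangoldt_nonneg) linarith
  qed auto
  also have "\<dots> = ln (fact (2 * n)) - 2 * ln (fact n)"
    using ln_fact_eq_sum_mangoldt[of "2*n" "2*n"] ln_fact_eq_sum_mangoldt[of n "2*n"]
    by (simp add: algebra_simps sum_subtractf sum_distrib_left)
  also have "\<dots> = ln (real ((2 * n) choose n))"
  proof -
    have "real ((2 * n) choose n) = fact (2 * n) / (fact n * fact n)"
      using binomial_fact[of n "2 * n", where ?'a = real] by simp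
    thus ?thesis by (simp only: ln_div ln_mult fact_gt_zero fact_nonzero mult_eq_0_iff) simp
  qed
  also have "\<dots> \<le> ln (2 ^ (2 * n))"
  proof -
    have "real ((2 * n) choose n) \<le> real (2 ^ (2 * n))"
      using binomial_le_pow2[of "2 * n" n] by (simp only: of_nat_le_iff)
    moreover have "real ((2 * n) choose n) > 0" by simp
    ultimately show ?thesis by (simp add: ln_mono)
  qed
  also have "\<dots> = 2 * real n * ln 2" by (simp add: ln_realpow)
  finally show ?thesis .
qed

lemma chebyshev_psi_le: "chebyshev_psi n \<le> 4 * real n"
proof (induction n rule: less_induct)
  case (less n)
  have ln2: "ln 2 \<le> (1 :: real)" using ln_le_minus_one[of 2] by simp
  show ?case
  proof (cases "n = 0")
    case True
    then show ?thesis by (simp add: chebyshev_psi_def)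
  next
    case False
    define k where "k = n div 2"
    have IH: "chebyshev_psi k \<le> 4 * k" using less[of k] False by (simp add: k_def)
    have "chebyshev_psi (2 * k) \<le> chebyshev_psi k + 2 * real k * ln 2"
      using chebyshev_psi_double_le[of k] by linarith
    also have "\<dots> \<le> 4 * k + 2 * real k * 1" using IH ln2 by (intro add_mono mult_left_mono) auto
    finally have *: "chebyshev_psi (2 * k) \<le> 6 * real k" by simp
    show ?thesis
    proof (cases "even n")
      case True
      then show ?thesis using * by (simp add: k_def)
    next
      case False
      hence n: "n = Suc (2 * k)" by (simp add: k_def)
      have "chebyshev_psi n = chebyshev_psi (2 * k) + mangoldt n" unfolding n by (simp add: chebyshev_psi_def)
      also have "mangoldt n \<le> ln (real n)" using mangoldt_le[of n] n by simp
      also have "ln (real n) \<le> 2 * k" using ln_le_minus_one[of "real n"] n by simp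
      finally show ?thesis using * n by simp
    qed
  qed
qed

lemma chebyshev_psi_nonneg: "chebyshev_psi n \<ge> 0"
  unfolding chebyshev_psi_def by (intro sum_nonneg mangoldt_nonneg)

section \<open>The zeta function and the logarithmic derivative of its Dirichlet series\<close>

text \<open>
  The series below are indexed from $0$ with terms in $n + 1$; these casts should stay atomic.
\<close>

declare of_nat_Suc [simp del]

text \<open>
  Weierstrass' M-test on discs. The factor $P$ allows for bounds that are polynomial in $s$.
\<close>

lemma holomorphic_suminf_half_plane:
  fixes f :: "nat \<Rightarrow> complex \<Rightarrow> complex" and P :: "complex \<Rightarrow> real"
  assumes hol: "\<And>n. f n holomorphic_on {s. Re s > c}"
    and bound: "\<And>n s. Re s > c \<Longrightarrow> norm (f n s) \<le> P s * real (Suc n) powr (-1 - (Re s - c))"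
    and P: "continuous_on {s. Re s > c} P"
  shows "(\<lambda>s. \<Sum>n. f n s) holomorphic_on {s. Re s > c}"
    and "\<And>s. Re s > c \<Longrightarrow> summable (\<lambda>n. norm (f n s))"
proof -
  have summ: "summable (\<lambda>n. real (Suc n) powr (-1 - d))" if "d > 0" for d :: real
    using that summable_Suc_iff[of "\<lambda>n. real n powr (-1 - d)"] by (simp add: summable_real_powr_iff)
  show sm: "summable (\<lambda>n. norm (f n s))" if "Re s > c" for s
    using that by (intro summable_comparison_test[OF _ summable_mult[OF summ[of "Re s - c"], of "P s"]]) (auto intro!: exI[of _ 0] bound)
  show "(\<lambda>s. \<Sum>n. f n s) holomorphic_on {s. Re s > c}"
  proof (rule holomorphic_uniform_sequence)
    show "open {s. Re s > c}" by (rule open_halfspace_Re_gt)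
    show "(\<lambda>s. \<Sum>n<N. f n s) holomorphic_on {s. Re s > c}" for N
      by (intro holomorphic_on_sum hol)
    fix x assume x: "x \<in> {s. Re s > c}"
    define d where "d = (Re x - c) / 2"
    have d: "d > 0" using x by (simp add: d_def)
    have Re: "Re y \<ge> c + d" if "y \<in> cball x d" for y
      using that abs_Re_le_cmod[of "x - y"] by (auto simp: dist_norm d_def field_simps abs_if split: if_splits)
    have sub: "cball x d \<subseteq> {s. Re s > c}" using Re d by fastforce
    have "compact (P ` cball x d)"
      using P sub by (intro compact_continuous_image) (auto intro: continuous_on_subset)
    then obtain M where M: "\<And>y. y \<in> cball x d \<Longrightarrow> norm (P y) \<le> M"
      by (meson compact_imp_bounded bounded_iff imageI)
    have "uniform_limit (cball x d) (\<lambda>n s. \<Sum>i<n. f i s) (\<lambda>s. \<Sum>n. f n s) sequentially"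
    proof (rule Weierstrass_m_test)
      show "summable (\<lambda>n. M * real (Suc n) powr (-1 - d))" by (intro summable_mult summ d)
      fix n y assume y: "y \<in> cball x d"
      hence "norm (f n y) \<le> P y * real (Suc n) powr (-1 - (Re y - c))" using sub by (intro bound) auto
      also have "\<dots> \<le> M * real (Suc n) powr (-1 - d)"
        using M[OF y] Re[OF y] norm_ge_zero[of "P y"] by (intro mult_mono powr_mono) auto
      finally show "norm (f n y) \<le> M * real (Suc n) powr (-1 - d)" .
    qed
    then show "\<exists>d>0. cball x d \<subseteq> {s. Re s > c} \<and> uniform_limit (cball x d) (\<lambda>n s. \<Sum>i<n. f i s) (\<lambda>s. \<Sum>n. f n s) sequentially"
      using d sub by blast
  qed
qed

text \<open>
  The second-order Taylor remainder of $t^{-s}$ between $t = n + 1$ and $t = n + 2$. It is smaller than $t^{-s}$ by two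
  powers of $t$. Two series are continued beyond their half-planes of convergence by passing to it: that of $\zeta$, and that
  with coefficients $\psi(n)$.
\<close>

definition powr_remainder :: "nat \<Rightarrow> complex \<Rightarrow> complex" where
  "powr_remainder n s = of_nat (Suc (Suc n)) powr (-s) - of_nat (Suc n) powr (-s) + s * of_nat (Suc n) powr (-s - 1)"

lemma powr_remainder_holomorphic: "powr_remainder n holomorphic_on A"
  unfolding powr_remainder_def by (intro holomorphic_intros)

lemma norm_powr_remainder_le:
  assumes "Re s > -2"
  shows "norm (powr_remainder n s) \<le> norm s * norm (s + 1) * real (Suc n) powr (-2 - Re s)"
proof -
  define f where "f = (\<lambda>(i :: nat) (x :: complex). if i = 0 then x powr (-s) else if i = 1 then - s * x powr (-s - 1)
     else s * (s + 1) * x powr (-s - 2))"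
  define t0 where "t0 = real (Suc n)"
  define S where "S = closed_segment (complex_of_real t0) (complex_of_real (t0 + 1))"
  have S: "\<exists>t\<ge>t0. x = of_real t" if "x \<in> S" for x
    using that unfolding S_def closed_segment_of_real by (auto simp: closed_segment_eq_real_ivl)
  have t0: "t0 > 0" by (simp add: t0_def)
  have "norm (f 0 (of_real (t0 + 1)) - (\<Sum>i\<le>1. f i (of_real t0) * (of_real (t0 + 1) - of_real t0) ^ i / fact i))
     \<le> (norm s * norm (s + 1) * t0 powr (-2 - Re s)) * norm (complex_of_real (t0 + 1) - of_real t0) ^ Suc 1 / fact 1"
  proof (rule complex_Taylor)
    show "convex S" "complex_of_real t0 \<in> S" "complex_of_real (t0 + 1) \<in> S" by (auto simp: S_def)
  next
    fix i x assume i: "i \<le> (1::nat)" and x: "x \<in> S"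
    from S[OF x] obtain t where "t \<ge> t0" "x = of_real t" by blast
    hence "x \<notin> \<real>\<^sub>\<le>\<^sub>0" using t0 by auto
    thus "(f i has_field_derivative f (Suc i) x) (at x within S)"
      using i by (cases i) (auto simp: f_def algebra_simps intro!: derivative_eq_intros)
  next
    fix x assume x: "x \<in> S"
    from S[OF x] obtain t where t: "t \<ge> t0" "x = of_real t" by blast
    have "t powr (-2 - Re s) \<le> t0 powr (-2 - Re s)" using t t0 assms by (intro powr_mono2') auto
    thus "norm (f (Suc 1) x) \<le> norm s * norm (s + 1) * t0 powr (-2 - Re s)"
      using t t0 by (auto simp: f_def norm_mult norm_powr_real_powr minus_diff_commute intro!: mult_left_mono)
  qed
  moreover have "complex_of_nat (Suc (Suc n)) = of_real (t0 + 1)" "complex_of_nat (Suc n) = of_real t0"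
    by (simp_all add: t0_def of_nat_Suc)
  ultimately have "norm (powr_remainder n s) \<le> norm s * norm (s + 1) * t0 powr (-2 - Re s)"
    by (simp add: f_def powr_remainder_def algebra_simps of_nat_Suc[of 0])
  thus ?thesis by (simp add: t0_def)
qed

definition zeta_series :: "complex \<Rightarrow> complex" where
  "zeta_series s = (\<Sum>n. of_nat (Suc n) powr (-s))"

definition mangoldt_series :: "complex \<Rightarrow> complex" where
  "mangoldt_series s = (\<Sum>n. mangoldt (Suc n) * of_nat (Suc n) powr (-s))"

text \<open>
  This is $(s - 1)\zeta(s)$, continued to $\mathrm{Re}\, s > 0$ and regular at $s = 1$: the remainders
  of $t^{1-s}$ are $(s - 1) n^{-s}$ plus a telescoping difference whose sum is $-1$.
\<close>

definition zeta_reg :: "complex \<Rightarrow> complex" where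
  "zeta_reg s = 1 + (\<Sum>n. powr_remainder n (s - 1))"

lemma zeta_reg_1: "zeta_reg 1 = 1"
  by (simp add: zeta_reg_def powr_remainder_def)

lemma zeta_reg_holomorphic: "zeta_reg holomorphic_on {s. Re s > 0}"
proof -
  have 1: "(\<lambda>s. powr_remainder n (s - 1)) holomorphic_on A" for n A
    unfolding powr_remainder_def by (intro holomorphic_intros)
  have 2: "norm (powr_remainder n (s - 1)) \<le> norm (s - 1) * norm s * real (Suc n) powr (-1 - (Re s - 0))" if "Re s > 0" for n s
    using norm_powr_remainder_le[of "s - 1" n] that by simp
  have 3: "continuous_on {s. Re s > 0} (\<lambda>s. norm (s - 1) * norm s)" by (intro continuous_intros)
  have "(\<lambda>s. \<Sum>n. powr_remainder n (s - 1)) holomorphic_on {s. Re s > 0}"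
    by (rule holomorphic_suminf_half_plane(1)[OF 1 _ 3]) (rule 2)
  then show ?thesis unfolding zeta_reg_def by (intro holomorphic_on_add holomorphic_on_const)
qed

lemma powr_of_nat_tendsto_0:
  assumes "Re s < 0"
  shows "(\<lambda>n. of_nat (Suc n) powr s :: complex) \<longlonglongrightarrow> 0"
proof (rule tendsto_norm_zero_cancel)
  have "(\<lambda>n. real (Suc n) powr Re s) \<longlonglongrightarrow> 0" using assms by real_asymp
  thus "(\<lambda>n. norm (of_nat (Suc n) powr s :: complex)) \<longlonglongrightarrow> 0"
    by (subst norm_powr_real_powr) auto
qed

text \<open>
  Termwise differentiation, by locally uniform convergence.
\<close>

lemma zeta_series_derivative_sums:
  shows "\<And>s. Re s > 1 \<Longrightarrow> summable (\<lambda>n. norm (of_nat (Suc n) powr (-s) :: complex))"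
    and "\<And>s. Re s > 1 \<Longrightarrow> (zeta_series has_field_derivative deriv zeta_series s) (at s)"
    and "\<And>s. Re s > 1 \<Longrightarrow> (\<lambda>n. - (of_real (ln (real (Suc n))) * of_nat (Suc n) powr (-s) :: complex)) sums deriv zeta_series s"
proof -
  have hol: "(\<lambda>s. of_nat (Suc n) powr (-s) :: complex) holomorphic_on A" for n A
    by (intro holomorphic_intros)
  have bound: "norm (of_nat (Suc n) powr (-s) :: complex) \<le> 1 * real (Suc n) powr (-1 - (Re s - 1))" for n s
    by (subst norm_powr_real_powr) auto
  note * = holomorphic_suminf_half_plane[where f = "\<lambda>n s. of_nat (Suc n) powr (-s)", OF hol bound continuous_on_const]
  have zhol: "zeta_series holomorphic_on {s. Re s > 1}" unfolding zeta_series_def by (rule *(1))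
  show sm: "summable (\<lambda>n. norm (of_nat (Suc n) powr (-s) :: complex))" if "Re s > 1" for s using *(2) that .
  show der: "(zeta_series has_field_derivative deriv zeta_series s) (at s)" if "Re s > 1" for s
    using zhol that by (intro holomorphic_derivI[OF _ open_halfspace_Re_gt]) auto
  show "(\<lambda>n. - (of_real (ln (real (Suc n))) * of_nat (Suc n) powr (-s) :: complex)) sums deriv zeta_series s" if s: "Re s > 1" for s
  proof -
    have "\<exists>g g'. \<forall>x\<in>{s :: complex. Re s > 1}. (\<lambda>n. of_nat (Suc n) powr (-x) :: complex) sums g x
         \<and> (\<lambda>n. - (of_real (ln (real (Suc n))) * of_nat (Suc n) powr (-x) :: complex)) sums g' x \<and> (g has_field_derivative g' x) (at x)"
    proof (rule series_and_derivative_comparison_local)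
      show "open {s :: complex. Re s > 1}" by (rule open_halfspace_Re_gt)
      show "((\<lambda>x. of_nat (Suc n) powr (-x)) has_field_derivative - (of_real (ln (real (Suc n))) * of_nat (Suc n) powr (-x) :: complex)) (at x)" for n and x :: complex
        by (rule DERIV_cong[OF DERIV_chain2[OF has_field_derivative_powr_right[of "of_nat (Suc n)"] 
                DERIV_minus[OF DERIV_ident]]]) (simp_all add: Ln_of_nat)
      fix x :: complex assume x: "x \<in> {s. Re s > 1}"
      define d where "d = (Re x - 1) / 2"
      have d: "d > 0" using x by (simp add: d_def)
      have "summable (\<lambda>n. real (Suc n) powr (-1 - d))" 
        using d summable_Suc_iff[of "\<lambda>n. real n powr (-1 - d)"] by (simp add: summable_real_powr_iff)
      moreover have "norm (of_nat (Suc n) powr (-y) :: complex) \<le> real (Suc n) powr (-1 - d)" if "y \<in> ball x d" for y n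
      proof -
        have "Re y \<ge> 1 + d"
          using that abs_Re_le_cmod[of "x - y"] by (auto simp: dist_norm d_def field_simps abs_if split: if_splits)
        thus ?thesis by (subst norm_powr_real_powr) (auto intro!: powr_mono)
      qed
      ultimately show "\<exists>d h. 0 < d \<and> summable h \<and> (\<forall>\<^sub>F n in sequentially. \<forall>y\<in>ball x d \<inter> {s. Re s > 1}. norm (of_nat (Suc n) powr (-y) :: complex) \<le> h n)"
        using d by (intro exI[of _ d] exI[of _ "\<lambda>n. real (Suc n) powr (-1 - d)"]) auto
    qed
    then obtain g g' where g: "\<And>x. Re x > 1 \<Longrightarrow> (\<lambda>n. of_nat (Suc n) powr (-x)) sums g x"
      "\<And>x. Re x > 1 \<Longrightarrow> (\<lambda>n. - (of_real (ln (real (Suc n))) * of_nat (Suc n) powr (-x) :: complex)) sums g' x"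
      "\<And>x. Re x > 1 \<Longrightarrow> (g has_field_derivative g' x) (at x)" by auto
    have eq: "g x = zeta_series x" if "Re x > 1" for x
      using g(1)[OF that] by (simp add: zeta_series_def sums_iff)
    have "(zeta_series has_field_derivative g' s) (at s)"
      by (rule has_field_derivative_transform_within_open[OF g(3)[OF s] open_halfspace_Re_gt[of 1]])
        (use s eq in auto)
    hence "deriv zeta_series s = g' s" by (rule DERIV_imp_deriv)
    thus ?thesis using g(2)[OF s] by simp
  qed
qed

lemma zeta_series_sums: "Re s > 1 \<Longrightarrow> (\<lambda>n. of_nat (Suc n) powr (-s)) sums zeta_series s"
  unfolding zeta_series_def by (intro summable_sums summable_norm_cancel[OF zeta_series_derivative_sums(1)])

lemma zeta_reg_eq: 
  assumes "Re s > 1"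
  shows "zeta_reg s = (s - 1) * zeta_series s"
proof -
  have "(\<lambda>n. of_nat (Suc n) powr (1 - s) :: complex) \<longlonglongrightarrow> 0"
    using assms by (intro powr_of_nat_tendsto_0) auto
  from telescope_sums[OF this]
  have "(\<lambda>n. of_nat (Suc (Suc n)) powr (1 - s) - of_nat (Suc n) powr (1 - s)) sums (0 - (1 :: complex))" 
    by (simp only: One_nat_def [symmetric] of_nat_1 powr_one_eq_one)
  from sums_add[OF this sums_mult[OF zeta_series_sums[OF assms], of "s - 1"]]
  have "(\<lambda>n. powr_remainder n (s - 1)) sums (-1 + (s - 1) * zeta_series s)" by (simp add: powr_remainder_def)
  thus ?thesis unfolding zeta_reg_def by (simp add: sums_iff)
qed

lemma summable_ln_powr:
  assumes "\<sigma> > 1"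
  shows "summable (\<lambda>n. ln (real (Suc n)) * real (Suc n) powr (-\<sigma>))"
proof -
  have "summable (\<lambda>n. - (of_real (ln (real (Suc n))) * of_nat (Suc n) powr (- complex_of_real \<sigma>) :: complex))"
    by (rule sums_summable[OF zeta_series_derivative_sums(3)]) (use assms in simp)
  moreover have "- (of_real (ln (real (Suc n))) * of_nat (Suc n) powr (- complex_of_real \<sigma>) :: complex)
      = of_real (- (ln (real (Suc n)) * real (Suc n) powr (-\<sigma>)))" for n
    using powr_of_real[of "real (Suc n)" "-\<sigma>"] by simp
  ultimately have "summable (\<lambda>n. complex_of_real (- (ln (real (Suc n)) * real (Suc n) powr (-\<sigma>))))"
    by simp
  from summable_minus[OF summable_Re[OF this]] show ?thesis by simp
qed

lemma mangoldt_series_summable: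
  assumes "Re s > 1"
  shows "summable (\<lambda>n. norm (mangoldt (Suc n) * of_nat (Suc n) powr (-s) :: complex))"
proof (rule summable_comparison_test[OF _ summable_ln_powr[OF assms]], intro exI[of _ 0] allI impI)
  fix n
  have "norm (mangoldt (Suc n) * of_nat (Suc n) powr (-s) :: complex) = mangoldt (Suc n) * real (Suc n) powr (-Re s)"
    by (simp add: norm_mult norm_powr_real_powr)
  also have "\<dots> \<le> ln (real (Suc n)) * real (Suc n) powr (-Re s)" 
    by (intro mult_right_mono mangoldt_le) auto
  finally show "norm (norm (mangoldt (Suc n) * of_nat (Suc n) powr (-s) :: complex)) \<le> ln (real (Suc n)) * real (Suc n) powr (-Re s)"
    by simp
qed

lemma mangoldt_series_sums:
  "Re s > 1 \<Longrightarrow> (\<lambda>n. mangoldt (Suc n) * of_nat (Suc n) powr (-s)) sums mangoldt_series s"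
  unfolding mangoldt_series_def by (intro summable_sums summable_norm_cancel[OF mangoldt_series_summable])


text \<open>
  Multiply the two absolutely convergent series and collect the terms with $ab = n$: since
  $\sum_{d \mid n} \Lambda(d) = \log n$, the result is the series of $-\zeta'$.
\<close>

lemma zeta_times_mangoldt_series:
  assumes s: "Re s > 1"
  shows "zeta_series s * mangoldt_series s = - deriv zeta_series s"
proof -
  define A where "A = {1::nat..}"
  have reindex: "(f has_sum S) A" if "(\<lambda>n. f (Suc n)) sums S" "summable (\<lambda>n. norm (f (Suc n)))" for f :: "nat \<Rightarrow> complex" and S
  proof -
    have "((\<lambda>n. f (Suc n)) has_sum S) UNIV" using that by (intro norm_summable_imp_has_sum)
    moreover have "bij_betw Suc UNIV A"
      by (rule bij_betwI[of _ _ _ "\<lambda>n. n - 1"]) (auto simp: A_def)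
    ultimately show ?thesis using has_sum_reindex_bij_betw[of Suc UNIV A f S] by simp
  qed
  define f where "f = (\<lambda>n. of_nat n powr (-s) :: complex)"
  define g where "g = (\<lambda>n. mangoldt n * of_nat n powr (-s) :: complex)"
  have f: "(f has_sum zeta_series s) A" "((\<lambda>n. norm (f n)) summable_on A)"
  proof -
    show "(f has_sum zeta_series s) A" unfolding f_def
      by (intro reindex zeta_series_sums zeta_series_derivative_sums(1) s)
    have "((\<lambda>n. complex_of_real (norm (f n))) has_sum (\<Sum>n. complex_of_real (norm (f (Suc n))))) A"
      using zeta_series_derivative_sums(1)[OF s] 
      by (intro reindex summable_sums) (auto simp: f_def summable_complex_of_real)
    from has_sum_Re[OF this] show "(\<lambda>n. norm (f n)) summable_on A" by (auto simp: has_sum_imp_summable)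
  qed
  have g: "(g has_sum mangoldt_series s) A" "((\<lambda>n. norm (g n)) summable_on A)"
  proof -
    show "(g has_sum mangoldt_series s) A" unfolding g_def
      by (intro reindex mangoldt_series_sums mangoldt_series_summable s)
    have "((\<lambda>n. complex_of_real (norm (g n))) has_sum (\<Sum>n. complex_of_real (norm (g (Suc n))))) A"
      using mangoldt_series_summable[OF s] 
      by (intro reindex summable_sums) (auto simp: g_def summable_complex_of_real)
    from has_sum_Re[OF this] show "(\<lambda>n. norm (g n)) summable_on A" by (auto simp: has_sum_imp_summable)
  qed
  have "(\<lambda>x. norm (case x of (a, b) \<Rightarrow> f a * g b)) summable_on A \<times> A"
    using f(2) g(2) by (intro iffD2[OF Infinite_Sum.abs_summable_on_Sigma_iff])
      (auto simp: norm_mult infsum_cmult_right' abs_mult infsum_nonneg intro!: summable_on_cmult_left summable_on_cmult_right)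
  hence "(\<lambda>(a, b). f a * g b) summable_on A \<times> A" by (rule abs_summable_summable)
  then obtain S where S: "((\<lambda>(a, b). f a * g b) has_sum S) (A \<times> A)" by (auto simp: summable_on_def)
  have "((\<lambda>a. f a * mangoldt_series s) has_sum S) A"
    using S by (rule has_sum_SigmaD) (auto intro!: has_sum_cmult_right g)
  moreover have "((\<lambda>a. f a * mangoldt_series s) has_sum (zeta_series s * mangoldt_series s)) A"
    by (intro has_sum_cmult_left f)
  ultimately have S_eq: "S = zeta_series s * mangoldt_series s" using has_sum_unique by blast

  have "((\<lambda>(n, d). f (n div d) * g d) has_sum S) (SIGMA n:A. {d. d dvd n})"
  proof (rule iffD1[OF has_sum_reindex_bij_witness[where i = "\<lambda>(n, d). (n div d, d)" and j = "\<lambda>(a, b). (a * b, b)"] S])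
    fix x assume "x \<in> A \<times> A"
    thus "(case (case x of (a, b) \<Rightarrow> (a * b, b)) of (n, d) \<Rightarrow> (n div d, d)) = x"
      "(case x of (a, b) \<Rightarrow> (a * b, b)) \<in> (SIGMA n:A. {d. d dvd n})" 
      "(case (case x of (a, b) \<Rightarrow> (a * b, b)) of (n, d) \<Rightarrow> f (n div d) * g d) = (case x of (a, b) \<Rightarrow> f a * g b)"
      by (auto simp: A_def)
  next
    fix x assume x: "x \<in> (SIGMA n:A. {d. d dvd n})"
    then obtain n d where nd: "x = (n, d)" "n \<ge> 1" "d dvd n" by (auto simp: A_def)
    hence "d \<ge> 1" "n div d \<ge> 1" by (auto elim!: dvdE simp: Suc_le_eq intro!: Nat.gr0I)
    thus "(case (case x of (n, d) \<Rightarrow> (n div d, d)) of (a, b) \<Rightarrow> (a * b, b)) = x"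
      "(case x of (n, d) \<Rightarrow> (n div d, d)) \<in> A \<times> A" using nd by (auto simp: A_def)
  qed auto
  hence 1: "((\<lambda>n. of_real (ln (real n)) * of_nat n powr (-s)) has_sum S) A"
  proof (rule has_sum_SigmaD)
    fix n assume n: "n \<in> A"
    have "(\<Sum>d | d dvd n. f (n div d) * g d) = (\<Sum>d | d dvd n. mangoldt d * of_nat n powr (-s))"
    proof (intro sum.cong refl)
      fix d assume d: "d \<in> {d. d dvd n}"
      then obtain k where k: "n = d * k" by auto
      hence "d > 0" "k > 0" using n by (auto simp: A_def intro!: Nat.gr0I)
      have "of_nat n powr (-s) = (of_nat d powr (-s) * of_nat k powr (-s) :: complex)"
        unfolding k of_nat_mult by (rule powr_times_real) auto
      moreover have "n div d = k" using k \<open>d > 0\<close> by simp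
      ultimately show "f (n div d) * g d = mangoldt d * of_nat n powr (-s)"
        by (simp add: f_def g_def)
    qed
    also have "\<dots> = of_real (ln (real n)) * of_nat n powr (-s)"
      using n by (subst sum_distrib_right [symmetric], subst mangoldt_sum) (auto simp: A_def)
    finally show "((\<lambda>d. case (n, d) of (n, d) \<Rightarrow> f (n div d) * g d) has_sum (of_real (ln (real n)) * of_nat n powr (-s))) {d. d dvd n}"
      using n by (intro has_sum_finiteI) (auto simp: A_def)
  qed
  have "(\<lambda>n. of_real (ln (real (Suc n))) * of_nat (Suc n) powr (-s)) sums (- deriv zeta_series s)"
    using sums_minus[OF zeta_series_derivative_sums(3)[OF s]] by simp
  hence 2: "((\<lambda>n. of_real (ln (real n)) * of_nat n powr (-s)) has_sum (- deriv zeta_series s)) A"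
    by (rule reindex) (use summable_ln_powr[OF s] in \<open>simp add: norm_mult norm_powr_real_powr\<close>)
  show ?thesis using has_sum_unique[OF 1 2] S_eq by simp
qed

text \<open>
  The identity $\zeta \cdot \sum \Lambda(n) n^{-s} = -\zeta'$ in terms of $(s - 1)\zeta(s)$, written without a quotient
  because it will serve to show that there are no zeros to the right of the line.
\<close>

lemma zeta_reg_times_mangoldt_series:
  assumes s: "Re s > 1"
  shows "zeta_reg s * mangoldt_series s = - deriv zeta_reg s + zeta_reg s / (s - 1)"
proof -
  have "((\<lambda>s. (s - 1) * zeta_series s) has_field_derivative (zeta_series s + (s - 1) * deriv zeta_series s)) (at s)"
    using zeta_series_derivative_sums(2)[OF s] by (auto intro!: derivative_eq_intros)
  hence "(zeta_reg has_field_derivative (zeta_series s + (s - 1) * deriv zeta_series s)) (at s)"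
    by (rule has_field_derivative_transform_within_open[OF _ open_halfspace_Re_gt[of 1]]) (use s zeta_reg_eq in auto)
  hence "deriv zeta_reg s = zeta_series s + (s - 1) * deriv zeta_series s" by (rule DERIV_imp_deriv)
  also have "deriv zeta_series s = - (zeta_series s * mangoldt_series s)"
    using zeta_times_mangoldt_series[OF s] by simp
  finally have "deriv zeta_reg s = zeta_series s - (s - 1) * zeta_series s * mangoldt_series s"
    by simp
  moreover have "s - 1 \<noteq> 0" using s by auto
  ultimately show ?thesis using s by (simp add: zeta_reg_eq)
qed

section \<open>Absence of zeros of zeta with real part at least 1\<close>

text \<open>
  Near a zero of order $m$ the function $-f'/f$ behaves like $-m/(s - s_0)$; at $s_0 = 1$ the simple pole of $\zeta$
  contributes $1$. Only the approach from the right, where the Dirichlet series converges, is considered.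
\<close>

lemma mangoldt_series_residue:
  assumes s0: "Re s0 \<ge> 1"
  shows "\<exists>m :: nat. (m = 0 \<longleftrightarrow> zeta_reg s0 \<noteq> 0) \<and>
    ((\<lambda>\<epsilon>. of_real \<epsilon> * mangoldt_series (s0 + of_real \<epsilon>)) \<longlongrightarrow> (if s0 = 1 then 1 else 0) - of_nat m) (at_right 0)"
proof -
  let ?S = "{s. Re s > 0}"
  have S: "open ?S" "connected ?S" "s0 \<in> ?S"
    using s0 by (auto intro!: open_halfspace_Re_gt convex_connected convex_halfspace_Re_gt)
  obtain k r and m :: nat where kr: "0 < r" "ball s0 r \<subseteq> ?S" "k holomorphic_on ball s0 r"
    "\<And>w. w \<in> ball s0 r \<Longrightarrow> zeta_reg w = (w - s0) ^ m * k w" "\<And>w. w \<in> ball s0 r \<Longrightarrow> k w \<noteq> 0"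
    "m = 0 \<longleftrightarrow> zeta_reg s0 \<noteq> 0"
  proof (cases "zeta_reg s0 = 0")
    case True
    have "\<not> zeta_reg constant_on ?S"
    proof
      assume "zeta_reg constant_on ?S"
      then obtain c where c: "\<And>s. Re s > 0 \<Longrightarrow> zeta_reg s = c" by (auto simp: constant_on_def)
      show False using c[of 1] c[of s0] S(3) True zeta_reg_1 by simp
    qed
    then show ?thesis
    proof (rule holomorphic_factor_zero_nonconstant[OF zeta_reg_holomorphic S True])
      fix g r and n :: nat
      assume "0 < n" "0 < r" "ball s0 r \<subseteq> ?S" "g holomorphic_on ball s0 r"
        "\<And>w. w \<in> ball s0 r \<Longrightarrow> zeta_reg w = (w - s0) ^ n * g w" "\<And>w. w \<in> ball s0 r \<Longrightarrow> g w \<noteq> 0"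
      then show ?thesis using True by (intro that[of r g n]) auto
    qed
  next
    case False
    have "isCont zeta_reg s0"
      using holomorphic_on_imp_continuous_on[OF zeta_reg_holomorphic] S by (simp add: continuous_on_eq_continuous_at)
    from continuous_at_avoid[OF this False] obtain e where e: "e > 0" "\<And>y. dist s0 y < e \<Longrightarrow> zeta_reg y \<noteq> 0" by auto
    obtain e' where e': "e' > 0" "ball s0 e' \<subseteq> ?S" using S by (auto simp: open_contains_ball)
    show ?thesis
      using e e' False by (intro that[of "min e e'" zeta_reg 0] holomorphic_on_subset[OF zeta_reg_holomorphic]) (auto simp: subset_iff)
  qed
  define L where "L = (\<lambda>w. deriv k w / k w)"
  have L_cont: "isCont L s0"
    unfolding L_def using kr 
    by (intro continuous_intros continuous_on_interior[of "ball s0 r"] holomorphic_on_imp_continuous_on holomorphic_deriv) auto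
  have eq: "of_real \<epsilon> * mangoldt_series (s0 + of_real \<epsilon>) = - of_nat m - of_real \<epsilon> * L (s0 + of_real \<epsilon>)
      + of_real \<epsilon> / (s0 + of_real \<epsilon> - 1)" if \<epsilon>: "0 < \<epsilon>" "\<epsilon> < r" for \<epsilon> :: real
  proof -
    define w where "w = s0 + of_real \<epsilon>"
    have w: "w \<in> ball s0 r" "Re w > 1" "w - s0 = of_real \<epsilon>" using \<epsilon> s0 by (auto simp: w_def dist_norm)
    have "(k has_field_derivative deriv k w) (at w)" using kr(3) w by (intro holomorphic_derivI) auto
    hence "((\<lambda>w. (w - s0) ^ m * k w) has_field_derivative 
        (of_nat m * (w - s0) ^ (m - 1) * k w + (w - s0) ^ m * deriv k w)) (at w)"
      by (auto intro!: derivative_eq_intros)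
    hence "(zeta_reg has_field_derivative (of_nat m * (w - s0) ^ (m - 1) * k w + (w - s0) ^ m * deriv k w)) (at w)"
      by (rule has_field_derivative_transform_within_open[OF _ open_ball w(1)]) (use kr in auto)
    hence d: "deriv zeta_reg w = of_nat m * (w - s0) ^ (m - 1) * k w + (w - s0) ^ m * deriv k w"
      by (rule DERIV_imp_deriv)
    have "of_real \<epsilon> * deriv zeta_reg w = of_nat m * (of_real \<epsilon> ^ m * k w) + of_real \<epsilon> * (of_real \<epsilon> ^ m * deriv k w)"
      unfolding d w(3) by (cases m) (auto simp: algebra_simps)
    moreover have "of_real \<epsilon> ^ m * k w * (of_real \<epsilon> * mangoldt_series w) 
        = - (of_real \<epsilon> * deriv zeta_reg w) + of_real \<epsilon> * (of_real \<epsilon> ^ m * k w / (w - 1))"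
      using arg_cong[OF zeta_reg_times_mangoldt_series[OF w(2)], of "\<lambda>x. of_real \<epsilon> * x"] kr(4)[OF w(1)] w(3)
      by (simp add: algebra_simps)
    ultimately have "of_real \<epsilon> ^ m * k w * (of_real \<epsilon> * mangoldt_series w) 
        = of_real \<epsilon> ^ m * k w * (- of_nat m - of_real \<epsilon> * L w + of_real \<epsilon> / (w - 1))"
      using kr(5)[OF w(1)] by (simp add: L_def algebra_simps)
    moreover have "of_real \<epsilon> ^ m * k w \<noteq> 0" using kr(5)[OF w(1)] \<epsilon> by simp
    ultimately show ?thesis unfolding w_def by (simp only: mult_cancel_left) simp
  qed
  have add: "((\<lambda>\<epsilon>. s0 + complex_of_real \<epsilon>) \<longlongrightarrow> s0 + of_real 0) (at_right 0)" by (intro tendsto_intros)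
  have "((\<lambda>\<epsilon>. L (s0 + of_real \<epsilon>)) \<longlongrightarrow> L s0) (at_right 0)"
    using isCont_tendsto_compose[OF L_cont] add by simp
  hence A: "((\<lambda>\<epsilon>. of_real \<epsilon> * L (s0 + of_real \<epsilon>)) \<longlongrightarrow> of_real 0 * L s0) (at_right 0)"
    by (intro tendsto_intros)
  have B: "((\<lambda>\<epsilon>. of_real \<epsilon> / (s0 + of_real \<epsilon> - 1)) \<longlongrightarrow> (if s0 = 1 then 1 else 0)) (at_right 0)"
  proof (cases "s0 = 1")
    case True
    have "eventually (\<lambda>\<epsilon>::real. 1 = complex_of_real \<epsilon> / (s0 + of_real \<epsilon> - 1)) (at_right 0)"
      using eventually_at_right_less[of "0::real"] by eventually_elim (use True in auto)
    then show ?thesis using True by (intro Lim_transform_eventually[OF tendsto_const]) auto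
  next
    case False
    have "((\<lambda>\<epsilon>. of_real \<epsilon> / (s0 + of_real \<epsilon> - 1)) \<longlongrightarrow> of_real 0 / (s0 + of_real 0 - 1)) (at_right 0)"
      using False by (intro tendsto_intros) auto
    then show ?thesis using False by simp
  qed
  have "((\<lambda>\<epsilon>. - of_nat m - of_real \<epsilon> * L (s0 + of_real \<epsilon>) + of_real \<epsilon> / (s0 + of_real \<epsilon> - 1))
      \<longlongrightarrow> - of_nat m - of_real 0 * L s0 + (if s0 = 1 then 1 else 0)) (at_right 0)"
    by (rule tendsto_add[OF tendsto_diff[OF tendsto_const A] B])
  moreover have "eventually (\<lambda>\<epsilon>. - of_nat m - of_real \<epsilon> * L (s0 + of_real \<epsilon>) + of_real \<epsilon> / (s0 + of_real \<epsilon> - 1)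
      = of_real \<epsilon> * mangoldt_series (s0 + of_real \<epsilon>)) (at_right 0)"
    using eventually_at_right_real[OF kr(1)] by eventually_elim (simp add: eq)
  ultimately have "((\<lambda>\<epsilon>. of_real \<epsilon> * mangoldt_series (s0 + of_real \<epsilon>)) 
      \<longlongrightarrow> - of_nat m - of_real 0 * L s0 + (if s0 = 1 then 1 else 0)) (at_right 0)"
    by (rule Lim_transform_eventually)
  then show ?thesis using kr(6) by (intro exI[of _ m]) (simp add: algebra_simps)
qed

text \<open>
  The coefficients of $\Lambda(n) n^{-\sigma}$ are $3 + 4 \cos\alpha + \cos 2\alpha = 2 (1 + \cos\alpha)^2 \ge 0$ with
  $\alpha = t \log n$.
\<close>

lemma mangoldt_series_3_4_1:
  fixes \<sigma> t :: real
  assumes "\<sigma> > 1"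
  shows "3 * Re (mangoldt_series \<sigma>) + 4 * Re (mangoldt_series (Complex \<sigma> t)) + Re (mangoldt_series (Complex \<sigma> (2 * t))) \<ge> 0"
proof -
  have Re_term: "Re (mangoldt (Suc n) * of_nat (Suc n) powr (- Complex \<sigma> u)) 
      = mangoldt (Suc n) * (real (Suc n) powr (-\<sigma>) * cos (u * ln (real (Suc n))))" for n u
  proof -
    have "(of_nat (Suc n) :: complex) powr (- Complex \<sigma> u) = exp (- Complex \<sigma> u * of_real (ln (real (Suc n))))"
      unfolding powr_def by (simp add: Ln_of_nat del: of_nat_Suc)
    hence "Re (of_nat (Suc n) powr (- Complex \<sigma> u)) = real (Suc n) powr (-\<sigma>) * cos (u * ln (real (Suc n)))"
      by (simp add: Re_exp powr_def del: of_nat_Suc)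
    thus ?thesis by (simp add: times_complex.sel(1) del: of_nat_Suc)
  qed
  have sums: "(\<lambda>n. mangoldt (Suc n) * (real (Suc n) powr (-\<sigma>) * cos (u * ln (real (Suc n))))) sums Re (mangoldt_series (Complex \<sigma> u))" for u
    unfolding Re_term[symmetric] by (intro sums_Re mangoldt_series_sums) (use assms in auto)
  define f where "f = (\<lambda>u n. mangoldt (Suc n) * (real (Suc n) powr (-\<sigma>) * cos (u * ln (real (Suc n)))) :: real)"
  have f: "f u sums Re (mangoldt_series (Complex \<sigma> u))" for u
    unfolding f_def by (rule sums)
  have nonneg: "3 * f 0 n + 4 * f t n + f (2 * t) n \<ge> 0" for n
  proof -
    define c where "c = cos (t * ln (real (Suc n)))"
    define a where "a = mangoldt (Suc n) * real (Suc n) powr (-\<sigma>)"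
    have "cos (2 * (t * ln (real (Suc n)))) = 2 * c\<^sup>2 - 1"
      unfolding c_def by (rule cos_double_cos)
    hence "f 0 n = a" "f t n = a * c" "f (2 * t) n = a * (2 * c\<^sup>2 - 1)"
      unfolding f_def a_def c_def by (simp_all only: mult.assoc mult_zero_left cos_zero mult_1_right)
    hence "3 * f 0 n + 4 * f t n + f (2 * t) n = 2 * (a * (1 + c)\<^sup>2)"
      by (simp add: algebra_simps power2_eq_square)
    moreover have "a \<ge> 0" unfolding a_def by (intro mult_nonneg_nonneg mangoldt_nonneg powr_ge_zero)
    ultimately show ?thesis by simp
  qed
  have "0 \<le> 3 * Re (mangoldt_series (Complex \<sigma> 0)) + 4 * Re (mangoldt_series (Complex \<sigma> t)) + Re (mangoldt_series (Complex \<sigma> (2 * t)))"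
    by (rule sums_le[OF nonneg sums_zero sums_add[OF sums_add[OF sums_mult[OF f] sums_mult[OF f]] f]])
  moreover have "complex_of_real \<sigma> = Complex \<sigma> 0" by (simp add: complex_eq_iff)
  ultimately show ?thesis by simp
qed

text \<open>
  To the right of the line the Dirichlet series of $\Lambda$ is bounded, so its residue, minus the order of the zero, vanishes. On the line,
  zeros of orders $m$ at $1 + it$ and $m_2$ at $1 + 2it$ give $3 - 4m - m_2 \ge 0$, which forces $m = 0$.
\<close>

theorem zeta_reg_nonzero:
  assumes "Re s \<ge> 1"
  shows "zeta_reg s \<noteq> 0"
proof -
  obtain m :: nat where m: "m = 0 \<longleftrightarrow> zeta_reg s \<noteq> 0" 
    "((\<lambda>\<epsilon>. of_real \<epsilon> * mangoldt_series (s + of_real \<epsilon>)) \<longlongrightarrow> (if s = 1 then 1 else 0) - of_nat m) (at_right 0)"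
    using mangoldt_series_residue[OF assms] by (elim exE conjE) (rule that)
  have "m = 0"
  proof (cases "Re s > 1")
    case True
    define B where "B = (\<Sum>n. norm (mangoldt (Suc n) * of_nat (Suc n) powr (-s) :: complex))"
    have bound: "norm (mangoldt_series (s + of_real \<epsilon>)) \<le> B" if "\<epsilon> > 0" for \<epsilon> :: real
    proof -
      have "norm (mangoldt_series (s + of_real \<epsilon>)) 
          \<le> (\<Sum>n. norm (mangoldt (Suc n) * of_nat (Suc n) powr (-(s + of_real \<epsilon>)) :: complex))"
        unfolding mangoldt_series_def
        by (rule summable_norm[OF mangoldt_series_summable]) (use True that in simp)
      also have "\<dots> \<le> B"
        unfolding B_def
      proof (intro suminf_le mangoldt_series_summable)
        fix n
        show "norm (mangoldt (Suc n) * of_nat (Suc n) powr (-(s + of_real \<epsilon>)) :: complex)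
          \<le> norm (mangoldt (Suc n) * of_nat (Suc n) powr (-s) :: complex)"
          using that unfolding norm_mult norm_mangoldt
          by (intro mult_left_mono mangoldt_nonneg, subst (1 2) norm_powr_real_powr) (auto intro!: powr_mono)
      qed (use True that in auto)
      finally show ?thesis .
    qed
    have lim0: "((\<lambda>\<epsilon>. of_real \<epsilon> * mangoldt_series (s + of_real \<epsilon>)) \<longlongrightarrow> 0) (at_right 0)"
    proof (rule Lim_null_comparison)
      have "((\<lambda>\<epsilon>. \<epsilon> * B) \<longlongrightarrow> 0 * B) (at_right 0)" by (intro tendsto_mult tendsto_ident_at tendsto_const)
      thus "((\<lambda>\<epsilon>. \<epsilon> * B) \<longlongrightarrow> 0) (at_right 0)" by simp
      show "eventually (\<lambda>\<epsilon>. norm (of_real \<epsilon> * mangoldt_series (s + of_real \<epsilon>)) \<le> \<epsilon> * B) (at_right 0)"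
        using eventually_at_right_less[of "0::real"] 
      proof eventually_elim
        case (elim \<epsilon>)
        thus ?case using bound[OF elim] by (simp add: norm_mult mult_left_mono)
      qed
    qed
    have "(if s = 1 then 1 else 0) - of_nat m = (0 :: complex)"
      by (rule tendsto_unique[OF trivial_limit_at_right_real m(2) lim0])
    moreover have "s \<noteq> 1" using True by auto
    ultimately show ?thesis by simp
  next
    case False
    with assms have s: "s = Complex 1 (Im s)" by (auto simp: complex_eq_iff)
    show ?thesis
    proof (cases "s = 1")
      case True
      then show ?thesis using m(1) zeta_reg_1 by simp
    next
      case False
      define t where "t = Im s"
      have t: "t \<noteq> 0" "s = Complex 1 t" using s False by (auto simp: t_def complex_eq_iff)
      have "Re 1 \<ge> 1" "Re (Complex 1 (2 * t)) \<ge> 1" by simp_all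
      note res = this[THEN mangoldt_series_residue]
      obtain m1 :: nat where m1: "m1 = 0 \<longleftrightarrow> zeta_reg 1 \<noteq> 0" 
        "((\<lambda>\<epsilon>. of_real \<epsilon> * mangoldt_series (1 + of_real \<epsilon>)) \<longlongrightarrow> (if 1 = (1::complex) then 1 else 0) - of_nat m1) (at_right 0)"
        using res(1) by (elim exE conjE) (rule that)
      hence "m1 = 0" by (simp add: zeta_reg_1)
      obtain m2 :: nat where m2: 
        "((\<lambda>\<epsilon>. of_real \<epsilon> * mangoldt_series (Complex 1 (2 * t) + of_real \<epsilon>)) \<longlongrightarrow> (if Complex 1 (2 * t) = 1 then 1 else 0) - of_nat m2) (at_right 0)"
        using res(2) by (elim exE conjE) (rule that)
      have "((\<lambda>\<epsilon>. 3 * Re (of_real \<epsilon> * mangoldt_series (1 + of_real \<epsilon>)) + 4 * Re (of_real \<epsilon> * mangoldt_series (s + of_real \<epsilon>))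
          + Re (of_real \<epsilon> * mangoldt_series (Complex 1 (2 * t) + of_real \<epsilon>)))
          \<longlongrightarrow> 3 * Re ((if 1 = (1::complex) then 1 else 0) - of_nat m1) + 4 * Re ((if s = 1 then 1 else 0) - of_nat m) + Re ((if Complex 1 (2 * t) = 1 then 1 else 0) - of_nat m2)) (at_right 0)"
        by (rule tendsto_add[OF tendsto_add[OF tendsto_mult[OF tendsto_const tendsto_Re[OF m1(2)]]
              tendsto_mult[OF tendsto_const tendsto_Re[OF m(2)]]] tendsto_Re[OF m2]])
      moreover have "eventually (\<lambda>\<epsilon>. 3 * Re (of_real \<epsilon> * mangoldt_series (1 + of_real \<epsilon>)) + 4 * Re (of_real \<epsilon> * mangoldt_series (s + of_real \<epsilon>))
          + Re (of_real \<epsilon> * mangoldt_series (Complex 1 (2 * t) + of_real \<epsilon>)) \<ge> 0) (at_right 0)"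
        using eventually_at_right_less[of "0::real"]
      proof eventually_elim
        case (elim \<epsilon>)
        have "0 \<le> \<epsilon> * (3 * Re (mangoldt_series (complex_of_real (1 + \<epsilon>))) + 4 * Re (mangoldt_series (Complex (1 + \<epsilon>) t)) 
             + Re (mangoldt_series (Complex (1 + \<epsilon>) (2 * t))))"
          using elim by (intro mult_nonneg_nonneg mangoldt_series_3_4_1) auto
        moreover have "Complex (1 + \<epsilon>) t = s + of_real \<epsilon>" "Complex (1 + \<epsilon>) (2 * t) = Complex 1 (2 * t) + of_real \<epsilon>"
          using t by (auto simp: complex_eq_iff)
        ultimately show ?case by (simp add: algebra_simps)
      qed
      ultimately have "3 * Re ((if 1 = (1::complex) then 1 else 0) - of_nat m1) + 4 * Re ((if s = 1 then 1 else 0) - of_nat m) + Re ((if Complex 1 (2 * t) = 1 then 1 else 0) - of_nat m2) \<ge> 0"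
        by (intro tendsto_lowerbound) auto
      moreover have "Complex 1 (2 * t) \<noteq> 1" using t by (auto simp: complex_eq_iff)
      ultimately show ?thesis using False \<open>m1 = 0\<close> by simp
    qed
  qed
  thus ?thesis using m(1) by simp
qed

section \<open>The Dirichlet series of Chebyshev's psi function\<close>

text \<open>
  The difference between $s \sum \psi(n) n^{-s-1}$ and $\sum \Lambda(n) n^{-s}$, where the increment of $t^{-s}$ from $n$ to
  $n + 1$ has been replaced by its derivative at $n$.
\<close>

definition psi_remainder_series :: "complex \<Rightarrow> complex" where
  "psi_remainder_series s = (\<Sum>n. of_real (chebyshev_psi (Suc n)) * powr_remainder n s)"

text \<open>
  By Chebyshev's estimate the growth of $\psi$ costs one of the two powers gained by the Taylor remainder.
\<close>

lemma psi_remainder_series_props: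
  shows psi_remainder_series_holomorphic: "psi_remainder_series holomorphic_on {s. Re s > 0}"
    and psi_remainder_series_sums: "\<And>s. Re s > 0 \<Longrightarrow> 
      (\<lambda>n. of_real (chebyshev_psi (Suc n)) * powr_remainder n s) sums psi_remainder_series s"
proof -
  have 1: "(\<lambda>s. of_real (chebyshev_psi (Suc n)) * powr_remainder n s) holomorphic_on A" for n A
    by (intro holomorphic_on_mult holomorphic_on_const powr_remainder_holomorphic)
  have 2: "norm (of_real (chebyshev_psi (Suc n)) * powr_remainder n s) 
      \<le> (4 * (norm s * norm (s + 1))) * real (Suc n) powr (-1 - (Re s - 0))" if "Re s > 0" for n s
  proof -
    have "norm (of_real (chebyshev_psi (Suc n)) * powr_remainder n s) 
        \<le> (4 * real (Suc n)) * (norm s * norm (s + 1) * real (Suc n) powr (-2 - Re s))"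
      unfolding norm_mult using norm_powr_remainder_le[of s n] chebyshev_psi_le[of "Suc n"] chebyshev_psi_nonneg[of "Suc n"] that
      by (intro mult_mono) auto
    also have "\<dots> = (4 * (norm s * norm (s + 1))) * (real (Suc n) powr 1 * real (Suc n) powr (-2 - Re s))"
      by simp
    also have "real (Suc n) powr 1 * real (Suc n) powr (-2 - Re s) = real (Suc n) powr (-1 - (Re s - 0))"
      by (subst powr_add [symmetric]) (simp add: algebra_simps)
    finally show ?thesis .
  qed
  have 3: "continuous_on {s. Re s > 0} (\<lambda>s :: complex. 4 * (norm s * norm (s + 1)))"
    by (intro continuous_intros)
  show "psi_remainder_series holomorphic_on {s. Re s > 0}"
    unfolding psi_remainder_series_def by (rule holomorphic_suminf_half_plane(1)[OF 1 _ 3]) (rule 2)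
  show "(\<lambda>n. of_real (chebyshev_psi (Suc n)) * powr_remainder n s) sums psi_remainder_series s" if "Re s > 0" for s
    unfolding psi_remainder_series_def
    by (rule summable_sums, rule summable_norm_cancel, rule holomorphic_suminf_half_plane(2)[OF 1 _ 3 that]) (rule 2)
qed

lemma chebyshev_psi_Suc: "chebyshev_psi (Suc n) = chebyshev_psi n + mangoldt (Suc n)"
  by (simp add: chebyshev_psi_def)

lemma mangoldt_series_by_parts:
  assumes s: "Re s > 1"
  shows "(\<lambda>n. of_real (chebyshev_psi (Suc n)) * (of_nat (Suc n) powr (-s) - of_nat (Suc (Suc n)) powr (-s))) sums mangoldt_series s"
proof -
  define a where "a = (\<lambda>n. of_nat (Suc n) powr (-s) :: complex)"
  have partial: "(\<Sum>n<N. of_real (chebyshev_psi (Suc n)) * (a n - a (Suc n)))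
      = (\<Sum>n<N. mangoldt (Suc n) * a n) - of_real (chebyshev_psi N) * a N" for N
  proof (induction N)
    case 0
    then show ?case by (simp add: chebyshev_psi_def)
  next
    case (Suc N)
    then show ?case by (simp add: chebyshev_psi_Suc algebra_simps)
  qed
  have lim: "(\<lambda>N. of_real (chebyshev_psi N) * a N) \<longlonglongrightarrow> 0"
  proof (rule Lim_null_comparison)
    show "(\<lambda>N. 4 * real (Suc N) powr (1 - Re s)) \<longlonglongrightarrow> 0"
      unfolding of_nat_Suc using s by real_asymp
    show "eventually (\<lambda>N. norm (of_real (chebyshev_psi N) * a N) \<le> 4 * real (Suc N) powr (1 - Re s)) sequentially"
    proof (rule always_eventually, rule allI)
      fix N
      have "chebyshev_psi N \<le> 4 * real (Suc N)" using chebyshev_psi_le[of N] by (simp add: of_nat_Suc)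
      hence "norm (of_real (chebyshev_psi N) * a N) \<le> (4 * real (Suc N)) * real (Suc N) powr (-Re s)"
        unfolding norm_mult a_def using chebyshev_psi_nonneg[of N] by (intro mult_mono) (auto simp: norm_powr_real_powr)
      also have "\<dots> = 4 * real (Suc N) powr (1 - Re s)" by (simp add: powr_diff powr_minus field_simps)
      finally show "norm (of_real (chebyshev_psi N) * a N) \<le> 4 * real (Suc N) powr (1 - Re s)" .
    qed
  qed
  have "(\<lambda>N. (\<Sum>n<N. mangoldt (Suc n) * a n) - of_real (chebyshev_psi N) * a N) \<longlonglongrightarrow> mangoldt_series s - 0"
    using mangoldt_series_sums[OF s] lim unfolding sums_def a_def by (intro tendsto_diff)
  hence "(\<lambda>N. \<Sum>n<N. of_real (chebyshev_psi (Suc n)) * (a n - a (Suc n))) \<longlonglongrightarrow> mangoldt_series s"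
    by (simp only: partial diff_zero)
  thus ?thesis unfolding sums_def a_def .
qed

lemma psi_dirichlet_series_sums:
  assumes s: "Re s > 1"
  shows "(\<lambda>n. of_real (chebyshev_psi (Suc n)) * of_nat (Suc n) powr (-s - 1)) 
    sums ((mangoldt_series s + psi_remainder_series s) / s)"
proof -
  have "s \<noteq> 0" using s by auto
  have "Re s > 0" using s by simp
  have "(\<lambda>n. (of_real (chebyshev_psi (Suc n)) * (of_nat (Suc n) powr (-s) - of_nat (Suc (Suc n)) powr (-s))
        + of_real (chebyshev_psi (Suc n)) * powr_remainder n s) / s) sums ((mangoldt_series s + psi_remainder_series s) / s)"
    by (rule sums_divide[OF sums_add[OF mangoldt_series_by_parts[OF s] psi_remainder_series_sums[OF \<open>Re s > 0\<close>]]])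
  moreover have "(of_real (chebyshev_psi (Suc n)) * (of_nat (Suc n) powr (-s) - of_nat (Suc (Suc n)) powr (-s))
        + of_real (chebyshev_psi (Suc n)) * powr_remainder n s) / s = of_real (chebyshev_psi (Suc n)) * of_nat (Suc n) powr (-s - 1)" for n
    using \<open>s \<noteq> 0\<close> by (simp add: powr_remainder_def field_simps)
  ultimately show ?thesis by simp
qed

text \<open>
  With $f(s) = (s-1)\zeta(s)$ the series with coefficients $\psi(k)/k - 1$ has the sum
  $$\frac{1}{s}\Big({-\frac{f'(s)}{f(s)}} + \sum_n \psi(n) r_n(s) - 1\Big) - \frac{f(s) - 1}{s - 1}$$
  where $r_n$ are the Taylor remainders: the poles of $\Lambda$- and $\zeta$-series at $s = 1$ cancel, and the non-vanishing
  of $f$ makes this holomorphic in a neighbourhood of $\mathrm{Re}\, s \ge 1$. Newman's theorem applies at $s = 1$.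
\<close>

theorem convergent_sum_psi:
  "convergent (\<lambda>N. \<Sum>k=1..N. (chebyshev_psi k - real k) / (real k)\<^sup>2)"
proof -
  define E where "E = (\<lambda>s. if s = 1 then deriv zeta_reg 1 else (zeta_reg s - zeta_reg 1) / (s - 1))"
  define T where "T = {s. Re s > 0} \<inter> zeta_reg -` (- {0})"
  have "open T" unfolding T_def
    by (intro continuous_open_preimage open_halfspace_Re_gt holomorphic_on_imp_continuous_on zeta_reg_holomorphic) auto
  define H where "H = (\<lambda>s. (- deriv zeta_reg s / zeta_reg s + psi_remainder_series s - 1) / s - E s)"
  have T_sub: "T \<subseteq> {s. Re s > 0}" by (auto simp: T_def)
  have "E holomorphic_on {s. Re s > 0}"
    unfolding E_def by (intro pole_lemma_open zeta_reg_holomorphic open_halfspace_Re_gt)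
  moreover have "deriv zeta_reg holomorphic_on {s. Re s > 0}"
    by (intro holomorphic_deriv zeta_reg_holomorphic open_halfspace_Re_gt)
  ultimately have H_hol: "H holomorphic_on T"
    unfolding H_def
    by (intro holomorphic_intros holomorphic_on_subset[OF _ T_sub] zeta_reg_holomorphic psi_remainder_series_holomorphic)
      (use \<open>open T\<close> in \<open>auto simp: T_def\<close>)
  define U where "U = (\<lambda>z. 1 + z) -` T"
  define G where "G = (\<lambda>z. H (1 + z))"
  have U: "open U" "{z. Re z \<ge> 0} \<subseteq> U" "G holomorphic_on U"
  proof -
    show "open U" unfolding U_def using \<open>open T\<close> by (intro open_vimage continuous_intros)
    show "{z. Re z \<ge> 0} \<subseteq> U" using zeta_reg_nonzero by (auto simp: U_def T_def)
    have "H \<circ> (\<lambda>z. 1 + z) holomorphic_on U"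
      using H_hol by (intro holomorphic_on_compose_gen[of _ _ _ T] holomorphic_intros) (auto simp: U_def)
    thus "G holomorphic_on U" by (simp add: G_def o_def)
  qed
  define a where "a = (\<lambda>n. complex_of_real (chebyshev_psi n / real n - 1))"
  have "norm (a n) \<le> 5" for n
  proof (cases "n = 0")
    case False
    have "chebyshev_psi n / real n \<le> 4" "chebyshev_psi n / real n \<ge> 0"
      using False chebyshev_psi_le[of n] chebyshev_psi_nonneg[of n] by (auto simp: field_simps)
    thus ?thesis unfolding a_def norm_of_real by linarith
  qed (simp add: a_def)
  moreover have "(\<lambda>n. a (Suc n) * of_nat (Suc n) powr (-1 - z)) sums G z" if "Re z > 0" for z
  proof -
    define s where "s = 1 + z"
    have s: "Re s > 1" "s - 1 \<noteq> 0" "s \<noteq> 0" using that by (auto simp: s_def complex_eq_iff)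
    have nz: "zeta_reg s \<noteq> 0" using s by (intro zeta_reg_nonzero) auto
    have "(\<lambda>n. of_real (chebyshev_psi (Suc n)) * of_nat (Suc n) powr (-s - 1) - of_nat (Suc n) powr (-s)) 
        sums ((mangoldt_series s + psi_remainder_series s) / s - zeta_series s)"
      by (rule sums_diff[OF psi_dirichlet_series_sums[OF s(1)] zeta_series_sums[OF s(1)]])
    moreover have "of_real (chebyshev_psi (Suc n)) * of_nat (Suc n) powr (-s - 1) - of_nat (Suc n) powr (-s)
        = a (Suc n) * of_nat (Suc n) powr (-1 - z)" for n
    proof -
      have "(of_nat (Suc n) powr (-s - 1) :: complex) = of_nat (Suc n) powr (-s) / of_nat (Suc n)"
        by (simp add: powr_diff)
      moreover have "-1 - z = -s" by (simp add: s_def)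
      ultimately show ?thesis by (simp only:) (simp add: a_def algebra_simps)
    qed
    moreover have "(mangoldt_series s + psi_remainder_series s) / s - zeta_series s = G z"
    proof -
      have M: "mangoldt_series s = - deriv zeta_reg s / zeta_reg s + 1 / (s - 1)"
        using zeta_reg_times_mangoldt_series[OF s(1)] nz s by (simp add: field_simps)
      have Z: "zeta_series s = zeta_reg s / (s - 1)" using zeta_reg_eq[OF s(1)] s by simp
      have "(mangoldt_series s + psi_remainder_series s) / s - zeta_series s 
        = (- deriv zeta_reg s / zeta_reg s + psi_remainder_series s - 1) / s + (1 / (s - 1) + 1) / s - zeta_reg s / (s - 1)"
        unfolding M Z by (simp add: add_divide_distrib diff_divide_distrib)
      also have "(1 / (s - 1) + 1) / s = 1 / (s - 1)" using s by (simp add: field_simps)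
      also have "(- deriv zeta_reg s / zeta_reg s + psi_remainder_series s - 1) / s + 1 / (s - 1) - zeta_reg s / (s - 1) = H s"
        using s by (simp add: H_def E_def zeta_reg_1 diff_divide_distrib)
      finally show ?thesis by (simp add: G_def s_def)
    qed
    ultimately show ?thesis by simp
  qed
  ultimately have "(\<lambda>N. \<Sum>k=1..N. a k / of_nat k) \<longlonglongrightarrow> G 0"
    by (intro newman_tauberian[OF _ U])
  hence "(\<lambda>N. Re (\<Sum>k=1..N. a k / of_nat k)) \<longlonglongrightarrow> Re (G 0)" by (rule tendsto_Re)
  moreover have "Re (\<Sum>k=1..N. a k / of_nat k) = (\<Sum>k=1..N. (chebyshev_psi k - real k) / (real k)\<^sup>2)" for N
    by (simp add: a_def Re_divide_of_nat) (intro sum.cong; simp add: field_simps power2_eq_square)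
  ultimately show ?thesis by (auto simp: convergent_def)
qed

section \<open>The prime number theorem for prime powers\<close>

lemma convergent_imp_differences_small:
  fixes S :: "nat \<Rightarrow> real"
  assumes "convergent S" "e > 0"
  shows "eventually (\<lambda>N. \<forall>m\<ge>N. \<forall>n\<ge>N. \<bar>S m - S n\<bar> < e) sequentially"
  using Cauchy_convergent_iff[of S] assms unfolding Cauchy_def dist_real_def eventually_sequentially
  by (meson le_trans)

lemma chebyshev_psi_mono: "m \<le> n \<Longrightarrow> chebyshev_psi m \<le> chebyshev_psi n"
  unfolding chebyshev_psi_def by (intro sum_mono2 mangoldt_nonneg) auto

text \<open>
  If $\psi(n) > (1 + 2\delta) n$ then, $\psi$ being monotone, $\psi(k) - k \ge \delta n$ for all $k$ from $n$ to
  $(1 + \delta) n$, and this stretch contributes at least a fixed multiple of $\delta^2$ to the convergent series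
  $\sum (\psi(k) - k)/k^2$. For large $n$ that is impossible. The lower bound uses the $k$ from $(1 - \delta) n$ to $n$.
\<close>

theorem prime_number_theorem_psi: "(\<lambda>n. chebyshev_psi n / real n) \<longlonglongrightarrow> 1"
proof -
  define f where "f = (\<lambda>k. (chebyshev_psi k - real k) / (real k)\<^sup>2)"
  define S where "S = (\<lambda>N. \<Sum>k=1..N. f k)"
  have diff: "S m - S n = (\<Sum>k=Suc n..m. f k)" if "n \<le> m" for m n
  proof -
    have "{1..m} = {1..n} \<union> {Suc n..m}" using that by auto
    thus ?thesis unfolding S_def by (simp add: sum.union_disjoint)
  qed
  have key: "eventually (\<lambda>n. \<bar>chebyshev_psi n - real n\<bar> \<le> 2 * \<delta> * n) sequentially" if \<delta>: "0 < \<delta>" "\<delta> < 1/2" for \<delta> :: real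
  proof -
    have "convergent S" using convergent_sum_psi by (simp add: S_def f_def)
    from convergent_imp_differences_small[OF this, of "\<delta>\<^sup>2 / 8"] \<delta> obtain N0 where 
      N0: "\<And>m n. m \<ge> N0 \<Longrightarrow> n \<ge> N0 \<Longrightarrow> \<bar>S m - S n\<bar> < \<delta>\<^sup>2 / 8" 
      by (auto simp: eventually_sequentially)
    have claim: "\<bar>chebyshev_psi n - real n\<bar> \<le> 2 * \<delta> * n" if n: "n \<ge> 2 * N0" "real n \<ge> 2 / \<delta>" for n
    proof -
      define r where "r = nat \<lfloor>\<delta> * n\<rfloor>"
      have "2 \<le> \<delta> * n" using n \<delta> by (simp add: field_simps)
      hence r: "real r \<le> \<delta> * n" "real r \<ge> \<delta> * n / 2" unfolding r_def by linarith+
      have "n > 0" using n \<delta> by (intro Nat.gr0I) auto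
      have pos: "\<delta> * real n \<ge> 0" using \<delta> by simp
      have "chebyshev_psi n - real n \<le> 2 * \<delta> * n"
      proof (rule ccontr)
        assume less: "\<not> chebyshev_psi n - real n \<le> 2 * \<delta> * n"
        have "\<delta>\<^sup>2 / 8 = (\<delta> * n / 2) * (\<delta> / (4 * n))" using \<open>n > 0\<close> by (simp add: field_simps power2_eq_square)
        also have "\<dots> \<le> real r * (\<delta> / (4 * n))" using r \<delta> by (intro mult_right_mono) auto
        also have "\<dots> = (\<Sum>k=Suc n..n + r. \<delta> / (4 * n))" by simp
        also have "\<dots> \<le> (\<Sum>k=Suc n..n + r. f k)"
        proof (intro sum_mono)
          fix k assume k: "k \<in> {Suc n..n + r}"
          have "real k \<le> real (n + r)" using k by (intro of_nat_mono) auto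
          hence k_le: "real k \<le> n + \<delta> * n" using r by simp
          have "chebyshev_psi k \<ge> chebyshev_psi n" using k by (intro chebyshev_psi_mono) auto
          hence num: "chebyshev_psi k - real k \<ge> \<delta> * n" using less k_le by linarith
          have "\<delta> * n \<le> 1 * real n" using \<delta> by (intro mult_right_mono) auto
          hence "real k \<le> 2 * real n" using k_le by linarith
          hence "(real k)\<^sup>2 \<le> (2 * real n)\<^sup>2" by (intro power_mono) auto
          hence "\<delta> * n / (2 * real n)\<^sup>2 \<le> f k"
            unfolding f_def using num order_trans[OF pos num] k \<open>n > 0\<close> by (intro frac_le) auto
          thus "\<delta> / (4 * n) \<le> f k" using \<open>n > 0\<close> by (simp add: power2_eq_square)
        qed
        also have "\<dots> = S (n + r) - S n" by (rule diff[symmetric]) simp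
        also have "\<dots> < \<delta>\<^sup>2 / 8" using N0[of "n + r" n] n by linarith
        finally show False by simp
      qed
      moreover have "chebyshev_psi n - real n \<ge> - (2 * \<delta> * n)"
      proof (rule ccontr)
        assume less: "\<not> chebyshev_psi n - real n \<ge> - (2 * \<delta> * n)"
        have "\<delta> * n \<le> 1 / 2 * real n" using \<delta> by (intro mult_right_mono) auto
        hence r_le: "real r \<le> real n / 2" using r by linarith
        hence "r \<le> n" by simp
        have "\<delta>\<^sup>2 / 2 = (\<delta> * n / 2) * (\<delta> / n)" using \<open>n > 0\<close> by (simp add: field_simps power2_eq_square)
        also have "\<dots> \<le> real r * (\<delta> / n)" using r \<delta> by (intro mult_right_mono) auto
        also have "\<dots> = (\<Sum>k=Suc (n - r)..n. \<delta> / n)" using \<open>r \<le> n\<close> by simp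
        also have "\<dots> \<le> (\<Sum>k=Suc (n - r)..n. - f k)"
        proof (intro sum_mono)
          fix k assume k: "k \<in> {Suc (n - r)..n}"
          have "real n \<le> real (k + r)" using k by (intro of_nat_mono) auto
          hence k_ge: "real k \<ge> n - \<delta> * n" using r by simp
          have "chebyshev_psi k \<le> chebyshev_psi n" using k by (intro chebyshev_psi_mono) auto
          hence num: "real k - chebyshev_psi k \<ge> \<delta> * n" using less k_ge by linarith
          have "(real k)\<^sup>2 \<le> (real n)\<^sup>2" using k by (intro power_mono) auto
          hence "\<delta> * n / (real n)\<^sup>2 \<le> (real k - chebyshev_psi k) / (real k)\<^sup>2"
            using num order_trans[OF pos num] k \<open>n > 0\<close> by (intro frac_le) auto
          also have "\<dots> = - f k" by (simp add: f_def diff_divide_distrib)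
          finally show "\<delta> / n \<le> - f k" using \<open>n > 0\<close> by (simp add: power2_eq_square)
        qed
        also have "\<dots> = - (S n - S (n - r))" by (subst diff) (auto simp: sum_negf)
        also have "\<dots> < \<delta>\<^sup>2 / 8" using N0[of n "n - r"] n r_le by linarith
        finally show False using \<delta> by simp
      qed
      ultimately show ?thesis by linarith
    qed
    have "eventually (\<lambda>n. real n \<ge> 2 / \<delta>) sequentially"
      using filterlim_real_sequentially by (auto simp: filterlim_at_top)
    with eventually_ge_at_top[of "2 * N0"] show ?thesis by eventually_elim (rule claim)
  qed
  show ?thesis
  proof (rule tendstoI)
    fix e :: real assume e: "e > 0"
    define \<delta> where "\<delta> = min (e / 4) (1 / 4)"
    have \<delta>: "0 < \<delta>" "\<delta> < 1/2" "2 * \<delta> < e" using e by (auto simp: \<delta>_def)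
    show "eventually (\<lambda>n. dist (chebyshev_psi n / real n) 1 < e) sequentially"
      using key[OF \<delta>(1,2)] eventually_gt_at_top[of 0]
    proof eventually_elim
      case (elim n)
      have "dist (chebyshev_psi n / real n) 1 = \<bar>chebyshev_psi n - real n\<bar> / n"
      proof -
        have "chebyshev_psi n / real n - 1 = (chebyshev_psi n - real n) / n" using elim by (simp add: diff_divide_distrib)
        thus ?thesis by (simp add: dist_real_def abs_divide)
      qed
      also have "\<dots> \<le> 2 * \<delta>" using elim by (simp add: field_simps)
      finally show ?case using \<delta> by linarith
    qed
  qed
qed

text \<open>
  Partial summation. The boundary term tends to $0$ by the prime number theorem, and $1/(k(k+1))$ differs from the weight
  $1/k^2$ of the previous series by an amount that leads to absolute convergence.
\<close>

theorem convergent_sum_mangoldt_minus_1: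
  "convergent (\<lambda>N. \<Sum>k=1..N. (mangoldt k - 1) / real k :: real)"
proof -
  define f where "f = (\<lambda>k. (chebyshev_psi k - real k) / (real k)\<^sup>2)"
  define g where "g = (\<lambda>k. (chebyshev_psi k - real k) / ((real k)\<^sup>2 * (real k + 1)))"
  have parts: "(\<Sum>k=1..N. (mangoldt k - 1) / real k) = (chebyshev_psi N - N) / (real N + 1) + (\<Sum>k=1..N. f k) - (\<Sum>k=1..N. g k)" for N
  proof (induction N)
    case 0
    then show ?case by (simp add: chebyshev_psi_def)
  next
    case (Suc N)
    define x where "x = chebyshev_psi N"
    define M where "M = real N + 1"
    have M: "M \<noteq> 0" "M + 1 \<noteq> 0" by (auto simp: M_def)
    have "(mangoldt (Suc N) - 1) / M = (x + mangoldt (Suc N) - M) / (M + 1) - (x - (M - 1)) / M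
       + (x + mangoldt (Suc N) - M) / M\<^sup>2 - (x + mangoldt (Suc N) - M) / (M\<^sup>2 * (M + 1))"
      using M by (simp add: divide_simps power2_eq_square) (simp add: algebra_simps)
    thus ?case using Suc by (simp add: f_def g_def chebyshev_psi_Suc x_def M_def of_nat_Suc add_ac)
  qed
  have "convergent (\<lambda>N. \<Sum>k=1..N. f k)" using convergent_sum_psi by (simp add: f_def)
  moreover have "convergent (\<lambda>N. \<Sum>k=1..N. g k)"
  proof -
    have "summable (\<lambda>k. g (Suc k))"
    proof (rule summable_comparison_test[OF _ summable_mult[of _ 5]], intro exI[of _ 0] allI impI)
      show "summable (\<lambda>k. 1 / (real (Suc k))\<^sup>2)"
        using inverse_squares_sums by (simp add: sums_iff of_nat_Suc add.commute)
      fix k :: nat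
      have "\<bar>chebyshev_psi (Suc k) - real (Suc k)\<bar> \<le> 5 * (real (Suc k) + 1)"
        using chebyshev_psi_le[of "Suc k"] chebyshev_psi_nonneg[of "Suc k"] by (simp add: of_nat_Suc)
      hence "\<bar>chebyshev_psi (Suc k) - real (Suc k)\<bar> / ((real (Suc k))\<^sup>2 * (real (Suc k) + 1)) \<le> 5 * (real (Suc k) + 1) / ((real (Suc k))\<^sup>2 * (real (Suc k) + 1))"
        by (intro divide_right_mono) auto
      also have "\<dots> = 5 * (1 / (real (Suc k))\<^sup>2)"
      proof -
        have "real (Suc k) + 1 \<noteq> 0" by linarith
        from nonzero_mult_divide_mult_cancel_right[OF this, of 5 "(real (Suc k))\<^sup>2"] show ?thesis by simp
      qed
      finally show "norm (g (Suc k)) \<le> 5 * (1 / (real (Suc k))\<^sup>2)" by (simp add: g_def abs_mult)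
    qed
    thus ?thesis by (simp add: summable_iff_convergent sum.atLeast1_atMost_eq)
  qed
  moreover have "convergent (\<lambda>N. (chebyshev_psi N - N) / (real N + 1))"
  proof -
    have lim: "(\<lambda>N. real N / (real N + 1)) \<longlonglongrightarrow> 1" by real_asymp
    have "(\<lambda>N. chebyshev_psi N / N * (N / (real N + 1)) - N / (real N + 1)) \<longlonglongrightarrow> 1 * 1 - 1"
      by (intro tendsto_diff tendsto_mult prime_number_theorem_psi lim)
    moreover have "chebyshev_psi N / N * (N / (real N + 1)) - N / (real N + 1) = (chebyshev_psi N - N) / (real N + 1)" for N
      by (cases "N = 0") (simp_all add: chebyshev_psi_def diff_divide_distrib)
    ultimately show ?thesis by (auto simp: convergent_def)
  qed
  ultimately show ?thesis unfolding parts by (intro convergent_diff convergent_add)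
qed


lemma Cesaro_mean_tendsto:
  fixes s :: "nat \<Rightarrow> real"
  assumes "s \<longlonglongrightarrow> L"
  shows "(\<lambda>N. (\<Sum>k<N. s k) / real N) \<longlonglongrightarrow> L"
proof (rule tendstoI)
  fix e :: real assume e: "e > 0"
  from tendstoD[OF assms, of "e / 2"] e obtain N0 where N0: "\<And>k. k \<ge> N0 \<Longrightarrow> \<bar>s k - L\<bar> < e / 2"
    by (auto simp: eventually_sequentially dist_real_def)
  define A where "A = (\<Sum>k<N0. \<bar>s k - L\<bar>)"
  have "A \<ge> 0" by (simp add: A_def sum_nonneg)
  have "eventually (\<lambda>N. real N > 2 * A / e) sequentially"
    using filterlim_real_sequentially by (auto simp: filterlim_at_top_dense)
  thus "eventually (\<lambda>N. dist ((\<Sum>k<N. s k) / real N) L < e) sequentially"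
    using eventually_ge_at_top[of "max 1 N0"]
  proof eventually_elim
    case (elim N)
    have "{..<N} = {..<N0} \<union> {N0..<N}" using elim by auto
    hence "(\<Sum>k<N. \<bar>s k - L\<bar>) = A + (\<Sum>k=N0..<N. \<bar>s k - L\<bar>)"
      by (simp add: A_def sum.union_disjoint ivl_disj_int)
    also have "(\<Sum>k=N0..<N. \<bar>s k - L\<bar>) \<le> (\<Sum>k=N0..<N. e / 2)"
      using N0 by (intro sum_mono) (auto intro: less_imp_le)
    also have "\<dots> \<le> N * (e / 2)" using e by (simp add: mult_right_mono)
    finally have *: "(\<Sum>k<N. \<bar>s k - L\<bar>) \<le> A + N * (e / 2)" by simp
    have "(\<Sum>k<N. s k) / real N - L = (\<Sum>k<N. s k - L) / N"
      using elim by (simp add: sum_subtractf field_simps)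
    also have "\<bar>\<dots>\<bar> \<le> (\<Sum>k<N. \<bar>s k - L\<bar>) / N" by (auto simp: abs_divide intro!: divide_right_mono sum_abs)
    also have "\<dots> \<le> (A + N * (e / 2)) / N" using * by (intro divide_right_mono) auto
    also have "\<dots> = A / N + e / 2" using elim by (simp add: field_simps)
    also have "A / N < e / 2" using elim e by (simp add: field_simps)
    finally show ?case by (simp add: dist_real_def)
  qed
qed

text \<open>
  The weighted sum is $N$ times the difference of the last partial sum and the mean of the earlier ones.
\<close>

lemma Kronecker_lemma:
  fixes d :: "nat \<Rightarrow> real"
  assumes "(\<lambda>N. \<Sum>k=1..N. d k) \<longlonglongrightarrow> L"
  shows "(\<lambda>N. (\<Sum>k=1..N. real k * d k) / real N) \<longlonglongrightarrow> 0"
proof -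
  define s where "s = (\<lambda>N. \<Sum>k=1..N. d k)"
  have "(\<Sum>k=1..N. real k * d k) = real N * s N - (\<Sum>k<N. s k)" for N
    by (induction N) (auto simp: s_def algebra_simps of_nat_Suc)
  moreover have "(\<lambda>N. s N - (\<Sum>k<N. s k) / real N) \<longlonglongrightarrow> L - L"
    using assms by (intro tendsto_diff Cesaro_mean_tendsto) (auto simp: s_def)
  hence "(\<lambda>N. (real N * s N - (\<Sum>k<N. s k)) / real N) \<longlonglongrightarrow> L - L"
    by (rule Lim_transform_eventually)
      (auto intro!: eventually_sequentiallyI[of 1] simp: field_simps)
  ultimately show ?thesis by simp
qed

text \<open>
  Partial summation bounds the sum of $d_k b_k$ over $N < k \le m$ by $2 e\, b_N$, where $e$ bounds the deviation of the
  partial sums of $d$ from their limit from $N$ on. So the series converges and its remainder is not only small but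
  $o(b_N)$; this gain turns $o(1)$ into the $o(1/\log N)$ needed for $\sum 1/p$.
\<close>

lemma Dirichlet_test_remainder:
  fixes d b :: "nat \<Rightarrow> real"
  assumes conv: "(\<lambda>N. \<Sum>k=1..N. d k) \<longlonglongrightarrow> L"
    and b_pos: "\<And>k. k \<ge> 2 \<Longrightarrow> b k > 0" and b_mono: "\<And>k. k \<ge> 2 \<Longrightarrow> b (Suc k) \<le> b k"
  shows "\<exists>M. (\<lambda>N. ((\<Sum>k=2..N. d k * b k) - M) / b N) \<longlonglongrightarrow> 0"
proof -
  define D where "D = (\<lambda>N. (\<Sum>k=1..N. d k) - L)"
  define u where "u = (\<lambda>N. \<Sum>k=2..N. d k * b k)"
  have D: "D \<longlonglongrightarrow> 0" unfolding D_def using conv by (simp add: LIM_zero)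
  have bound: "\<bar>u m - u N\<bar> \<le> 2 * e * b N" if N: "N \<ge> 2" "N \<le> m" and e: "\<And>k. k \<ge> N \<Longrightarrow> \<bar>D k\<bar> \<le> e" for N m e
  proof -
    have "\<bar>u m - u N - D m * b m\<bar> \<le> e * b N + e * (b N - b m) \<and> b m \<le> b N" using N(2)
    proof (induction m rule: dec_induct)
      case base
      have "\<bar>D N\<bar> * b N \<le> e * b N" using e[of N] b_pos[OF N(1)] by (intro mult_right_mono) auto
      thus ?case using b_pos[OF N(1)] by (simp add: abs_mult)
    next
      case (step m)
      have "u (Suc m) = u m + d (Suc m) * b (Suc m)" "D (Suc m) = D m + d (Suc m)"
        using step N by (auto simp: u_def D_def)
      hence "u (Suc m) - u N - D (Suc m) * b (Suc m) = (u m - u N - D m * b m) + D m * (b m - b (Suc m))"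
        by (simp add: algebra_simps)
      moreover have "\<bar>D m * (b m - b (Suc m))\<bar> \<le> e * (b m - b (Suc m))"
        unfolding abs_mult using e[of m] b_mono[of m] step N by (intro mult_mono) auto
      moreover have "e * (b m - b (Suc m)) = e * (b N - b (Suc m)) - e * (b N - b m)" by (simp add: algebra_simps)
      ultimately show ?case using step b_mono[of m] N by linarith
    qed
    moreover have "\<bar>D m * b m\<bar> \<le> e * b m"
      unfolding abs_mult using e[of m] b_pos[of m] N by (intro mult_mono) auto
    moreover have "e * (b N - b m) = e * b N - e * b m" by (simp add: algebra_simps)
    ultimately show ?thesis by linarith
  qed
  have b_le: "b N \<le> b 2" if "N \<ge> 2" for N
    using that by (induction N rule: dec_induct) (auto intro: order_trans[OF b_mono])
  have small: "eventually (\<lambda>N. \<forall>m\<ge>N. \<bar>u m - u N\<bar> \<le> e * b N) sequentially" if "e > 0" for e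
  proof -
    from tendstoD[OF D, of "e / 2"] that obtain N0 where N0: "\<And>k. k \<ge> N0 \<Longrightarrow> \<bar>D k\<bar> < e / 2"
      by (auto simp: eventually_sequentially)
    show ?thesis
    proof (rule eventually_sequentiallyI[of "max 2 N0"], intro allI impI)
      fix N m assume "max 2 N0 \<le> N" "N \<le> m"
      thus "\<bar>u m - u N\<bar> \<le> e * b N" using bound[of N m "e / 2"] N0 by (force intro: less_imp_le)
    qed
  qed
  have "Cauchy u"
    unfolding Cauchy_altdef dist_real_def
  proof (intro allI impI)
    fix e :: real assume e: "e > 0"
    define e' where "e' = e / (2 * b 2)"
    have "b 2 > 0" by (rule b_pos) simp
    hence e': "e' > 0" "e' * b 2 < e" using e by (auto simp: e'_def field_simps)
    from small[OF e'(1)] obtain N where N: "\<And>n m. n \<ge> N \<Longrightarrow> m \<ge> n \<Longrightarrow> \<bar>u m - u n\<bar> \<le> e' * b n"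
      by (auto simp: eventually_sequentially)
    show "\<exists>N. \<forall>m\<ge>N. \<forall>n>m. \<bar>u m - u n\<bar> < e"
    proof (intro exI[of _ "max 2 N"] allI impI)
      fix m n assume mn: "m \<ge> max 2 N" "m < n"
      have "\<bar>u n - u m\<bar> \<le> e' * b m" using mn by (intro N) auto
      also have "\<dots> \<le> e' * b 2" using mn e' by (intro mult_left_mono b_le) auto
      finally show "\<bar>u m - u n\<bar> < e" using e' by linarith
    qed
  qed
  then obtain M where M: "u \<longlonglongrightarrow> M" using Cauchy_convergent_iff convergent_def by blast
  have "(\<lambda>N. (u N - M) / b N) \<longlonglongrightarrow> 0"
  proof (rule tendstoI)
    fix e :: real assume e: "e > 0"
    hence "e / 2 > 0" by simp
    from small[OF this] eventually_ge_at_top[of 2]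
    show "eventually (\<lambda>N. dist ((u N - M) / b N) 0 < e) sequentially"
    proof eventually_elim
      case (elim N)
      have "\<bar>M - u N\<bar> \<le> e / 2 * b N"
      proof (rule tendsto_upperbound)
        show "(\<lambda>m. \<bar>u m - u N\<bar>) \<longlonglongrightarrow> \<bar>M - u N\<bar>" by (intro tendsto_intros M)
        show "eventually (\<lambda>m. \<bar>u m - u N\<bar> \<le> e / 2 * b N) sequentially"
          using elim by (intro eventually_sequentiallyI[of N]) auto
      qed auto
      hence "\<bar>u N - M\<bar> / b N \<le> e / 2" using b_pos[OF elim(2)] by (simp add: field_simps abs_minus_commute)
      hence "\<bar>u N - M\<bar> / b N < e" using e by linarith
      thus ?case using b_pos[OF elim(2)] by (simp add: dist_real_def abs_divide)
    qed
  qed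
  thus ?thesis unfolding u_def by blast
qed

section \<open>From prime powers to primes\<close>

definition prime_ln :: "nat \<Rightarrow> real" where
  "prime_ln k = (if prime k then ln (real k) else 0)"

definition chebyshev_theta :: "nat \<Rightarrow> real" where
  "chebyshev_theta n = (\<Sum>k=1..n. prime_ln k)"

definition prime_reciprocals :: "nat \<Rightarrow> real" where
  "prime_reciprocals n = (\<Sum>k=2..n. if prime k then 1 / real k else 0)"

lemma prime_ln_le_mangoldt: "prime_ln k \<le> mangoldt k"
  by (simp add: prime_ln_def mangoldt_nonneg)

lemma ln_le_two_sqrt:
  fixes x :: real
  assumes "x > 0"
  shows "ln x \<le> 2 * x powr (1/2)"
proof -
  have "ln x = 2 * ln (x powr (1/2))" using assms by (simp add: ln_powr)
  also have "ln (x powr (1/2)) \<le> x powr (1/2)" using assms by (intro ln_bound) auto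
  finally show ?thesis by simp
qed

text \<open>
  Only the proper prime powers $p^j$ with $j \ge 2$ contribute, with $\log p / p^j$. Enlarging the range of $p$ to all
  integers from $2$ on and summing the geometric series leaves $\sum_p 2 \log p / p^2 \le 4 \sum_p p^{-3/2} \le 8$.
\<close>

lemma sum_proper_prime_powers_le:
  "(\<Sum>k=1..N. (mangoldt k - prime_ln k) / real k) \<le> 8"
proof -
  define A where "A = {k \<in> {1..N}. primepow k \<and> \<not> prime k}"
  define h where "h = (\<lambda>k :: nat. (aprimedivisor k, multiplicity (aprimedivisor k) k))"
  define g where "g = (\<lambda>(p :: nat, j :: nat). ln (real p) / real p ^ j)"
  have A: "prime (fst (h k))" "k = fst (h k) ^ snd (h k)" "snd (h k) \<ge> 2" "fst (h k) \<ge> 2" if k: "k \<in> A" for k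
  proof -
    have pk: "primepow k" "\<not> prime k" "k \<noteq> 0" using k by (auto simp: A_def)
    have "k > 1" using pk by (intro primepow_gt_Suc_0[unfolded One_nat_def[symmetric]])
    thus p: "prime (fst (h k))" by (auto simp: h_def intro!: prime_aprimedivisor')
    show eq: "k = fst (h k) ^ snd (h k)" using primepow_decompose[OF pk(1)] by (simp add: h_def)
    have "snd (h k) \<noteq> 0" using eq \<open>k > 1\<close> by (metis power_0 less_irrefl)
    moreover have "snd (h k) \<noteq> 1" using eq p pk by (metis power_one_right)
    ultimately show "snd (h k) \<ge> 2" by linarith
    show "fst (h k) \<ge> 2" using p by (rule prime_ge_2_nat)
  qed
  have inj: "inj_on h A" using A(2) by (metis inj_onI)
  have h_le: "h k \<in> {2..N} \<times> {2..N}" if k: "k \<in> A" for k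
  proof -
    have "fst (h k) ^ 1 \<le> fst (h k) ^ snd (h k)" using A[OF k] by (intro power_increasing) auto
    moreover have "snd (h k) < fst (h k) ^ snd (h k)" using A[OF k] by (intro power_gt_expt) auto
    moreover have "k \<le> N" using k by (simp add: A_def)
    ultimately show ?thesis using A[OF k] by (metis mem_Sigma_iff atLeastAtMost_iff less_imp_le_nat le_trans power_one_right prod.collapse)
  qed
  have "(\<Sum>k=1..N. (mangoldt k - prime_ln k) / real k) = (\<Sum>k\<in>A. (mangoldt k - prime_ln k) / real k)"
    by (intro sum.mono_neutral_right) (auto simp: A_def prime_ln_def mangoldt_def[of k for k] simp del: One_nat_def)
  also have "\<dots> = (\<Sum>k\<in>A. g (h k))"
  proof (intro sum.cong refl)
    fix k assume k: "k \<in> A"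
    have "mangoldt k = ln (real (fst (h k)))" using k by (simp add: mangoldt_def A_def h_def)
    moreover have "real k = real (fst (h k)) ^ snd (h k)" using A(2)[OF k] by (metis of_nat_power)
    moreover have "prime_ln k = 0" using k by (simp add: A_def prime_ln_def)
    ultimately show "(mangoldt k - prime_ln k) / real k = g (h k)" by (simp add: g_def case_prod_beta)
  qed
  also have "\<dots> = (\<Sum>x\<in>h ` A. g x)" using inj by (simp add: sum.reindex)
  also have "\<dots> \<le> (\<Sum>x\<in>{2..N} \<times> {2..N}. g x)"
    using image_subsetI[of A h, OF h_le] by (intro sum_mono2) (auto simp: g_def)
  also have "\<dots> = (\<Sum>p=2..N. \<Sum>j=2..N. ln (real p) / real p ^ j)"
    by (simp add: g_def sum.cartesian_product)
  also have "\<dots> \<le> (\<Sum>p=2..N. 4 * real p powr (-1 - 1/2))"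
  proof (intro sum_mono)
    fix p assume p: "p \<in> {2..N}"
    define q where "q = 1 / real p"
    have q: "0 < q" "q \<le> 1/2" using p by (auto simp: q_def field_simps)
    have "(\<Sum>j=2..N. q ^ j) \<le> 2 * q\<^sup>2"
    proof -
      have "(\<Sum>j=2..M. q ^ j) \<le> 2 * q\<^sup>2 - q ^ M" if "M \<ge> 2" for M
        using that
      proof (induction M rule: dec_induct)
        case (step n)
        have "2 * q ^ Suc n \<le> q ^ n" using q by simp
        thus ?case using step by simp
      qed (use q in simp)
      from this[of N] have "(\<Sum>j=2..N. q ^ j) \<le> 2 * q\<^sup>2 - q ^ N" using p by simp
      moreover have "q ^ N \<ge> 0" using q by simp
      ultimately show ?thesis by linarith
    qed
    hence "ln (real p) * (\<Sum>j=2..N. q ^ j) \<le> (2 * real p powr (1/2)) * (2 * q\<^sup>2)"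
      using p q by (intro mult_mono ln_le_two_sqrt sum_nonneg) auto
    also have "\<dots> = 4 * real p powr (-1 - 1/2)"
    proof -
      have "q\<^sup>2 = real p powr (-2)" using p by (simp add: q_def powr_minus powr_numeral field_simps)
      hence "(2 * real p powr (1/2)) * (2 * q\<^sup>2) = 4 * (real p powr (1/2) * real p powr (-2))" by simp
      thus ?thesis by (simp flip: powr_add)
    qed
    finally show "(\<Sum>j=2..N. ln (real p) / real p ^ j) \<le> 4 * real p powr (-1 - 1/2)"
      by (simp add: sum_distrib_left q_def power_one_over field_simps)
  qed
  also have "\<dots> = 4 * (\<Sum>p=Suc 1..N. real p powr (-1 - 1/2))" by (simp add: sum_distrib_left numeral_2_eq_2)
  also have "\<dots> \<le> 4 * (real 1 powr (- (1/2)) / (1/2))" by (intro mult_left_mono sum_powr_tail_le) auto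
  finally show ?thesis by (simp del: One_nat_def)
qed

theorem convergent_sum_prime_ln_minus_1:
  "convergent (\<lambda>N. \<Sum>k=1..N. (prime_ln k - 1) / real k)"
proof -
  define r where "r = (\<lambda>N. \<Sum>k=1..N. (mangoldt k - prime_ln k) / real k)"
  have "incseq r"
    unfolding r_def by (intro incseq_SucI) (simp add: prime_ln_le_mangoldt)
  moreover have "\<forall>N. r N \<le> 8" unfolding r_def using sum_proper_prime_powers_le by simp
  ultimately have "convergent r" by (metis incseq_convergent convergentI)
  from convergent_diff[OF convergent_sum_mangoldt_minus_1 this]
  have "convergent (\<lambda>N. (\<Sum>k=1..N. (mangoldt k - 1) / real k) - r N)" .
  moreover have "(\<Sum>k=1..N. (mangoldt k - 1) / real k) - r N = (\<Sum>k=1..N. (prime_ln k - 1) / real k)" for N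
    unfolding r_def by (subst sum_subtractf [symmetric]) (simp add: diff_divide_distrib)
  ultimately show ?thesis by simp
qed

theorem prime_number_theorem_theta: "(\<lambda>n. chebyshev_theta n / real n) \<longlonglongrightarrow> 1"
proof -
  from convergent_sum_prime_ln_minus_1 obtain L where "(\<lambda>N. \<Sum>k=1..N. (prime_ln k - 1) / real k) \<longlonglongrightarrow> L"
    by (auto simp: convergent_def)
  from Kronecker_lemma[OF this] 
  have "(\<lambda>N. (\<Sum>k=1..N. real k * ((prime_ln k - 1) / real k)) / real N) \<longlonglongrightarrow> 0" .
  moreover have "(\<Sum>k=1..N. real k * ((prime_ln k - 1) / real k)) = chebyshev_theta N - N" for N
  proof -
    have "(\<Sum>k=1..N. real k * ((prime_ln k - 1) / real k)) = (\<Sum>k=1..N. prime_ln k - 1)"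
      by (intro sum.cong) auto
    thus ?thesis by (simp add: chebyshev_theta_def sum_subtractf)
  qed
  ultimately have "(\<lambda>N. (chebyshev_theta N - N) / real N) \<longlonglongrightarrow> 0" by simp
  from tendsto_add[OF this tendsto_const[of 1]]
  have "(\<lambda>N. (chebyshev_theta N - N) / real N + 1) \<longlonglongrightarrow> 1" by simp
  thus ?thesis
    by (rule Lim_transform_eventually) (auto intro!: eventually_sequentiallyI[of 1] simp: field_simps)
qed

text \<open>
  The increments of $\log\log$ lie between consecutive terms of the series. So the difference $t_N$ decreases, while
  $t_N - 1/(N \log N)$ increases, and $t_N$ is within $1/(N \log N)$ of its limit.
\<close>

lemma sum_inverse_n_ln_n_remainder:
  "\<exists>T. (\<lambda>N. ln (real N) * ((\<Sum>k=2..N. 1 / (real k * ln (real k))) - ln (ln (real N)) - T)) \<longlonglongrightarrow> 0"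
proof -
  define b where "b = (\<lambda>k :: nat. 1 / (real k * ln (real k)))"
  define t where "t = (\<lambda>N. (\<Sum>k=2..N. b k) - ln (ln (real N)))"
  have step: "b (Suc n) \<le> ln (ln (real (Suc n))) - ln (ln (real n)) \<and> ln (ln (real (Suc n))) - ln (ln (real n)) \<le> b n"
    if n: "n \<ge> 2" for n
  proof -
    have "((\<lambda>x. ln (ln x)) has_real_derivative 1 / (x * ln x)) (at x)" if "real n \<le> x" "x \<le> real (Suc n)" for x
    proof -
      have "x > 1" using that n by simp
      thus ?thesis by (auto intro!: derivative_eq_intros simp: field_simps)
    qed
    from MVT2[of "real n" "real (Suc n)", OF _ this] obtain x where
      x: "real n < x" "x < real (Suc n)" "ln (ln (real (Suc n))) - ln (ln (real n)) = 1 / (x * ln x)" 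
      by (auto simp: of_nat_Suc)
    have "x * ln x \<le> real (Suc n) * ln (real (Suc n))" "real n * ln (real n) \<le> x * ln x"
      using x n by (intro mult_mono; simp)+
    moreover have "real n * ln (real n) > 0" "x * ln x > 0" "real (Suc n) * ln (real (Suc n)) > 0"
      using n x by (auto intro!: mult_pos_pos)
    ultimately show ?thesis unfolding x(3) b_def by (intro conjI frac_le) (assumption | simp)+
  qed
  have b_nonneg: "b n \<ge> 0" for n by (cases "n = 0") (auto simp: b_def)
  have t_Suc: "t (Suc n) = t n + b (Suc n) - (ln (ln (real (Suc n))) - ln (ln (real n)))" if "n \<ge> 2" for n
    using that by (simp add: t_def)
  define s where "s = (\<lambda>n. t (n + 2))"
  have dec: "decseq s"
  proof (rule decseq_SucI)
    fix n show "s (Suc n) \<le> s n" using step[of "n + 2"] t_Suc[of "n + 2"] by (simp add: s_def)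
  qed
  have inc: "incseq (\<lambda>n. s n - b (n + 2))"
  proof (rule incseq_SucI)
    fix n show "s n - b (n + 2) \<le> s (Suc n) - b (Suc n + 2)"
      using step[of "n + 2"] t_Suc[of "n + 2"] by (simp add: s_def)
  qed
  have lower: "s n \<ge> s 0 - b 2" for n
    using incseqD[OF inc, of 0 n] b_nonneg[of "n + 2"] by (simp add: numeral_2_eq_2)
  obtain T where T: "s \<longlonglongrightarrow> T" "\<And>n. T \<le> s n"
    using decseq_convergent[OF dec, of "s 0 - b 2"] lower by auto
  have T_ge: "s n - b (n + 2) \<le> T" for n
  proof (rule tendsto_lowerbound[OF T(1)])
    show "eventually (\<lambda>m. s n - b (n + 2) \<le> s m) sequentially"
    proof (rule eventually_sequentiallyI)
      fix m assume "m \<ge> n"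
      thus "s n - b (n + 2) \<le> s m" using incseqD[OF inc, of n m] b_nonneg[of "m + 2"] by simp
    qed
  qed auto
  have "(\<lambda>N. ln (real N) * (t N - T)) \<longlonglongrightarrow> 0"
  proof (rule Lim_null_comparison)
    show "(\<lambda>N. 1 / real N) \<longlonglongrightarrow> 0" by (rule lim_1_over_n)
    show "eventually (\<lambda>N. norm (ln (real N) * (t N - T)) \<le> 1 / real N) sequentially"
    proof (rule eventually_sequentiallyI[of 2])
      fix N :: nat assume N: "N \<ge> 2"
      define n where "n = N - 2"
      have n: "N = n + 2" using N by (simp add: n_def)
      have "t N - T \<ge> 0" "t N - T \<le> b N" using T(2)[of n] T_ge[of n] by (auto simp: s_def n)
      hence "ln (real N) * (t N - T) \<le> ln (real N) * b N" "ln (real N) * (t N - T) \<ge> 0"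
        using N by (auto intro!: mult_left_mono)
      moreover have "ln (real N) * b N = 1 / real N" using N by (simp add: b_def)
      ultimately show "norm (ln (real N) * (t N - T)) \<le> 1 / real N" by simp
    qed
  qed
  thus ?thesis unfolding t_def b_def by blast
qed

text \<open>
  Apply Dirichlet's test with the weights $1/\log k$ to the convergent series whose term is $(\log k - 1)/k$ for prime $k$ and
  $-1/k$ for the other $k$.
\<close>

theorem mertens_second_theorem:
  "\<exists>M. (\<lambda>N. ln (real N) * (prime_reciprocals N - ln (ln (real N)) - M)) \<longlonglongrightarrow> 0"
proof -
  from convergent_sum_prime_ln_minus_1 obtain L where "(\<lambda>N. \<Sum>k=1..N. (prime_ln k - 1) / real k) \<longlonglongrightarrow> L"
    by (auto simp: convergent_def)
  moreover have "1 / ln (real k) > 0" "1 / ln (real (Suc k)) \<le> 1 / ln (real k)" if "k \<ge> 2" for k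
    using that by (auto intro!: divide_left_mono mult_pos_pos)
  ultimately obtain U where U: "(\<lambda>N. ((\<Sum>k=2..N. (prime_ln k - 1) / real k * (1 / ln (real k))) - U) / (1 / ln (real N))) \<longlonglongrightarrow> 0"
    using Dirichlet_test_remainder[of "\<lambda>k. (prime_ln k - 1) / real k" L "\<lambda>k. 1 / ln (real k)"] by blast
  obtain T where T: "(\<lambda>N. ln (real N) * ((\<Sum>k=2..N. 1 / (real k * ln (real k))) - ln (ln (real N)) - T)) \<longlonglongrightarrow> 0"
    using sum_inverse_n_ln_n_remainder by blast
  have "prime_reciprocals N = (\<Sum>k=2..N. (prime_ln k - 1) / real k * (1 / ln (real k))) + (\<Sum>k=2..N. 1 / (real k * ln (real k)))" for N
    unfolding prime_reciprocals_def sum.distrib [symmetric]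
    by (intro sum.cong) (auto simp: prime_ln_def field_simps)
  hence "ln (real N) * (prime_reciprocals N - ln (ln (real N)) - (U + T)) =
      ((\<Sum>k=2..N. (prime_ln k - 1) / real k * (1 / ln (real k))) - U) / (1 / ln (real N))
      + ln (real N) * ((\<Sum>k=2..N. 1 / (real k * ln (real k))) - ln (ln (real N)) - T)" for N
    by (simp add: algebra_simps)
  thus ?thesis using tendsto_add[OF U T] by (intro exI[of _ "U + T"]) simp
qed

section \<open>The constant in Mertens' theorem\<close>

lemma summable_powr_Suc:
  assumes "s > 1"
  shows "summable (\<lambda>n. real (Suc n) powr (-s))"
  using assms summable_Suc_iff[of "\<lambda>n. real n powr (-s)"] by (simp add: summable_real_powr_iff)

text \<open>
  Removing from $\sum n^{-s}$ the multiples of a prime multiplies the sum by $1 - p^{-s}$. After finitely many primes the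
  term $n = 1$ is still there.
\<close>

lemma euler_product_le_zeta:
  assumes s: "s > (1 :: real)" and P: "finite P" "\<And>p. p \<in> P \<Longrightarrow> prime (p :: nat)"
  shows "1 \<le> (\<Prod>p\<in>P. 1 - real p powr (-s)) * (\<Sum>n. real (Suc n) powr (-s))"
proof -
  define f where "f = (\<lambda>n :: nat. real n powr (-s))"
  define S where "S = (\<lambda>P :: nat set. {n :: nat. n > 0 \<and> (\<forall>p\<in>P. \<not> p dvd n)})"
  define Z where "Z = (\<Sum>n. real (Suc n) powr (-s))"
  have base: "(f has_sum Z) {0<..}"
  proof -
    have "((\<lambda>n. f (Suc n)) has_sum Z) UNIV"
      unfolding Z_def f_def by (intro sums_nonneg_imp_has_sum summable_sums summable_powr_Suc s) auto
    moreover have "bij_betw Suc UNIV {0<..}"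
      by (rule bij_betwI[of _ _ _ "\<lambda>n. n - 1"]) auto
    ultimately show ?thesis using has_sum_reindex_bij_betw[of Suc UNIV "{0<..}" f Z] by simp
  qed
  have "(f has_sum ((\<Prod>p\<in>P. 1 - real p powr (-s)) * Z)) (S P)"
    using P
  proof (induction P rule: finite_induct)
    case empty
    have "S {} = {0<..}" by (auto simp: S_def)
    thus ?case using base by simp
  next
    case (insert p P)
    define E where "E = (\<Prod>p\<in>P. 1 - real p powr (-s)) * Z"
    have IH: "(f has_sum E) (S P)" using insert by (simp add: E_def)
    have p: "prime p" using insert by simp
    have "((\<lambda>n. real p powr (-s) * f n) has_sum (real p powr (-s) * E)) (S P)"
      by (intro has_sum_cmult_right IH)
    moreover have "real p powr (-s) * f n = f (p * n)" for n by (simp add: f_def powr_mult)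
    ultimately have "((\<lambda>n. f (p * n)) has_sum (real p powr (-s) * E)) (S P)" by simp
    moreover have "bij_betw (\<lambda>n. p * n) (S P) {n \<in> S P. p dvd n}"
    proof (rule bij_betwI[of _ _ _ "\<lambda>n. n div p"])
      show "(\<lambda>n. p * n) \<in> S P \<rightarrow> {n \<in> S P. p dvd n}"
      proof (intro funcsetI CollectI conjI)
        fix n assume n: "n \<in> S P"
        have "\<not> q dvd p * n" if q: "q \<in> P" for q
        proof -
          have "prime q" "q \<noteq> p" using q insert by auto
          thus ?thesis using q n p by (auto simp: S_def prime_dvd_mult_iff primes_dvd_imp_eq)
        qed
        thus "p * n \<in> S P" using n p by (auto simp: S_def prime_gt_0_nat)
      qed auto
      show "(\<lambda>n. n div p) \<in> {n \<in> S P. p dvd n} \<rightarrow> S P"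
        using p by (auto simp: S_def prime_gt_0_nat elim!: dvdE)
    qed (use p in \<open>auto simp: prime_gt_0_nat\<close>)
    ultimately have mult: "(f has_sum (real p powr (-s) * E)) {n \<in> S P. p dvd n}"
      using has_sum_reindex_bij_betw[of "\<lambda>n. p * n" "S P" "{n \<in> S P. p dvd n}" f] by simp
    have "(f has_sum (E - real p powr (-s) * E)) (S P - {n \<in> S P. p dvd n})"
      by (intro has_sum_Diff IH mult) auto
    moreover have "S P - {n \<in> S P. p dvd n} = S (insert p P)" by (auto simp: S_def)
    moreover have "E - real p powr (-s) * E = (\<Prod>p\<in>insert p P. 1 - real p powr (-s)) * Z"
      using insert by (simp add: E_def algebra_simps)
    ultimately show ?case by simp
  qed
  moreover have "(f has_sum 1) {1}" by (intro has_sum_finiteI) (auto simp: f_def simp del: One_nat_def)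
  moreover have "{1} \<subseteq> S P" using P(2)[of 1] by (auto simp: S_def)
  ultimately have "1 \<le> (\<Prod>p\<in>P. 1 - real p powr (-s)) * Z"
    by (intro has_sum_mono2[of f "{1}" 1 "S P"]) (simp_all add: f_def)
  thus ?thesis by (simp add: Z_def)
qed

lemma zeta_le:
  assumes "\<delta> > (0 :: real)"
  shows "(\<Sum>n. real (Suc n) powr (-(1 + \<delta>))) \<le> 1 + 1 / \<delta>"
proof (rule suminf_le_const)
  show "summable (\<lambda>n. real (Suc n) powr (-(1 + \<delta>)))" using assms by (intro summable_powr_Suc) auto
  fix N
  show "(\<Sum>n<N. real (Suc n) powr (-(1 + \<delta>))) \<le> 1 + 1 / \<delta>"
  proof (cases "N = 0")
    case False
    have "(\<Sum>n<N. real (Suc n) powr (-(1 + \<delta>))) = (\<Sum>k=Suc 0..N. real k powr (-1 - \<delta>))"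
      by (simp add: sum.atLeast1_atMost_eq)
    also have "\<dots> = 1 + (\<Sum>k=Suc 1..N. real k powr (-1 - \<delta>))"
      using False by (subst sum.atLeast_Suc_atMost) (auto simp: of_nat_Suc)
    also have "(\<Sum>k=Suc 1..N. real k powr (-1 - \<delta>)) \<le> real 1 powr (-\<delta>) / \<delta>"
      using assms by (intro sum_powr_tail_le) auto
    finally show ?thesis by (simp del: One_nat_def)
  qed (use assms in auto)
qed

text \<open>
  Summation by parts turns the difference from $L$ into $(1 - x) \sum (s_n - L) x^n$ with the partial sums $s_n$. The factor
  $1 - x$ kills any fixed initial segment, and the rest is at most an average of small terms.
\<close>

lemma Abel_limit:
  fixes r :: "nat \<Rightarrow> real"
  assumes "r sums L"
  shows "((\<lambda>x. \<Sum>n. r n * x ^ n) \<longlongrightarrow> L) (at_left 1)"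
proof -
  define s where "s = (\<lambda>n. \<Sum>k<Suc n. r k)"
  have s: "s \<longlonglongrightarrow> L" using assms unfolding sums_def s_def by (rule LIMSEQ_Suc)
  have "Bseq s" using s by (intro convergent_imp_Bseq) (auto simp: convergent_def)
  then obtain B where B: "\<And>n. \<bar>s n - L\<bar> \<le> B" 
    using Bseq_add[of s "-L"] by (auto simp: Bseq_def)
  have summ_r: "summable (\<lambda>n. r n * x ^ n)" if x: "0 < x" "x < 1" for x
    using powser_inside[of r 1 x] assms x by (simp add: sums_iff)
  have summ_s: "summable (\<lambda>n. (s n - L) * x ^ n)" if x: "0 < x" "x < 1" for x
    by (rule summable_comparison_test[OF _ summable_mult[OF summable_geometric[of x], of B]])
      (use x B in \<open>auto simp: abs_mult intro!: exI[of _ 0] mult_right_mono\<close>)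
  have eq: "(\<Sum>n. r n * x ^ n) - L = (1 - x) * (\<Sum>n. (s n - L) * x ^ n)" if x: "0 < x" "x < 1" for x
  proof -
    have "(\<Sum>n<N. r n * x ^ n) = (1 - x) * (\<Sum>n<N. (s n - L) * x ^ n) + L + (s N - L - r N) * x ^ N" for N
      by (induction N) (auto simp: s_def algebra_simps)
    moreover have "(\<lambda>N. (1 - x) * (\<Sum>n<N. (s n - L) * x ^ n) + L + (s N - L - r N) * x ^ N)
        \<longlonglongrightarrow> (1 - x) * (\<Sum>n. (s n - L) * x ^ n) + L + (L - L - 0) * 0"
      using x summable_LIMSEQ[OF summ_s[OF x]] summable_LIMSEQ_zero[OF sums_summable[OF assms]]
      by (intro tendsto_add tendsto_mult tendsto_diff tendsto_const s LIMSEQ_realpow_zero) auto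
    ultimately have "(\<lambda>N. \<Sum>n<N. r n * x ^ n) \<longlonglongrightarrow> (1 - x) * (\<Sum>n. (s n - L) * x ^ n) + L" by simp
    from LIMSEQ_unique[OF this summable_LIMSEQ[OF summ_r[OF x]]] show ?thesis by simp
  qed
  show ?thesis
  proof (rule tendstoI)
    fix e :: real assume e: "e > 0"
    from tendstoD[OF s, of "e / 2"] e obtain N where N: "\<And>n. n \<ge> N \<Longrightarrow> \<bar>s n - L\<bar> < e / 2"
      by (auto simp: eventually_sequentially dist_real_def)
    have "B \<ge> 0" using B[of 0] by linarith
    have "((\<lambda>x :: real. (1 - x) * (B * N)) \<longlongrightarrow> (1 - 1) * (B * N)) (at_left 1)"
      by (intro tendsto_mult tendsto_diff tendsto_const tendsto_ident_at)
    from tendstoD[OF this, of "e / 2"] e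
    have "eventually (\<lambda>x :: real. (1 - x) * (B * N) < e / 2) (at_left 1)"
      by (auto simp: dist_real_def elim!: eventually_mono)
    moreover have "eventually (\<lambda>x :: real. x \<in> {0<..<1}) (at_left 1)" by (intro eventually_at_left_real) auto
    ultimately show "eventually (\<lambda>x. dist (\<Sum>n. r n * x ^ n) L < e) (at_left 1)"
    proof eventually_elim
      case (elim x)
      hence x: "0 < x" "x < 1" by auto
      have summ_abs: "summable (\<lambda>n. \<bar>s n - L\<bar> * x ^ n)"
        by (rule summable_comparison_test[OF _ summable_mult[OF summable_geometric[of x], of B]])
          (use x B in \<open>auto simp: abs_mult intro!: exI[of _ 0] mult_right_mono\<close>)
      have "\<bar>\<Sum>n. (s n - L) * x ^ n\<bar> \<le> (\<Sum>n. \<bar>s n - L\<bar> * x ^ n)"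
        using summable_rabs[of "\<lambda>n. (s n - L) * x ^ n"] summ_abs x by (simp add: abs_mult)
      also have "\<dots> = (\<Sum>n. \<bar>s (n + N) - L\<bar> * x ^ (n + N)) + (\<Sum>n<N. \<bar>s n - L\<bar> * x ^ n)"
        by (rule suminf_split_initial_segment[OF summ_abs])
      also have "(\<Sum>n<N. \<bar>s n - L\<bar> * x ^ n) \<le> (\<Sum>n<N. B * 1)"
        using x B \<open>B \<ge> 0\<close> by (intro sum_mono mult_mono power_le_one) auto
      also have "\<dots> = B * N" by simp
      also have "(\<Sum>n. \<bar>s (n + N) - L\<bar> * x ^ (n + N)) \<le> (\<Sum>n. e / 2 * x ^ n)"
      proof (rule suminf_le)
        fix n
        show "\<bar>s (n + N) - L\<bar> * x ^ (n + N) \<le> e / 2 * x ^ n"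
          using N[of "n + N"] x e by (intro mult_mono power_decreasing) auto
      qed (use x summ_abs in \<open>auto intro!: summable_mult summable_geometric simp: summable_iff_shift[of "\<lambda>n. \<bar>s n - L\<bar> * x ^ n"]\<close>)
      also have "\<dots> = e / 2 * (1 / (1 - x))" using x by (subst suminf_mult) (auto simp: suminf_geometric)
      finally have "\<bar>\<Sum>n. (s n - L) * x ^ n\<bar> \<le> e / 2 * (1 / (1 - x)) + B * N" by simp
      hence *: "(1 - x) * \<bar>\<Sum>n. (s n - L) * x ^ n\<bar> \<le> (1 - x) * (e / 2 * (1 / (1 - x)) + B * N)"
        using x by (intro mult_left_mono) auto
      have cancel: "y * (e / 2 * (1 / y) + B * N) = e / 2 + y * (B * N)" if "y > 0" for y :: real
        using that by (simp add: distrib_left)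
      have "(1 - x) * \<bar>\<Sum>n. (s n - L) * x ^ n\<bar> \<le> e / 2 + (1 - x) * (B * N)"
      proof -
        have "1 - x > 0" using x by simp
        from order_trans[OF * eq_refl[OF cancel[OF this]]] show ?thesis .
      qed
      also have "\<dots> < e" using elim by simp
      finally show ?case using x by (simp add: dist_real_def eq abs_mult)
    qed
  qed
qed

definition primes_upto :: "nat \<Rightarrow> nat set" where
  "primes_upto n = {p. prime p \<and> p \<le> n}"

lemma finite_primes_upto [simp]: "finite (primes_upto n)"
  by (rule finite_subset[of _ "{..n}"]) (auto simp: primes_upto_def)

lemma primes_upto_mono: "m \<le> n \<Longrightarrow> primes_upto m \<subseteq> primes_upto n"
  by (auto simp: primes_upto_def)

lemma prime_reciprocals_altdef: "prime_reciprocals n = (\<Sum>p\<in>primes_upto n. 1 / real p)"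
proof -
  have "primes_upto n = {p \<in> {2..n}. prime p}" by (auto simp: primes_upto_def dest: prime_ge_2_nat)
  show ?thesis unfolding prime_reciprocals_def \<open>primes_upto n = _\<close> by (rule sum.inter_filter[symmetric]) simp
qed

lemma chebyshev_theta_altdef: "chebyshev_theta n = (\<Sum>p\<in>primes_upto n. ln (real p))"
proof -
  have "primes_upto n = {p \<in> {1..n}. prime p}" by (auto simp: primes_upto_def dest: prime_ge_1_nat)
  show ?thesis unfolding chebyshev_theta_def prime_ln_def \<open>primes_upto n = _\<close> by (rule sum.inter_filter[symmetric]) simp
qed

text \<open>
  The contribution of the powers $p^j$ with $j \ge 2$ to $\log \zeta(s)$, namely $\sum_{j \ge 2} p^{-js}/j$ in closed form.
\<close>

definition euler_excess :: "real \<Rightarrow> nat \<Rightarrow> real" where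
  "euler_excess s p = - ln (1 - real p powr (-s)) - real p powr (-s)"

lemma prime_powr_less_1: "prime p \<Longrightarrow> s > 0 \<Longrightarrow> real p powr (-s) < 1"
  using prime_gt_1_nat[of p] by (simp add: powr_less_one)

lemma euler_excess_nonneg: "prime p \<Longrightarrow> s > 0 \<Longrightarrow> euler_excess s p \<ge> 0"
  using ln_add_one_self_le_self2[of "- (real p powr (-s))"] prime_powr_less_1[of p s]
  by (simp add: euler_excess_def)

lemma sum_prime_powr_le:
  assumes \<delta>: "\<delta> > 0" and K: "K \<le> N"
  shows "(\<Sum>p\<in>primes_upto N. real p powr (-(1 + \<delta>))) + (\<Sum>p\<in>primes_upto K. euler_excess (1 + \<delta>) p) \<le> ln (1 + 1 / \<delta>)"
proof -
  have less: "real p powr (-(1 + \<delta>)) < 1" if "p \<in> primes_upto N" for p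
    using that \<delta> by (intro prime_powr_less_1) (auto simp: primes_upto_def)
  define Q where "Q = (\<Prod>p\<in>primes_upto N. 1 - real p powr (-(1 + \<delta>)))"
  have "Q > 0" unfolding Q_def using less by (intro prod_pos) auto
  have "(\<Sum>p\<in>primes_upto K. euler_excess (1 + \<delta>) p) \<le> (\<Sum>p\<in>primes_upto N. euler_excess (1 + \<delta>) p)"
    using \<delta> K by (intro sum_mono2 primes_upto_mono euler_excess_nonneg) (auto simp: primes_upto_def)
  also have "\<dots> = - ln Q - (\<Sum>p\<in>primes_upto N. real p powr (-(1 + \<delta>)))"
  proof -
    have "ln Q = (\<Sum>p\<in>primes_upto N. ln (1 - real p powr (-(1 + \<delta>))))"
      unfolding Q_def
    proof (rule ln_prod)
      fix p assume "p \<in> primes_upto N"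
      from less[OF this] show "1 - real p powr (-(1 + \<delta>)) \<noteq> 0" by linarith
    qed simp
    thus ?thesis unfolding euler_excess_def by (simp add: sum_subtractf sum_negf)
  qed
  finally have *: "(\<Sum>p\<in>primes_upto N. real p powr (-(1 + \<delta>))) + (\<Sum>p\<in>primes_upto K. euler_excess (1 + \<delta>) p) \<le> ln (1 / Q)"
    using \<open>Q > 0\<close> by (simp add: ln_div)
  have "1 / Q \<le> (\<Sum>n. real (Suc n) powr (-(1 + \<delta>)))"
  proof -
    have "1 \<le> Q * (\<Sum>n. real (Suc n) powr (-(1 + \<delta>)))"
      unfolding Q_def by (rule euler_product_le_zeta) (use \<delta> in \<open>auto simp: primes_upto_def\<close>)
    thus ?thesis using \<open>Q > 0\<close> by (simp only: pos_divide_le_eq mult.commute)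
  qed
  hence "ln (1 / Q) \<le> ln (1 + 1 / \<delta>)"
    using zeta_le[OF \<delta>] \<open>Q > 0\<close> by (intro ln_mono) auto
  with * show ?thesis by linarith
qed

text \<open>
  Let $a_n$ be the sum of $1/p$ over the primes with $e^{n-1} < p \le e^n$. The partial sums of $a_n$ are
  $\log n + M + o(1)$, those of $1/n$ are $\log n + \gamma + o(1)$; so $\sum (a_n - 1/n) = M - \gamma$, and by Abel's theorem
  $\sum a_n x^n + \log(1 - x) \to M - \gamma$ as $x \to 1$. For $x = e^{-\delta}$ a prime in the $n$-th group satisfies
  $p^{-\delta} \ge x^n$, hence $\sum a_n x^n \le \sum_p p^{-1-\delta}$, which the Euler product bounds by
  $\log(1 + 1/\delta)$ minus the higher prime powers. Since $(1 + 1/\delta)(1 - e^{-\delta}) \to 1$, only the latter remain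
  in the limit. The bound is uniform in $K$, so that later $K$ can grow with the range of the product.
\<close>

theorem mertens_constant_le:
  assumes M: "(\<lambda>N. ln (real N) * (prime_reciprocals N - ln (ln (real N)) - M)) \<longlonglongrightarrow> 0"
  shows "M + (\<Sum>p\<in>primes_upto K. euler_excess 1 p) \<le> euler_mascheroni"
proof -
  define E where "E = (\<lambda>n. nat \<lfloor>exp (real n)\<rfloor>)"
  define A where "A = (\<lambda>n. prime_reciprocals (E n))"
  define a where "a = (\<lambda>n. if n = 0 then 0 else A n - A (n - 1))"
  define r where "r = (\<lambda>n. a n - 1 / real n)"
  have E_mono: "E m \<le> E n" if "m \<le> n" for m n
    unfolding E_def using that by (intro nat_mono floor_mono) auto
  have E_lim: "filterlim E at_top sequentially"
    unfolding E_def by (intro filterlim_compose[OF filterlim_nat_sequentially] filterlim_compose[OF filterlim_floor_sequentially]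
       filterlim_compose[OF exp_at_top] filterlim_real_sequentially)
  have "A 0 = 0" by (simp add: A_def E_def prime_reciprocals_def)
  have a_partial: "(\<Sum>k<Suc n. a k) = A n" for n
    by (induction n) (auto simp: a_def \<open>A 0 = 0\<close>)
  have r_partial: "(\<Sum>k<Suc n. r k) = A n - harm n" for n
  proof -
    have "(\<Sum>k<Suc n. 1 / real k) = harm n" by (induction n) (auto simp: harm_def divide_inverse)
    thus ?thesis unfolding r_def sum_subtractf a_partial by simp
  qed
  have "(\<lambda>N. prime_reciprocals N - ln (ln (real N))) \<longlonglongrightarrow> M"
  proof -
    have inv: "(\<lambda>N. 1 / ln (real N)) \<longlonglongrightarrow> 0" by real_asymp
    have "(\<lambda>N. ln (real N) * (prime_reciprocals N - ln (ln (real N)) - M) * (1 / ln (real N)) + M) \<longlonglongrightarrow> 0 * 0 + M"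
      by (intro tendsto_add tendsto_mult M inv tendsto_const)
    moreover have "eventually (\<lambda>N. ln (real N) * (prime_reciprocals N - ln (ln (real N)) - M) * (1 / ln (real N)) + M
       = prime_reciprocals N - ln (ln (real N))) sequentially"
      by (rule eventually_sequentiallyI[of 2]) auto
    ultimately have "(\<lambda>N. prime_reciprocals N - ln (ln (real N))) \<longlonglongrightarrow> 0 * 0 + M" by (rule Lim_transform_eventually)
    thus ?thesis by simp
  qed
  from filterlim_compose[OF this E_lim] have A_lim: "(\<lambda>n. A n - ln (ln (real (E n)))) \<longlonglongrightarrow> M" by (simp add: A_def)
  have E_ln: "(\<lambda>n. ln (ln (real (E n))) - ln (real n)) \<longlonglongrightarrow> 0"
  proof -
    have "(\<lambda>n. ln (ln (real_of_int \<lfloor>exp (real n)\<rfloor>)) - ln (real n)) \<longlonglongrightarrow> 0" by real_asymp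
    thus ?thesis by (simp add: E_def)
  qed
  have harm_lim: "(\<lambda>n. harm n - ln (real n)) \<longlonglongrightarrow> (euler_mascheroni :: real)"
    using euler_mascheroni_LIMSEQ by (simp add: LIMSEQ_def)
  have "(\<lambda>n. (A n - ln (ln (real (E n)))) + (ln (ln (real (E n))) - ln (real n)) - (harm n - ln (real n))) 
      \<longlonglongrightarrow> M + 0 - euler_mascheroni"
    by (intro tendsto_add tendsto_diff A_lim E_ln harm_lim)
  hence "(\<lambda>n. \<Sum>k<Suc n. r k) \<longlonglongrightarrow> M - euler_mascheroni" unfolding r_partial by simp
  hence r_sums: "r sums (M - euler_mascheroni)" unfolding sums_def by (rule LIMSEQ_imp_Suc)

  \<comment> \<open>Replacing \<open>ln p\<close> by the next integer makes \<open>exp (-\<delta> * ln p)\<close> smaller.\<close>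
  have a_le: "(\<Sum>n<Suc m. a n * exp (-\<delta>) ^ n) \<le> (\<Sum>p\<in>primes_upto (E m). real p powr (-(1 + \<delta>)))" if \<delta>: "\<delta> > 0" for \<delta> m
  proof (induction m)
    case 0
    then show ?case by (simp add: a_def sum_nonneg)
  next
    case (Suc m)
    define D where "D = primes_upto (E (Suc m)) - primes_upto (E m)"
    have sub: "primes_upto (E m) \<subseteq> primes_upto (E (Suc m))" by (intro primes_upto_mono E_mono) simp
    have "a (Suc m) = (\<Sum>p\<in>D. 1 / real p)"
      unfolding a_def A_def prime_reciprocals_altdef D_def using sub by (simp add: sum_diff)
    hence "a (Suc m) * exp (-\<delta>) ^ Suc m = (\<Sum>p\<in>D. 1 / real p * exp (-\<delta>) ^ Suc m)" by (simp add: sum_distrib_right)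
    also have "\<dots> \<le> (\<Sum>p\<in>D. real p powr (-(1 + \<delta>)))"
    proof (intro sum_mono)
      fix p assume "p \<in> D"
      hence p: "prime p" "p \<le> E (Suc m)" by (auto simp: D_def primes_upto_def)
      have "p > 0" using p by (simp add: prime_gt_0_nat)
      have "real p \<le> exp (real (Suc m))"
        using p(2) unfolding E_def by (simp add: le_nat_iff le_floor_iff)
      hence "ln (real p) \<le> ln (exp (real (Suc m)))" using \<open>p > 0\<close> by (intro ln_mono) auto
      hence "ln (real p) \<le> real (Suc m)" by simp
      hence "exp (- \<delta> * real (Suc m)) \<le> exp (- \<delta> * ln (real p))" using \<delta> by simp
      also have "exp (- \<delta> * real (Suc m)) = exp (-\<delta>) ^ Suc m" by (rule exp_of_nat2_mult)
      finally have "1 / real p * exp (-\<delta>) ^ Suc m \<le> 1 / real p * real p powr (-\<delta>)"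
        using \<open>p > 0\<close> by (intro mult_left_mono) (auto simp: powr_def)
      also have "\<dots> = real p powr (-1) * real p powr (-\<delta>)" using \<open>p > 0\<close> by (simp add: powr_minus_divide)
      also have "\<dots> = real p powr (-(1 + \<delta>))" by (subst powr_add [symmetric]) simp
      finally show "1 / real p * exp (-\<delta>) ^ Suc m \<le> real p powr (-(1 + \<delta>))" .
    qed
    finally have "(\<Sum>n<Suc (Suc m). a n * exp (-\<delta>) ^ n) 
        \<le> (\<Sum>p\<in>primes_upto (E m). real p powr (-(1 + \<delta>))) + (\<Sum>p\<in>D. real p powr (-(1 + \<delta>)))"
      using Suc by simp
    also have "\<dots> = (\<Sum>p\<in>primes_upto (E (Suc m)). real p powr (-(1 + \<delta>)))"
      unfolding D_def using sub by (simp add: sum_diff)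
    finally show ?case .
  qed
  define G where "G = (\<lambda>\<delta>. (\<Sum>p\<in>primes_upto K. euler_excess (1 + \<delta>) p))"
  have bound: "(\<Sum>n. r n * exp (-\<delta>) ^ n) \<le> (ln (1 + 1 / \<delta>) + ln (1 - exp (-\<delta>))) - G \<delta>" if \<delta>: "\<delta> > 0" for \<delta>
  proof -
    define x where "x = exp (-\<delta>)"
    have x: "0 < x" "x < 1" using \<delta> by (auto simp: x_def)
    have log_sums: "(\<lambda>n. 1 / real n * x ^ n) sums (- ln (1 - x))"
    proof -
      have "(\<lambda>n. - ((- (- x)) ^ n) / real n) sums ln (1 + (- x))" using x by (intro ln_series') auto
      from sums_minus[OF this] show ?thesis by simp
    qed
    have "summable (\<lambda>n. r n * x ^ n)" using powser_inside[of r 1 x] r_sums x by (simp add: sums_iff)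
    hence r_x: "(\<lambda>n. r n * x ^ n) sums (\<Sum>n. r n * x ^ n)" by (rule summable_sums)
    from sums_add[OF this log_sums] have "(\<lambda>n. a n * x ^ n) sums ((\<Sum>n. r n * x ^ n) - ln (1 - x))"
      by (simp add: r_def algebra_simps)
    hence "(\<lambda>m. \<Sum>n<Suc m. a n * x ^ n) \<longlonglongrightarrow> (\<Sum>n. r n * x ^ n) - ln (1 - x)"
      unfolding sums_def by (rule LIMSEQ_Suc)
    moreover have "eventually (\<lambda>m. (\<Sum>n<Suc m. a n * x ^ n) \<le> ln (1 + 1 / \<delta>) - G \<delta>) sequentially"
      using filterlim_at_top[THEN iffD1, OF E_lim, rule_format, of K]
    proof eventually_elim
      case (elim m)
      show ?case using a_le[OF \<delta>, of m] sum_prime_powr_le[OF \<delta> elim] unfolding x_def G_def by linarith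
    qed
    ultimately have "(\<Sum>n. r n * x ^ n) - ln (1 - x) \<le> ln (1 + 1 / \<delta>) - G \<delta>"
      by (rule tendsto_upperbound) simp
    thus ?thesis by (simp add: x_def)
  qed
  have "filterlim (\<lambda>\<delta> :: real. exp (-\<delta>)) (at_left 1) (at_right 0)" by real_asymp
  from filterlim_compose[OF Abel_limit[OF r_sums] this]
  have lim: "((\<lambda>\<delta>. \<Sum>n. r n * exp (-\<delta>) ^ n) \<longlongrightarrow> M - euler_mascheroni) (at_right 0)" .
  have "((\<lambda>\<delta> :: real. ln (1 + 1 / \<delta>) + ln (1 - exp (-\<delta>))) \<longlongrightarrow> 0) (at_right 0)" by real_asymp
  moreover have "(G \<longlongrightarrow> (\<Sum>p\<in>primes_upto K. euler_excess 1 p)) (at_right 0)"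
    unfolding G_def
  proof (intro tendsto_sum)
    fix p assume "p \<in> primes_upto K"
    hence p: "prime p" by (simp add: primes_upto_def)
    have pw: "((\<lambda>\<delta>. real p powr (-(1 + \<delta>))) \<longlongrightarrow> real p powr (-(1 + 0))) (at_right 0)"
      using prime_gt_0_nat[OF p] by (intro tendsto_powr tendsto_minus tendsto_add tendsto_const tendsto_ident_at) auto
    have "1 - real p powr (-(1 + 0)) \<noteq> 0" using prime_powr_less_1[OF p, of "1 + 0"] by linarith
    hence "((\<lambda>\<delta>. euler_excess (1 + \<delta>) p) \<longlongrightarrow> - ln (1 - real p powr (-(1 + 0))) - real p powr (-(1 + 0))) (at_right 0)"
      unfolding euler_excess_def by (intro tendsto_diff tendsto_minus tendsto_ln tendsto_const pw)
    thus "((\<lambda>\<delta>. euler_excess (1 + \<delta>) p) \<longlongrightarrow> euler_excess 1 p) (at_right 0)" by (simp add: euler_excess_def)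
  qed
  ultimately have lim': "((\<lambda>\<delta>. (ln (1 + 1 / \<delta>) + ln (1 - exp (-\<delta>))) - G \<delta>) \<longlongrightarrow> 0 - (\<Sum>p\<in>primes_upto K. euler_excess 1 p)) (at_right 0)"
    by (rule tendsto_diff)
  have "eventually (\<lambda>\<delta>. (\<Sum>n. r n * exp (-\<delta>) ^ n) \<le> (ln (1 + 1 / \<delta>) + ln (1 - exp (-\<delta>))) - G \<delta>) (at_right 0)"
    using eventually_at_right_less[of "0 :: real"] by eventually_elim (rule bound)
  hence "M - euler_mascheroni \<le> 0 - (\<Sum>p\<in>primes_upto K. euler_excess 1 p)"
    by (rule tendsto_le[OF trivial_limit_at_right_real lim' lim])
  thus ?thesis by simp
qed

text \<open>
  The logarithm of the product is $\sum 1/p$ plus the higher prime powers. The latter are at most $\gamma - M$, so $M$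
  cancels and the product is at most $e^\gamma \log n \cdot e^{o(1/\log n)}$.
\<close>

theorem mertens_product_le:
  assumes "e > 0"
  shows "eventually (\<lambda>n. (\<Prod>p\<in>primes_upto n. 1 / (1 - 1 / real p)) \<le> exp euler_mascheroni * (ln (real n) + e)) sequentially"
proof -
  obtain M where M: "(\<lambda>N. ln (real N) * (prime_reciprocals N - ln (ln (real N)) - M)) \<longlonglongrightarrow> 0"
    using mertens_second_theorem by blast
  have "filterlim (\<lambda>n. ln (real n)) at_top sequentially"
    by (intro filterlim_compose[OF ln_at_top] filterlim_real_sequentially)
  hence "eventually (\<lambda>n. ln (real n) \<ge> e / 2) sequentially"
    by (rule filterlim_at_top[THEN iffD1, rule_format])
  moreover have "eventually (\<lambda>N. ln (real N) * (prime_reciprocals N - ln (ln (real N)) - M) < e / 2) sequentially"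
    using order_tendstoD(2)[OF M, of "e / 2"] assms by simp
  ultimately show ?thesis using eventually_ge_at_top[of 2]
  proof eventually_elim
    case (elim n)
    have l: "ln (real n) > 0" using elim by simp
    have "1 / (1 - 1 / real p) = exp (euler_excess 1 p + 1 / real p)" if "p \<in> primes_upto n" for p
    proof -
      have "p > 1" using that by (auto simp: primes_upto_def prime_gt_Suc_0_nat)
      hence "1 - 1 / real p > 0" by (simp add: field_simps)
      thus ?thesis by (simp add: euler_excess_def powr_minus_divide exp_minus inverse_eq_divide)
    qed
    hence "(\<Prod>p\<in>primes_upto n. 1 / (1 - 1 / real p)) = (\<Prod>p\<in>primes_upto n. exp (euler_excess 1 p + 1 / real p))"
      by (intro prod.cong refl)
    also have "\<dots> = exp (\<Sum>p\<in>primes_upto n. euler_excess 1 p + 1 / real p)" by (simp add: exp_sum)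
    also have "(\<Sum>p\<in>primes_upto n. euler_excess 1 p + 1 / real p) = (\<Sum>p\<in>primes_upto n. euler_excess 1 p) + prime_reciprocals n"
      by (simp add: sum.distrib prime_reciprocals_altdef)
    also have "exp ((\<Sum>p\<in>primes_upto n. euler_excess 1 p) + prime_reciprocals n) \<le> exp (euler_mascheroni + (prime_reciprocals n - M))"
      using mertens_constant_le[OF M, of n] by simp
    finally have prod_le: "(\<Prod>p\<in>primes_upto n. 1 / (1 - 1 / real p)) \<le> exp (euler_mascheroni + (prime_reciprocals n - M))" .
    have "prime_reciprocals n - M \<le> ln (ln (real n)) + e / 2 / ln (real n)"
      using elim(2) l by (simp add: field_simps)
    hence "exp (euler_mascheroni + (prime_reciprocals n - M)) \<le> exp (euler_mascheroni + (ln (ln (real n)) + e / 2 / ln (real n)))"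
      by simp
    also have "\<dots> = exp euler_mascheroni * (ln (real n) * exp (e / 2 / ln (real n)))" using l by (simp add: exp_add)
    finally have exp_le: "exp (euler_mascheroni + (prime_reciprocals n - M)) \<le> exp euler_mascheroni * (ln (real n) * exp (e / 2 / ln (real n)))" .
    have "ln (real n) * exp (e / 2 / ln (real n)) \<le> ln (real n) + e"
    proof -
      define y where "y = e / 2 / ln (real n)"
      have y: "0 \<le> y" "y \<le> 1" "ln (real n) * y = e / 2" using assms elim(1) l by (auto simp: y_def)
      have "ln (real n) * exp y \<le> ln (real n) * (1 + y + y * 1)"
        using exp_bound[of y] y l mult_left_mono[of y 1 y] by (intro mult_left_mono) (auto simp: power2_eq_square)
      also have "\<dots> = ln (real n) + 2 * (ln (real n) * y)" by (simp add: algebra_simps)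
      finally show ?thesis unfolding y(3) by (simp add: y_def)
    qed
    hence "exp euler_mascheroni * (ln (real n) * exp (e / 2 / ln (real n))) \<le> exp euler_mascheroni * (ln (real n) + e)"
      by (intro mult_left_mono) auto
    with prod_le exp_le show ?case by linarith
  qed
qed

section \<open>Sums of divisors\<close>

text \<open>
  This translates products over the first $m$ primes into products over the primes up to $p_m$.
\<close>

lemma nth_prime_bij_betw:
  assumes "m \<ge> 1"
  shows "bij_betw nth_prime {1..m} (primes_upto (nth_prime m))"
proof -
  note inf = primes_infinite
  have "inj_on nth_prime {1..m}"
  proof (rule inj_onI)
    fix i j assume ij: "i \<in> {1..m}" "j \<in> {1..m}" "nth_prime i = nth_prime j"
    hence "i - 1 = j - 1" unfolding nth_prime_def using enumerate_mono[OF _ inf] by (metis less_irrefl linorder_neqE_nat)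
    thus "i = j" using ij by auto
  qed
  moreover have "nth_prime ` {1..m} = primes_upto (nth_prime m)"
  proof (intro equalityI subsetI)
    fix p assume "p \<in> nth_prime ` {1..m}"
    then obtain k where k: "1 \<le> k" "k \<le> m" "p = nth_prime k" by auto
    have "enumerate {p :: nat. prime p} (k - 1) \<le> enumerate {p. prime p} (m - 1)"
      using k inf by simp
    moreover have "prime (enumerate {p :: nat. prime p} (k - 1))" using enumerate_in_set[OF inf] by blast
    ultimately show "p \<in> primes_upto (nth_prime m)" using k by (simp add: primes_upto_def nth_prime_def)
  next
    fix p assume "p \<in> primes_upto (nth_prime m)"
    hence p: "prime p" "p \<le> nth_prime m" by (auto simp: primes_upto_def)
    obtain i where i: "enumerate {p. prime p} i = p" using enumerate_Ex[OF inf, of p] p by auto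
    have "i \<le> m - 1"
      using p(2) enumerate_mono[OF _ inf, of "m - 1" i] unfolding nth_prime_def i by (meson leD leI)
    thus "p \<in> nth_prime ` {1..m}" using i assms
      by (intro image_eqI[of _ _ "Suc i"]) (auto simp: nth_prime_def)
  qed
  ultimately show ?thesis by (simp add: bij_betw_def)
qed

text \<open>
  Every divisor of $ab$ is a product of a divisor of $a$ and one of $b$, possibly in several ways.
\<close>

lemma divisor_sum_mult_le:
  assumes "a > 0" "b > 0"
  shows "divisor_sum (a * b) \<le> divisor_sum a * divisor_sum b"
proof -
  have "{d. d dvd a * b} \<subseteq> (\<lambda>(x, y). x * y) ` ({d. d dvd a} \<times> {d. d dvd b})"
    by (auto dest!: division_decomp)
  hence "divisor_sum (a * b) \<le> (\<Sum>d\<in>(\<lambda>(x, y). x * y) ` ({d. d dvd a} \<times> {d. d dvd b}). d)"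
    unfolding divisor_sum_def using assms by (intro sum_mono2 finite_imageI finite_cartesian_product) auto
  also have "\<dots> \<le> (\<Sum>z\<in>{d. d dvd a} \<times> {d. d dvd b}. (case z of (x, y) \<Rightarrow> x * y))"
    using assms by (intro sum_image_le[of _ "\<lambda>d. d", simplified]) auto
  also have "\<dots> = divisor_sum a * divisor_sum b"
    unfolding divisor_sum_def sum_product by (simp add: sum.cartesian_product)
  finally show ?thesis .
qed

text \<open>
  The geometric series $\sum_{i \le b} p^i$ is less than $p^b \sum_{i \ge 0} p^{-i}$.
\<close>

lemma divisor_sum_prime_power_le:
  assumes "prime p"
  shows "real (divisor_sum (p ^ b)) \<le> real (p ^ b) * (1 / (1 - 1 / real p))"
proof -
  have p: "p > 1" using assms by (rule prime_gt_1_nat)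
  have "{d. d dvd p ^ b} = (\<lambda>i. p ^ i) ` {..b}" using assms by (auto simp: divides_primepow_nat)
  moreover have "inj_on (\<lambda>i. p ^ i) {..b}" using p by (auto simp: inj_on_def)
  ultimately have "divisor_sum (p ^ b) = (\<Sum>i\<le>b. p ^ i)" by (simp add: divisor_sum_def sum.reindex)
  moreover have "(1 - 1 / real p) * (\<Sum>i\<le>b. real p ^ i) = real p ^ b - 1 / real p"
    using p by (induction b) (auto simp: algebra_simps)
  ultimately have "(1 - 1 / real p) * real (divisor_sum (p ^ b)) \<le> real (p ^ b)" by simp
  moreover have "1 - 1 / real p > 0" using p by simp
  ultimately show ?thesis by (simp add: field_simps)
qed

lemma divisor_sum_prod_prime_powers_le:
  assumes "finite I" "\<And>i. i \<in> I \<Longrightarrow> prime (p i)"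
  shows "real (divisor_sum (\<Prod>i\<in>I. p i ^ b i)) \<le> real (\<Prod>i\<in>I. p i ^ b i) * (\<Prod>i\<in>I. 1 / (1 - 1 / real (p i)))"
  using assms
proof (induction I rule: finite_induct)
  case empty
  then show ?case by (simp add: divisor_sum_def)
next
  case (insert j I)
  define N where "N = (\<Prod>i\<in>I. p i ^ b i)"
  have "N > 0" unfolding N_def using insert by (intro prod_pos) (auto simp: prime_gt_0_nat)
  moreover have "p j ^ b j > 0" using insert by (simp add: prime_gt_0_nat)
  ultimately have "real (divisor_sum (p j ^ b j * N)) \<le> real (divisor_sum (p j ^ b j)) * real (divisor_sum N)"
    using divisor_sum_mult_le[of "p j ^ b j" N] by (simp flip: of_nat_mult)
  also have "\<dots> \<le> (real (p j ^ b j) * (1 / (1 - 1 / real (p j)))) * (real N * (\<Prod>i\<in>I. 1 / (1 - 1 / real (p i))))"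
    using insert unfolding N_def by (intro mult_mono divisor_sum_prime_power_le order_trans[OF of_nat_0_le_iff divisor_sum_prime_power_le]) auto
  finally show ?case using insert by (simp add: N_def mult_ac)
qed

lemma mertens_product_le_ln_theta:
  assumes "c > 0"
  shows "eventually (\<lambda>n. (\<Prod>p\<in>primes_upto n. 1 / (1 - 1 / real p)) \<le> exp euler_mascheroni * (ln (chebyshev_theta n) + c)) sequentially"
proof -
  have "(\<lambda>n. ln (chebyshev_theta n / real n)) \<longlonglongrightarrow> ln 1"
    by (intro tendsto_ln prime_number_theorem_theta) simp
  from order_tendstoD(1)[OF this, of "- (c / 2)"] assms
  have "eventually (\<lambda>n. ln (chebyshev_theta n / real n) > - (c / 2)) sequentially" by simp
  moreover have "eventually (\<lambda>n. chebyshev_theta n / real n > 0) sequentially"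
    by (rule order_tendstoD(1)[OF prime_number_theorem_theta]) simp
  moreover have "eventually (\<lambda>n. (\<Prod>p\<in>primes_upto n. 1 / (1 - 1 / real p)) \<le> exp euler_mascheroni * (ln (real n) + c / 2)) sequentially"
    using assms by (intro mertens_product_le) simp
  ultimately show ?thesis using eventually_gt_at_top[of 0]
  proof eventually_elim
    case (elim n)
    have "chebyshev_theta n > 0" using elim(2,4) by (simp add: zero_less_divide_iff)
    hence "ln (chebyshev_theta n / real n) = ln (chebyshev_theta n) - ln (real n)"
      using elim(4) by (simp add: ln_div)
    hence "ln (real n) + c / 2 \<le> ln (chebyshev_theta n) + c" using elim(1) by linarith
    hence "exp euler_mascheroni * (ln (real n) + c / 2) \<le> exp euler_mascheroni * (ln (chebyshev_theta n) + c)"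
      by (intro mult_left_mono) auto
    with elim(3) show ?case by linarith
  qed
qed

theorem theorem2:
  fixes n m :: "nat \<Rightarrow> nat"
    and \<beta> :: "nat \<Rightarrow> nat \<Rightarrow> nat"
    and \<epsilon> :: "nat \<Rightarrow> real"
  assumes n_ge_2: "\<And>j. j \<ge> 1 \<Longrightarrow> n j \<ge> 2"
    and n_lim: "filterlim n at_top sequentially"
    and m_ge_1: "\<And>j. j \<ge> 1 \<Longrightarrow> m j \<ge> 1"
    and n_eq: "\<And>j. j \<ge> 1 \<Longrightarrow> n j = (\<Prod>k=1..m j. nth_prime k ^ \<beta> j k)"
    and \<beta>_antimono: "\<And>j k l. \<lbrakk>j \<ge> 1; 1 \<le> k; k \<le> l; l \<le> m j\<rbrakk> \<Longrightarrow> \<beta> j k \<ge> \<beta> j l"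
    and \<beta>_ge_1: "\<And>j k. \<lbrakk>j \<ge> 1; 1 \<le> k; k \<le> m j\<rbrakk> \<Longrightarrow> \<beta> j k \<ge> 1"
    and \<epsilon>_def: "\<And>j. j \<ge> 1 \<Longrightarrow>
           real (n j) = (\<Prod>k=1..m j. real (nth_prime k)) powr (1 + \<epsilon> j)"
    and \<epsilon>_lim: "(\<exists>L>0. \<epsilon> \<longlonglongrightarrow> L) \<or> filterlim \<epsilon> at_top sequentially"
  shows "filterlim
           (\<lambda>j. exp euler_mascheroni * real (n j) * ln (ln (real (n j))) - real (divisor_sum (n j)))
           at_top sequentially"
proof -
  define x where "x = (\<lambda>j. nth_prime (m j))"
  define Q where "Q = (\<lambda>y. \<Prod>p\<in>primes_upto y. 1 / (1 - 1 / real p))"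
  obtain \<delta> where \<delta>: "\<delta> > 0" "eventually (\<lambda>j. \<epsilon> j \<ge> \<delta>) sequentially"
  proof (cases "filterlim \<epsilon> at_top sequentially")
    case True
    then show ?thesis using that[of 1] by (simp add: filterlim_at_top)
  next
    case False
    then obtain L where L: "L > 0" "\<epsilon> \<longlonglongrightarrow> L" using \<epsilon>_lim by blast
    have "eventually (\<lambda>j. \<epsilon> j > L / 2) sequentially" using L by (intro order_tendstoD(1)[OF L(2)]) simp
    hence "eventually (\<lambda>j. \<epsilon> j \<ge> L / 2) sequentially" by eventually_elim simp
    with L show ?thesis by (intro that[of "L / 2"]) auto
  qed
  \<comment> \<open>Half of the gain \<open>ln (1 + \<delta>)\<close> absorbs the error of the product estimate, the other half is left for the conclusion.\<close>
  define c where "c = ln (1 + \<delta>) / 2"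
  have c: "c > 0" using \<delta> by (simp add: c_def)
  obtain X where X: "\<And>y. y \<ge> X \<Longrightarrow> Q y \<le> exp euler_mascheroni * (ln (chebyshev_theta y) + c)"
    using mertens_product_le_ln_theta[OF c] by (auto simp: eventually_sequentially Q_def)

  have sigma_le: "real (divisor_sum (n j)) \<le> real (n j) * Q (x j)" if j: "j \<ge> 1" for j
  proof -
    have bij: "bij_betw nth_prime {1..m j} (primes_upto (x j))"
      unfolding x_def using m_ge_1[OF j] by (rule nth_prime_bij_betw)
    have "prime (nth_prime k)" if "k \<in> {1..m j}" for k
      using bij_betwE[OF bij] that by (auto simp: primes_upto_def)
    hence "real (divisor_sum (n j)) \<le> real (n j) * (\<Prod>k=1..m j. 1 / (1 - 1 / real (nth_prime k)))"
      unfolding n_eq[OF j] by (intro divisor_sum_prod_prime_powers_le) auto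
    also have "(\<Prod>k=1..m j. 1 / (1 - 1 / real (nth_prime k))) = Q (x j)"
      unfolding Q_def by (rule prod.reindex_bij_betw[OF bij])
    finally show ?thesis .
  qed
  have lnln: "ln (ln (real (n j))) = ln (1 + \<epsilon> j) + ln (chebyshev_theta (x j))" if j: "j \<ge> 1" "\<epsilon> j > 0" for j
  proof -
    have bij: "bij_betw nth_prime {1..m j} (primes_upto (x j))"
      unfolding x_def using m_ge_1[OF j(1)] by (rule nth_prime_bij_betw)
    have "(\<Prod>k=1..m j. real (nth_prime k)) = (\<Prod>p\<in>primes_upto (x j). real p)"
      by (rule prod.reindex_bij_betw[OF bij])
    moreover have "ln (\<Prod>p\<in>primes_upto (x j). real p) = chebyshev_theta (x j)"
      unfolding chebyshev_theta_altdef by (rule ln_prod) (auto simp: primes_upto_def intro: prime_gt_0_nat)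
    moreover have "(\<Prod>p\<in>primes_upto (x j). real p) > 0"
    proof (rule prod_pos)
      fix p assume "p \<in> primes_upto (x j)"
      hence "prime p" by (simp add: primes_upto_def)
      from prime_gt_0_nat[OF this] show "real p > 0" by simp
    qed
    ultimately have ln_n: "ln (real (n j)) = (1 + \<epsilon> j) * chebyshev_theta (x j)"
      unfolding \<epsilon>_def[OF j(1)] by (simp add: ln_powr)
    moreover have "ln (real (n j)) > 0" using n_ge_2[OF j(1)] by simp
    ultimately have "chebyshev_theta (x j) > 0" using j(2) by (simp add: zero_less_mult_iff)
    thus ?thesis unfolding ln_n using j(2) by (simp add: ln_mult)
  qed
  have Q_mono: "Q y \<le> Q z" if "y \<le> z" for y z
  proof -
    have "Q z = Q y * (\<Prod>p\<in>primes_upto z - primes_upto y. 1 / (1 - 1 / real p))"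
      unfolding Q_def using primes_upto_mono[OF that] by (subst prod.subset_diff[of "primes_upto y"]) (auto simp: mult.commute)
    moreover have "(\<Prod>p\<in>primes_upto z - primes_upto y. 1 / (1 - 1 / real p)) \<ge> 1"
      by (intro prod_ge_1) (auto simp: primes_upto_def field_simps dest: prime_gt_1_nat)
    moreover have "Q y \<ge> 0" unfolding Q_def 
      by (intro prod_nonneg) (auto simp: primes_upto_def dest: prime_gt_0_nat)
    ultimately show ?thesis using mult_left_mono[of 1 _ "Q y"] by fastforce
  qed

  have "filterlim (\<lambda>j. ln (ln (real (n j)))) at_top sequentially"
    by (intro filterlim_compose[OF ln_at_top] filterlim_compose[OF filterlim_real_sequentially] n_lim)
  hence "eventually (\<lambda>j. ln (ln (real (n j))) \<ge> (Q X + c) / exp euler_mascheroni) sequentially"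
    by (rule filterlim_at_top[THEN iffD1, rule_format])
  with \<delta>(2) eventually_ge_at_top[of 1]
  \<comment> \<open>The factor \<open>min 1 (exp euler_mascheroni)\<close> makes one lower bound serve both cases.\<close>
  have "eventually (\<lambda>j. exp euler_mascheroni * real (n j) * ln (ln (real (n j))) - real (divisor_sum (n j)) \<ge> c * min 1 (exp euler_mascheroni) * real (n j)) sequentially"
  proof eventually_elim
    case (elim j)
    have "Q (x j) + c * min 1 (exp euler_mascheroni) \<le> exp euler_mascheroni * ln (ln (real (n j)))"
    proof (cases "x j \<ge> X")
      case True
      have "ln (1 + \<epsilon> j) \<ge> 2 * c" unfolding c_def using elim(1) \<delta>(1) by simp
      hence "ln (chebyshev_theta (x j)) + c + c \<le> ln (ln (real (n j)))"
        using lnln[OF elim(2)] elim(1) \<delta>(1) by simp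
      hence "exp euler_mascheroni * (ln (chebyshev_theta (x j)) + c + c) \<le> exp euler_mascheroni * ln (ln (real (n j)))"
        by (intro mult_left_mono) auto
      moreover have "c * min 1 (exp euler_mascheroni) \<le> c * exp euler_mascheroni" using c by (intro mult_left_mono) auto
      ultimately show ?thesis using X[OF True] by (simp add: algebra_simps)
    next
      case False
      \<comment> \<open>Only finitely many values of \<open>Q\<close> occur here, and the growth of \<open>ln (ln n)\<close> decides.\<close>
      have "Q (x j) \<le> Q X" using False by (intro Q_mono) simp
      moreover have "c * min 1 (exp euler_mascheroni) \<le> c * 1" using c by (intro mult_left_mono) auto
      moreover have "Q X + c \<le> exp euler_mascheroni * ln (ln (real (n j)))"
        using elim(3) by (simp add: pos_divide_le_eq mult.commute)
      ultimately show ?thesis by linarith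
    qed
    hence "real (n j) * (Q (x j) + c * min 1 (exp euler_mascheroni)) \<le> real (n j) * (exp euler_mascheroni * ln (ln (real (n j))))"
      by (intro mult_left_mono) auto
    thus ?case using sigma_le[OF elim(2)] by (simp add: algebra_simps)
  qed
  moreover have "filterlim (\<lambda>j. c * min 1 (exp euler_mascheroni) * real (n j)) at_top sequentially"
    using c by (intro filterlim_tendsto_pos_mult_at_top[OF tendsto_const] filterlim_compose[OF filterlim_real_sequentially] n_lim) simp
  ultimately show ?thesis by (rule filterlim_at_top_mono[rotated])
qed

end
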